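(* Let $q$ be an odd prime power, $F=\mathbb F_q((\pi))$ with ring of integers $\mathcal O=\mathbb F_q[[\pi]]$, $G=Sp_4(F)$, $K=Sp_4(\mathcal O)$ and $\Gamma=Sp_4(\mathbb F_q[\pi^{-1}])$. For every $p\in(4,\infty]$ there exists a function $\phi_p\in C_0(\Gamma)$ such that for every finitely supported $f:\Gamma\to\mathbb C$ satisfying $f(\gamma)=f(\gamma')$ whenever $\gamma,\gamma'\in\Gamma$ and $\gamma\in K\gamma'K$, one has for all $\gamma\in\Gamma$ $$|f(\gamma)|\le\phi_p(\gamma)\,\|m_f\|_{MS^p(\ell^2\Gamma)}.$$
   Context: $Sp_4(R)=\{A\in M_{4\times4}(R):A^tJA=J\}$ with $J_{14}=J_{23}=1$, $J_{32}=J_{41}=-1$, other entries $0$. $m_f$ is the Schur multiplier $(T_{x,y})_{x,y\in\Gamma}\mapsto(f(x^{-1}y)T_{x,y})$ and $\|m_f\|_{MS^p(\ell^2\Gamma)}$ its (not necessarily completely bounded) operator norm on the Schatten class $S^p(\ell^2\Gamma)$, with $S^\infty$ the compact operators. *)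

theory Defs
  imports Complex_Main "HOL-Computational_Algebra.Formal_Laurent_Series" "HOL-Library.Extended_Real"
begin

type_synonym 'a m4 = "nat \<Rightarrow> nat \<Rightarrow> 'a"

definition is_m4 :: "('a::zero) m4 \<Rightarrow> bool" where
  "is_m4 A \<longleftrightarrow> (\<forall>i j. (4 \<le> i \<or> 4 \<le> j) \<longrightarrow> A i j = 0)"

definition m4_mult :: "('a::semiring_0) m4 \<Rightarrow> 'a m4 \<Rightarrow> 'a m4" where
  "m4_mult A B = (\<lambda>i j. if i < 4 \<and> j < 4 then (\<Sum>k<4. A i k * B k j) else 0)"

definition m4_transpose :: "'a m4 \<Rightarrow> 'a m4" where
  "m4_transpose A = (\<lambda>i j. A j i)"

definition m4_one :: "('a::{zero,one}) m4" where
  "m4_one = (\<lambda>i j. if i < 4 \<and> j < 4 \<and> i = j then 1 else 0)"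

text \<open>J with J_14 = J_23 = 1, J_32 = J_41 = -1 (1-based), shifted to 0-based indices.\<close>
definition J4 :: "('a::ring_1) m4" where
  "J4 = (\<lambda>i j. if (i,j) = (0,3) \<or> (i,j) = (1,2) then 1
              else if (i,j) = (2,1) \<or> (i,j) = (3,0) then -1 else 0)"

definition Sp4 :: "('a::comm_ring_1) set \<Rightarrow> 'a m4 set" where
  "Sp4 R = {A. is_m4 A \<and> (\<forall>i j. A i j \<in> R) \<and>
              m4_mult (m4_mult (m4_transpose A) J4) A = J4}"

definition m4_inv :: "('a::comm_ring_1) m4 \<Rightarrow> 'a m4" where
  "m4_inv A = (THE B. is_m4 B \<and> m4_mult B A = m4_one)"

definition double_coset :: "('a::comm_ring_1) m4 set \<Rightarrow> 'a m4 \<Rightarrow> 'a m4 set" where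
  "double_coset K g = {m4_mult (m4_mult k1 g) k2 | k1 k2. k1 \<in> K \<and> k2 \<in> K}"

definition power_series_ring :: "('a::zero) fls set" where
  "power_series_ring = {x. \<forall>n::int. n < 0 \<longrightarrow> fls_nth x n = 0}"

definition inv_poly_ring :: "('a::zero) fls set" where
  "inv_poly_ring = {x. \<forall>n::int. n > 0 \<longrightarrow> fls_nth x n = 0}"

definition unitary_on :: "'g set \<Rightarrow> ('g \<Rightarrow> 'g \<Rightarrow> complex) \<Rightarrow> bool" where
  "unitary_on A U \<longleftrightarrow>
     (\<forall>i\<in>A. \<forall>j\<in>A. (\<Sum>k\<in>A. cnj (U k i) * U k j) = (if i = j then 1 else 0))"

definition singular_values_on :: "'g set \<Rightarrow> ('g \<Rightarrow> 'g \<Rightarrow> complex) \<Rightarrow> ('g \<Rightarrow> real) \<Rightarrow> bool" where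
  "singular_values_on A T s \<longleftrightarrow> (\<forall>k\<in>A. 0 \<le> s k) \<and>
     (\<exists>U V. unitary_on A U \<and> unitary_on A V \<and>
        (\<forall>i\<in>A. \<forall>j\<in>A. T i j = (\<Sum>k\<in>A. U i k * complex_of_real (s k) * cnj (V j k))))"

definition schatten_norm :: "ereal \<Rightarrow> 'g set \<Rightarrow> ('g \<Rightarrow> 'g \<Rightarrow> complex) \<Rightarrow> real" where
  "schatten_norm p A T = (THE v. \<exists>s. singular_values_on A T s \<and>
      v = (if p = \<infinity> then Max (insert 0 (s ` A))
           else (\<Sum>k\<in>A. s k powr real_of_ereal p) powr (1 / real_of_ereal p)))"

text \<open>Operator norm on S^p(l^2 X) of the Schur multiplier with symbol M, computed as the
  supremum over finitely supported matrices (compressions to finite A \<subseteq> X).\<close>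
definition schur_mult_norm :: "ereal \<Rightarrow> 'g set \<Rightarrow> ('g \<Rightarrow> 'g \<Rightarrow> complex) \<Rightarrow> ereal" where
  "schur_mult_norm p X M = Sup {ereal (schatten_norm p A (\<lambda>x y. M x y * T x y)) | A T.
       finite A \<and> A \<subseteq> X \<and> schatten_norm p A T \<le> 1}"

end

theory Submission
  imports Defs "Jordan_Normal_Form.Spectral_Radius" "HOL-Analysis.L2_Norm"
begin

text \<open>Write \<open>t = 1/\<pi>\<close>. By the Cartan decomposition the values of \<open>f\<close> depend only on a pair of
  invariants \<open>i \<ge> j \<ge> 0\<close>: the maximal degrees in \<open>t\<close> of the entries and of the two by two minors are
  \<open>i\<close> and \<open>i + j\<close>. Given finite families \<open>x\<close>, \<open>y\<close> in \<open>\<Gamma>\<close> and a matrix \<open>T\<close> supported on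
  pairs for which \<open>x\<^sup>-\<^sup>1 y\<close> has one of two given types, with equal total mass \<open>1\<close> and \<open>- 1\<close>,
  pairing \<open>m\<^sub>f T\<close> with the constant vectors bounds the difference of the two values of \<open>f\<close> by
  \<open>\<parallel>m\<^sub>f\<parallel>\<close> times the normalised Schatten norm of \<open>T\<close>. In two families of unipotent elements the type is
  the degree of \<open>t\<^sup>n (y\<^sub>3 - x\<^sub>3) + x\<^sub>2 y\<^sub>2\<close> up to terms in \<open>x\<^sub>2\<close> or \<open>y\<^sub>2\<close> alone, a point-line
  incidence relation, whose matrix \<open>T\<close> has normalised operator norm of order \<open>q^(-n/2)\<close> and squared
  Hilbert--Schmidt norm of order \<open>q^n\<close>; hence its \<open>S\<^sup>p\<close> norm decays exactly when \<open>p > 4\<close>. The first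
  family compares \<open>(i, j)\<close> with \<open>(i, j + 1)\<close> (\<open>n = i - j\<close>), the second compares \<open>(i, j)\<close> with
  \<open>(i + 1, j - 1)\<close> (\<open>n = j\<close>). A zigzag of such moves leads to infinity, where \<open>f\<close> vanishes, and the
  errors sum to an exponentially small bound.\<close>

section \<open>Singular value decompositions on finite sets\<close>

text \<open>Averaging over K is the natural test in G, but \<Gamma> meets K only in constant
  matrices, so invariance can be exploited only by recognising the double coset of each product from
  its degrees. Moreover the norm is not completely bounded: rows and columns may not be amplified or
  repeated, so each family must be an injective parametrisation of elements of \<Gamma>. Unipotent
  polynomial matrices meet both demands. The signs of T are essential: they make two rows orthogonal
  unless their parameters nearly agree, which lowers the squared operator norm from order
  \<open>q^(2n)\<close> to \<open>q^n\<close>. Interpolation with the Hilbert-Schmidt norm then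
  gives the rate \<open>q^(n (2/p - 1/2))\<close>. Neither move suffices alone: raising j at fixed i
  stops at the wall i = j, where n = i - j vanishes, and lowering j along fixed i + j stops near j =
  0, where n = j vanishes. The path is therefore steered towards i = 2 j. Since
  \<open>schatten_norm\<close> is a definite description over singular value decompositions, their
  existence and the independence of the choice come before any estimate.\<close>

lemma left_inverse_imp_right_inverse_on:
  fixes B C :: "'g \<Rightarrow> 'g \<Rightarrow> 'a::field"
  assumes A: "finite A"
    and BC: "\<And>i j. i \<in> A \<Longrightarrow> j \<in> A \<Longrightarrow> (\<Sum>k\<in>A. B i k * C k j) = (if i = j then 1 else 0)"
    and ij: "i \<in> A" "j \<in> A"
  shows "(\<Sum>k\<in>A. C i k * B k j) = (if i = j then 1 else 0)"
proof -
  define n where "n = card A"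
  obtain e where e: "bij_betw e {0..<n} A"
    using ex_bij_betw_nat_finite[OF A] n_def by blast
  have inj: "e a = e b \<longleftrightarrow> a = b" if "a < n" "b < n" for a b
    using e that by (auto simp: bij_betw_def inj_on_def)
  have eA: "e a \<in> A" if "a < n" for a using e that by (auto simp: bij_betw_def)
  define MB where "MB = mat n n (\<lambda>(i,j). B (e i) (e j))"
  define MC where "MC = mat n n (\<lambda>(i,j). C (e i) (e j))"
  have c: "MB \<in> carrier_mat n n" "MC \<in> carrier_mat n n" by (auto simp: MB_def MC_def)
  have re: "(\<Sum>k\<in>A. g k) = (\<Sum>k\<in>{0..<n}. g (e k))" for g :: "'g \<Rightarrow> 'a"
    using sum.reindex_bij_betw[OF e, of g] by simp
  have "MB * MC = 1\<^sub>m n"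
  proof (rule eq_matI)
    fix a b assume "a < dim_row (1\<^sub>m n)" "b < dim_col (1\<^sub>m n)"
    hence ab: "a < n" "b < n" by auto
    have "(MB * MC) $$ (a,b) = (\<Sum>k\<in>{0..<n}. B (e a) (e k) * C (e k) (e b))"
      using ab by (simp add: MB_def MC_def scalar_prod_def)
    also have "\<dots> = (if e a = e b then 1 else 0)"
      using BC[OF eA[OF ab(1)] eA[OF ab(2)]] by (simp add: re)
    finally show "(MB * MC) $$ (a,b) = 1\<^sub>m n $$ (a,b)" using ab inj by simp
  qed (auto simp: MB_def MC_def)
  from mat_mult_left_right_inverse[OF c this] have CB: "MC * MB = 1\<^sub>m n" .
  obtain a b where ab: "a < n" "b < n" "i = e a" "j = e b"
    using e ij by (auto simp: bij_betw_def)
  have "(\<Sum>k\<in>A. C i k * B k j) = (MC * MB) $$ (a,b)"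
    using ab by (simp add: MB_def MC_def scalar_prod_def re)
  thus ?thesis using ab inj by (simp add: CB)
qed

text \<open>A square matrix and its transpose have the same determinant, so both have a kernel or
  neither has. The determinant is taken after an enumeration of \<open>A\<close> carries the matrix
  to \<open>carrier_mat n n\<close>.\<close>

lemma kernel_transpose_on:
  fixes M :: "'g \<Rightarrow> 'g \<Rightarrow> 'a::field"
  assumes A: "finite A"
    and d: "a \<in> A" "d a \<noteq> 0" "\<And>i. i \<in> A \<Longrightarrow> (\<Sum>j\<in>A. M i j * d j) = 0"
  obtains c b where "b \<in> A" "c b \<noteq> 0" "\<And>j. j \<in> A \<Longrightarrow> (\<Sum>i\<in>A. M i j * c i) = 0"
proof -
  define n where "n = card A"
  obtain e where e: "bij_betw e {0..<n} A"
    using ex_bij_betw_nat_finite[OF A] n_def by blast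
  have eA: "e a \<in> A" if "a < n" for a using e that by (auto simp: bij_betw_def)
  define e' where "e' = inv_into {0..<n} e"
  have e': "e' x < n" "e (e' x) = x" if "x \<in> A" for x
    using e that bij_betw_inv_into_right[OF e that] inv_into_into[of x e "{0..<n}"]
    by (auto simp: e'_def bij_betw_def)
  have e'e: "e' (e k) = k" if "k < n" for k
    using bij_betw_inv_into_left[OF e] that by (simp add: e'_def)
  have re: "(\<Sum>k\<in>A. g k) = (\<Sum>k\<in>{0..<n}. g (e k))" for g :: "'g \<Rightarrow> 'a"
    using sum.reindex_bij_betw[OF e, of g] by simp
  define MM where "MM = mat n n (\<lambda>(i,j). M (e i) (e j))"
  have c: "MM \<in> carrier_mat n n" "transpose_mat MM \<in> carrier_mat n n" by (auto simp: MM_def)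
  define v where "v = vec n (\<lambda>i. d (e i))"
  have "v \<in> carrier_vec n" "v \<noteq> 0\<^sub>v n" "MM *\<^sub>v v = 0\<^sub>v n"
  proof -
    show "v \<noteq> 0\<^sub>v n"
    proof
      assume "v = 0\<^sub>v n"
      hence "v $ (e' a) = 0" using e'[OF d(1)] by simp
      thus False using d e'[OF d(1)] by (simp add: v_def)
    qed
    show "MM *\<^sub>v v = 0\<^sub>v n"
      by (rule eq_vecI) (auto simp: MM_def v_def scalar_prod_def d(3)[OF eA, unfolded re])
  qed (simp add: v_def)
  hence "det MM = 0" using det_0_iff_vec_prod_zero_field[OF c(1)] by blast
  hence "det (transpose_mat MM) = 0" using det_transpose[OF c(1)] by simp
  then obtain w where w: "w \<in> carrier_vec n" "w \<noteq> 0\<^sub>v n" "transpose_mat MM *\<^sub>v w = 0\<^sub>v n"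
    using det_0_iff_vec_prod_zero_field[OF c(2)] by blast
  have "\<exists>k<n. w $ k \<noteq> 0"
  proof (rule ccontr)
    assume "\<not> ?thesis"
    hence "w = 0\<^sub>v n" using w(1) by (intro eq_vecI) auto
    thus False using w by simp
  qed
  then obtain k where k: "k < n" "w $ k \<noteq> 0" by blast
  show ?thesis
  proof (rule that[of "e k" "\<lambda>x. w $ (e' x)"])
    show "e k \<in> A" using k eA by simp
    show "w $ e' (e k) \<noteq> 0" using k e'e by simp
    fix j assume j: "j \<in> A"
    have "(\<Sum>i\<in>A. M i j * w $ e' i) = (\<Sum>i\<in>{0..<n}. M (e i) j * w $ i)"
      by (simp add: re e'e)
    also have "\<dots> = (transpose_mat MM *\<^sub>v w) $ (e' j)"
      using e'[OF j] w(1) by (simp add: MM_def scalar_prod_def)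
    finally show "(\<Sum>i\<in>A. M i j * w $ e' i) = 0" using w e'[OF j] by simp
  qed
qed

lemma eigenvector_exists_on:
  fixes M :: "'g \<Rightarrow> 'g \<Rightarrow> complex"
  assumes A: "finite A" "A \<noteq> {}"
  obtains l d a where "a \<in> A" "d a \<noteq> 0" "\<And>i. i \<in> A \<Longrightarrow> (\<Sum>j\<in>A. M i j * d j) = l * d i"
proof -
  define n where "n = card A"
  obtain e where e: "bij_betw e {0..<n} A"
    using ex_bij_betw_nat_finite[OF A(1)] n_def by blast
  have eA: "e a \<in> A" if "a < n" for a using e that by (auto simp: bij_betw_def)
  define e' where "e' = inv_into {0..<n} e"
  have e': "e' x < n" "e (e' x) = x" if "x \<in> A" for x
    using e that bij_betw_inv_into_right[OF e that] inv_into_into[of x e "{0..<n}"]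
    by (auto simp: e'_def bij_betw_def)
  have e'e: "e' (e k) = k" if "k < n" for k
    using bij_betw_inv_into_left[OF e] that by (simp add: e'_def)
  have re: "(\<Sum>k\<in>A. g k) = (\<Sum>k\<in>{0..<n}. g (e k))" for g :: "'g \<Rightarrow> complex"
    using sum.reindex_bij_betw[OF e, of g] by simp
  define MM where "MM = mat n n (\<lambda>(i,j). M (e i) (e j))"
  have c: "MM \<in> carrier_mat n n" by (auto simp: MM_def)
  have "spectrum MM \<noteq> {}" using spectrum_non_empty[OF c] A by (simp add: n_def card_gt_0_iff)
  then obtain l v where v: "eigenvector MM v l"
    by (auto simp: spectrum_def eigenvalue_def)
  hence v: "v \<in> carrier_vec n" "v \<noteq> 0\<^sub>v n" "MM *\<^sub>v v = l \<cdot>\<^sub>v v"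
    using c by (auto simp: eigenvector_def)
  have "\<exists>k<n. v $ k \<noteq> 0"
  proof (rule ccontr)
    assume "\<not> ?thesis"
    hence "v = 0\<^sub>v n" using v(1) by (intro eq_vecI) auto
    thus False using v by simp
  qed
  then obtain k where k: "k < n" "v $ k \<noteq> 0" by blast
  show ?thesis
  proof (rule that[of "e k" "\<lambda>x. v $ (e' x)" l])
    show "e k \<in> A" using k eA by simp
    show "v $ e' (e k) \<noteq> 0" using k e'e by simp
    fix i assume i: "i \<in> A"
    have "(\<Sum>j\<in>A. M i j * v $ e' j) = (\<Sum>j\<in>{0..<n}. M i (e j) * v $ j)"
      by (simp add: re e'e)
    also have "\<dots> = (MM *\<^sub>v v) $ (e' i)"
      using e'[OF i] v(1) by (simp add: MM_def scalar_prod_def)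
    finally show "(\<Sum>j\<in>A. M i j * v $ e' j) = l * v $ e' i" using v e'[OF i] by simp
  qed
qed

text \<open>Only the columns with index in \<open>B\<close> are constrained, so that an orthonormal
  system can grow one index at a time.\<close>

definition orthonormal_on :: "'g set \<Rightarrow> 'g set \<Rightarrow> ('g \<Rightarrow> 'g \<Rightarrow> complex) \<Rightarrow> bool" where
  "orthonormal_on A B U \<longleftrightarrow>
     (\<forall>i\<in>B. \<forall>j\<in>B. (\<Sum>k\<in>A. cnj (U k i) * U k j) = (if i = j then 1 else 0))"

lemma unitary_on_iff_orthonormal_on: "unitary_on A U \<longleftrightarrow> orthonormal_on A A U"
  by (simp add: unitary_on_def orthonormal_on_def)

lemma unitary_on_rows:
  assumes "finite A" "unitary_on A U" "i \<in> A" "j \<in> A"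
  shows "(\<Sum>k\<in>A. U i k * cnj (U j k)) = (if i = j then 1 else 0)"
  using left_inverse_imp_right_inverse_on[of A "\<lambda>i k. cnj (U k i)" U i j] assms
  by (auto simp: unitary_on_def)

lemma sum_cmod_square_pos:
  assumes "finite A" "b \<in> A" "c b \<noteq> (0::complex)"
  shows "(\<Sum>i\<in>A. (cmod (c i))\<^sup>2) > 0"
  using assms by (intro sum_pos2[of A b]) auto

lemma cnj_mult_self: "cnj z * z = complex_of_real ((cmod z)\<^sup>2)"
  using complex_norm_square[of z] by (simp add: mult.commute)

lemma normalise_on:
  assumes "finite A" "b \<in> A" "c b \<noteq> (0::complex)"
  obtains r :: real where "r > 0" "(\<Sum>i\<in>A. (cmod (c i / r))\<^sup>2) = 1"
proof -
  define r where "r = sqrt (\<Sum>i\<in>A. (cmod (c i))\<^sup>2)"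
  have r: "r > 0" "r\<^sup>2 = (\<Sum>i\<in>A. (cmod (c i))\<^sup>2)"
    using sum_cmod_square_pos[of A b c] assms by (auto simp: r_def)
  have "(\<Sum>i\<in>A. (cmod (c i / r))\<^sup>2) = (\<Sum>i\<in>A. (cmod (c i))\<^sup>2) / r\<^sup>2"
    using r(1) by (simp add: norm_divide power_divide sum_divide_distrib)
  also have "\<dots> = 1" using r(1) by (simp flip: r(2))
  finally show ?thesis using r that by blast
qed

lemma orthonormal_on_insert:
  assumes "orthonormal_on A B U" "k0 \<notin> B"
    and "\<And>k. k \<in> B \<Longrightarrow> (\<Sum>i\<in>A. cnj (U i k) * u i) = 0"
    and "(\<Sum>i\<in>A. (cmod (u i))\<^sup>2) = 1"
  shows "orthonormal_on A (insert k0 B) (\<lambda>a k. if k = k0 then u a else U a k)"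
proof -
  have 1: "(\<Sum>i\<in>A. cnj (u i) * U i k) = 0" if "k \<in> B" for k
  proof -
    have "(\<Sum>i\<in>A. cnj (u i) * U i k) = cnj (\<Sum>i\<in>A. cnj (U i k) * u i)"
      by (simp add: mult.commute)
    thus ?thesis using assms(3)[OF that] by simp
  qed
  have 2: "(\<Sum>i\<in>A. cnj (u i) * u i) = 1"
    using assms(4) by (simp only: cnj_mult_self of_real_sum[symmetric]) simp
  show ?thesis
    unfolding orthonormal_on_def
  proof (intro ballI)
    fix i j assume "i \<in> insert k0 B" "j \<in> insert k0 B"
    then consider "i = k0" "j = k0" | "i = k0" "j \<in> B" "j \<noteq> k0" | "i \<in> B" "i \<noteq> k0" "j = k0"
      | "i \<in> B" "j \<in> B" "i \<noteq> k0" "j \<noteq> k0" using assms(2) by blast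
    thus "(\<Sum>k\<in>A. cnj (if i = k0 then u k else U k i) * (if j = k0 then u k else U k j)) =
            (if i = j then 1 else 0)"
      using 1 2 assms(1,3) by cases (auto simp: orthonormal_on_def)
  qed
qed

lemma orthonormal_on_extend1:
  assumes A: "finite A" and B: "B \<subseteq> A" "orthonormal_on A B U" and k0: "k0 \<in> A" "k0 \<notin> B"
  obtains u where "orthonormal_on A (insert k0 B) (\<lambda>a k. if k = k0 then u a else U a k)"
proof -
  \<comment> \<open>Column \<open>k0\<close> of \<open>M\<close> is zero, so the basis vector at
    \<open>k0\<close> lies in its kernel. The transpose then kills some nonzero \<open>c\<close>,
    which says that \<open>c\<close> is orthogonal to the columns of \<open>U\<close> with index in
    \<open>B\<close>.\<close>
  define M where "M = (\<lambda>j i. if i \<in> B then cnj (U j i) else 0)"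
  obtain c b where cb: "b \<in> A" "c b \<noteq> 0" "\<And>j. j \<in> A \<Longrightarrow> (\<Sum>i\<in>A. M i j * c i) = 0"
  proof (rule kernel_transpose_on[of A k0 "\<lambda>k. if k = k0 then 1 else 0" M])
    fix i assume "i \<in> A"
    show "(\<Sum>j\<in>A. M i j * (if j = k0 then 1 else 0)) = 0"
      using k0 by (intro sum.neutral) (auto simp: M_def)
  qed (use A k0 in auto)
  obtain r :: real where r: "r > 0" "(\<Sum>i\<in>A. (cmod (c i / r))\<^sup>2) = 1"
    using normalise_on[of A b c, OF A cb(1,2)] .
  have "(\<Sum>i\<in>A. cnj (U i k) * (c i / r)) = 0" if "k \<in> B" for k
  proof -
    have "(\<Sum>i\<in>A. cnj (U i k) * c i) = 0"
      using cb(3)[of k] that B by (auto simp: M_def)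
    hence "(\<Sum>i\<in>A. cnj (U i k) * c i) / r = 0" by simp
    thus ?thesis by (simp add: sum_divide_distrib)
  qed
  thus ?thesis using r by (intro that[of "\<lambda>i. c i / r"] orthonormal_on_insert[OF B(2) k0(2)])
qed

lemma orthonormal_on_extend:
  assumes A: "finite A" and B: "B \<subseteq> A" "orthonormal_on A B U"
  obtains U' where "unitary_on A U'" "\<And>a k. k \<in> B \<Longrightarrow> U' a k = U a k"
proof -
  have "\<exists>U'. unitary_on A U' \<and> (\<forall>a. \<forall>k\<in>B. U' a k = U a k)"
    using B
  proof (induction "card (A - B)" arbitrary: B U rule: less_induct)
    case less
    show ?case
    proof (cases "B = A")
      case True
      thus ?thesis using less.prems by (auto simp: unitary_on_iff_orthonormal_on)
    next
      case False
      then obtain k0 where k0: "k0 \<in> A" "k0 \<notin> B" using less.prems by blast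
      obtain u where u: "orthonormal_on A (insert k0 B) (\<lambda>a k. if k = k0 then u a else U a k)"
        using orthonormal_on_extend1[OF A less.prems k0] .
      have "card (A - insert k0 B) < card (A - B)"
        by (rule psubset_card_mono) (use A k0 in auto)
      from less.hyps[OF this _ u] k0 less.prems obtain U' where
        "unitary_on A U'" "\<forall>a. \<forall>k\<in>insert k0 B. U' a k = (if k = k0 then u a else U a k)"
        by auto
      thus ?thesis using k0 by (intro exI[of _ U']) auto
    qed
  qed
  thus ?thesis using that by blast
qed

text \<open>\<open>d\<close> is a unit eigenvector of the Gram matrix of T, with eigenvalue the
  squared norm of T d, and \<open>c\<close> is T d normalised. If T d = 0, then T is singular and
  \<open>c\<close> is any unit vector in the kernel of the adjoint.\<close>

lemma singular_pair_on:
  fixes T :: "'g \<Rightarrow> 'g \<Rightarrow> complex"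
  assumes A: "finite A" "A \<noteq> {}"
  obtains s :: real and c d :: "'g \<Rightarrow> complex" where "s \<ge> 0" "(\<Sum>i\<in>A. (cmod (c i))\<^sup>2) = 1" "(\<Sum>i\<in>A. (cmod (d i))\<^sup>2) = 1"
    "\<And>i. i \<in> A \<Longrightarrow> (\<Sum>j\<in>A. T i j * d j) = s * c i"
    "\<And>j. j \<in> A \<Longrightarrow> (\<Sum>i\<in>A. cnj (T i j) * c i) = s * d j"
proof -
  obtain l d0 a where d0: "a \<in> A" "d0 a \<noteq> 0"
    "\<And>i. i \<in> A \<Longrightarrow> (\<Sum>j\<in>A. (\<Sum>k\<in>A. cnj (T k i) * T k j) * d0 j) = l * d0 i"
    by (rule eigenvector_exists_on[OF A, of "\<lambda>i j. \<Sum>k\<in>A. cnj (T k i) * T k j"], rule that)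
  obtain r :: real where r: "r > 0" "(\<Sum>i\<in>A. (cmod (d0 i / r))\<^sup>2) = 1"
    using normalise_on[of A a d0, OF A(1) d0(1,2)] .
  define d where "d = (\<lambda>i. d0 i / r)"
  have d1: "(\<Sum>i\<in>A. (cmod (d i))\<^sup>2) = 1" using r by (simp add: d_def)
  define w where "w = (\<lambda>i. \<Sum>j\<in>A. T i j * d j)"
  have Tw: "(\<Sum>i\<in>A. cnj (T i j) * w i) = l * d j" if j: "j \<in> A" for j
  proof -
    have "(\<Sum>i\<in>A. cnj (T i j) * w i) = (\<Sum>i\<in>A. \<Sum>k\<in>A. cnj (T i j) * T i k * d0 k / r)"
      by (simp add: w_def d_def sum_distrib_left mult.assoc)
    also have "\<dots> = (\<Sum>k\<in>A. \<Sum>i\<in>A. cnj (T i j) * T i k * d0 k / r)" by (rule sum.swap)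
    also have "\<dots> = (\<Sum>k\<in>A. (\<Sum>i\<in>A. cnj (T i j) * T i k) * d0 k) / r"
      by (simp add: sum_distrib_right sum_divide_distrib)
    also have "\<dots> = l * d j" using d0(3)[OF j] by (simp add: d_def)
    finally show ?thesis .
  qed
  have l: "l = complex_of_real (\<Sum>i\<in>A. (cmod (w i))\<^sup>2)"
  proof -
    have "complex_of_real (\<Sum>i\<in>A. (cmod (w i))\<^sup>2) = (\<Sum>i\<in>A. cnj (w i) * w i)"
      by (simp only: cnj_mult_self of_real_sum)
    also have "\<dots> = (\<Sum>i\<in>A. \<Sum>j\<in>A. cnj (T i j) * cnj (d j) * w i)"
      by (subst (1) w_def) (simp add: sum_distrib_right)
    also have "\<dots> = (\<Sum>j\<in>A. \<Sum>i\<in>A. cnj (T i j) * cnj (d j) * w i)" by (rule sum.swap)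
    also have "\<dots> = (\<Sum>j\<in>A. cnj (d j) * (\<Sum>i\<in>A. cnj (T i j) * w i))"
      by (simp add: sum_distrib_left mult_ac)
    also have "\<dots> = (\<Sum>j\<in>A. l * (cnj (d j) * d j))"
      by (intro sum.cong) (auto simp: Tw)
    also have "\<dots> = l * complex_of_real (\<Sum>i\<in>A. (cmod (d i))\<^sup>2)"
      by (simp only: cnj_mult_self of_real_sum sum_distrib_left)
    finally show ?thesis using d1 by simp
  qed
  define s where "s = sqrt (\<Sum>i\<in>A. (cmod (w i))\<^sup>2)"
  have s0: "s \<ge> 0" by (simp add: s_def sum_nonneg)
  have s2: "s\<^sup>2 = (\<Sum>i\<in>A. (cmod (w i))\<^sup>2)" by (simp add: s_def sum_nonneg)
  show ?thesis
  proof (cases "s = 0")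
    case False
    define c where "c = (\<lambda>i. w i / s)"
    show ?thesis
    proof (rule that[of s c d])
      have "(\<Sum>i\<in>A. (cmod (c i))\<^sup>2) = (\<Sum>i\<in>A. (cmod (w i))\<^sup>2) / s\<^sup>2"
        by (simp add: c_def norm_divide power_divide sum_divide_distrib)
      thus "(\<Sum>i\<in>A. (cmod (c i))\<^sup>2) = 1" using False by (simp flip: s2)
      show "(\<Sum>j\<in>A. T i j * d j) = s * c i" if "i \<in> A" for i
        using False by (simp add: c_def w_def)
      show "(\<Sum>i\<in>A. cnj (T i j) * c i) = s * d j" if "j \<in> A" for j
      proof -
        have "(\<Sum>i\<in>A. cnj (T i j) * c i) = (\<Sum>i\<in>A. cnj (T i j) * w i) / s"
          by (simp add: c_def sum_divide_distrib)
        also have "\<dots> = (complex_of_real (s\<^sup>2) * d j) / s" using Tw[OF that] l s2 by simp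
        finally show ?thesis using False by (simp add: power2_eq_square)
      qed
    qed (use s0 d1 in auto)
  next
    case True
    hence w0: "w i = 0" if "i \<in> A" for i
      using s2 A that by (simp add: sum_nonneg_eq_0_iff)
    have dn: "\<exists>a\<in>A. d a \<noteq> 0" using d0 r by (auto simp: d_def)
    then obtain a' where a': "a' \<in> A" "d a' \<noteq> 0" by blast
    obtain c b where cb: "b \<in> A" "c b \<noteq> 0" "\<And>j. j \<in> A \<Longrightarrow> (\<Sum>i\<in>A. T i j * c i) = 0"
      by (rule kernel_transpose_on[of A a' d T, OF A(1) a']) (use w0 in \<open>auto simp: w_def\<close>)
    obtain r' :: real where r': "r' > 0" "(\<Sum>i\<in>A. (cmod (c i / r'))\<^sup>2) = 1"
      using normalise_on[of A b c, OF A(1) cb(1,2)] .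
    show ?thesis
    proof (rule that[of 0 "\<lambda>i. cnj (c i / r')" d])
      show "(\<Sum>i\<in>A. cnj (T i j) * cnj (c i / r')) = complex_of_real 0 * d j" if "j \<in> A" for j
      proof -
        have "(\<Sum>i\<in>A. cnj (T i j) * cnj (c i / r')) = cnj ((\<Sum>i\<in>A. T i j * c i) / r')"
          by (simp add: sum_divide_distrib)
        thus ?thesis using cb(3)[OF that] by simp
      qed
    qed (use r' d1 w0 in \<open>auto simp: w_def norm_divide\<close>)
  qed
qed

text \<open>The adjoint sends the columns of \<open>U\<close> in \<open>B\<close> to multiples of
  those of \<open>V\<close> in \<open>B\<close>; hence T maps the orthogonal complement of the
  latter into that of the former. It acts there through its block in the two bases, so the relation
  \<open>blk\<close> lifts to T.\<close>

lemma block_image: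
  fixes T U V :: "'g \<Rightarrow> 'g \<Rightarrow> complex" and c d :: "'g \<Rightarrow> complex" and s :: "'g \<Rightarrow> real"
  assumes A: "finite A" and U: "unitary_on A U" and V: "unitary_on A V" and B: "B \<subseteq> A"
    and adj: "\<And>k j. k \<in> B \<Longrightarrow> j \<in> A \<Longrightarrow> (\<Sum>i\<in>A. cnj (T i j) * U i k) = s k * V j k"
    and blk: "\<And>k. k \<in> A - B \<Longrightarrow>
       (\<Sum>l\<in>A - B. (\<Sum>i\<in>A. \<Sum>j\<in>A. cnj (U i k) * T i j * V j l) * d l) = r * c k"
    and i: "i \<in> A"
  shows "(\<Sum>j\<in>A. T i j * (\<Sum>l\<in>A - B. d l * V j l)) = r * (\<Sum>k\<in>A - B. c k * U i k)"
proof -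
  define v where "v = (\<lambda>j. \<Sum>l\<in>A - B. d l * V j l)"
  define w where "w = (\<lambda>i. \<Sum>j\<in>A. T i j * v j)"
  define p where "p = (\<lambda>k. \<Sum>i\<in>A. cnj (U i k) * w i)"
  have pB: "p k = 0" if k: "k \<in> B" for k
  proof -
    have "p k = (\<Sum>i\<in>A. \<Sum>j\<in>A. cnj (U i k) * T i j * v j)"
      by (simp add: p_def w_def sum_distrib_left mult.assoc)
    also have "\<dots> = (\<Sum>j\<in>A. \<Sum>i\<in>A. cnj (U i k) * T i j * v j)" by (rule sum.swap)
    also have "\<dots> = (\<Sum>j\<in>A. cnj (\<Sum>i\<in>A. cnj (T i j) * U i k) * v j)"
      by (simp add: sum_distrib_left sum_distrib_right mult_ac)
    also have "\<dots> = (\<Sum>j\<in>A. s k * cnj (V j k) * v j)"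
      by (intro sum.cong refl) (simp only: adj[OF k], simp)
    also have "\<dots> = (\<Sum>j\<in>A. \<Sum>l\<in>A - B. s k * d l * (cnj (V j k) * V j l))"
      by (simp add: v_def sum_distrib_left mult_ac)
    also have "\<dots> = (\<Sum>l\<in>A - B. \<Sum>j\<in>A. s k * d l * (cnj (V j k) * V j l))" by (rule sum.swap)
    also have "\<dots> = (\<Sum>l\<in>A - B. s k * d l * (\<Sum>j\<in>A. cnj (V j k) * V j l))"
      by (simp add: sum_distrib_left)
    also have "\<dots> = 0"
    proof (intro sum.neutral ballI)
      fix l assume l: "l \<in> A - B"
      have "(\<Sum>j\<in>A. cnj (V j k) * V j l) = (if k = l then 1 else 0)"
        using V B k l unfolding unitary_on_def by blast
      thus "s k * d l * (\<Sum>j\<in>A. cnj (V j k) * V j l) = 0" using k l by auto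
    qed
    finally show ?thesis .
  qed
  have pC: "p k = r * c k" if k: "k \<in> A - B" for k
  proof -
    have "p k = (\<Sum>i\<in>A. \<Sum>j\<in>A. \<Sum>l\<in>A - B. cnj (U i k) * T i j * V j l * d l)"
      by (simp add: p_def w_def v_def sum_distrib_left mult_ac cong: sum.cong)
    also have "\<dots> = (\<Sum>i\<in>A. \<Sum>l\<in>A - B. \<Sum>j\<in>A. cnj (U i k) * T i j * V j l * d l)"
      by (rule sum.cong[OF refl], rule sum.swap)
    also have "\<dots> = (\<Sum>l\<in>A - B. \<Sum>i\<in>A. \<Sum>j\<in>A. cnj (U i k) * T i j * V j l * d l)"
      by (rule sum.swap)
    also have "\<dots> = r * c k" using blk[OF k] by (simp add: sum_distrib_right)
    finally show ?thesis .
  qed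
  have "w i = (\<Sum>i'\<in>A. (if i = i' then 1 else 0) * w i')"
    using A i by (simp add: if_distrib[of "\<lambda>x. x * _"] cong: if_cong)
  also have "\<dots> = (\<Sum>i'\<in>A. (\<Sum>k\<in>A. U i k * cnj (U i' k)) * w i')"
    using unitary_on_rows[OF A U i] by (intro sum.cong refl) simp
  also have "\<dots> = (\<Sum>i'\<in>A. \<Sum>k\<in>A. U i k * (cnj (U i' k) * w i'))"
    by (simp add: sum_distrib_right mult.assoc)
  also have "\<dots> = (\<Sum>k\<in>A. \<Sum>i'\<in>A. U i k * (cnj (U i' k) * w i'))" by (rule sum.swap)
  also have "\<dots> = (\<Sum>k\<in>A. U i k * p k)" by (simp add: p_def sum_distrib_left)
  also have "\<dots> = (\<Sum>k\<in>A - B. U i k * p k)"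
    using A B pB by (intro sum.mono_neutral_right) auto
  also have "\<dots> = (\<Sum>k\<in>A - B. r * (c k * U i k))"
    by (intro sum.cong) (auto simp: pC)
  finally show ?thesis by (simp add: w_def v_def sum_distrib_left)
qed

lemma unit_combination:
  assumes A: "finite A" and U: "unitary_on A U" and C: "C \<subseteq> A"
    and c: "(\<Sum>k\<in>C. (cmod (c k))\<^sup>2) = 1"
  shows "k \<in> A - C \<Longrightarrow> (\<Sum>i\<in>A. cnj (U i k) * (\<Sum>l\<in>C. c l * U i l)) = 0"
    and "(\<Sum>i\<in>A. (cmod (\<Sum>l\<in>C. c l * U i l))\<^sup>2) = 1"
proof -
  have ip: "(\<Sum>i\<in>A. cnj (U i k) * (\<Sum>l\<in>C. c l * U i l)) = (if k \<in> C then c k else 0)"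
    if k: "k \<in> A" for k
  proof -
    have "(\<Sum>i\<in>A. cnj (U i k) * (\<Sum>l\<in>C. c l * U i l))
        = (\<Sum>i\<in>A. \<Sum>l\<in>C. c l * (cnj (U i k) * U i l))"
      by (simp add: sum_distrib_left mult_ac)
    also have "\<dots> = (\<Sum>l\<in>C. \<Sum>i\<in>A. c l * (cnj (U i k) * U i l))" by (rule sum.swap)
    also have "\<dots> = (\<Sum>l\<in>C. c l * (\<Sum>i\<in>A. cnj (U i k) * U i l))" by (simp add: sum_distrib_left)
    also have "\<dots> = (\<Sum>l\<in>C. if l = k then c l else 0)"
      using U C k by (intro sum.cong) (auto simp: unitary_on_def)
    finally show ?thesis using finite_subset[OF C A] by simp
  qed
  show "(\<Sum>i\<in>A. cnj (U i k) * (\<Sum>l\<in>C. c l * U i l)) = 0" if "k \<in> A - C"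
    using ip[of k] that by simp
  define u where "u = (\<lambda>i. \<Sum>l\<in>C. c l * U i l)"
  have "complex_of_real (\<Sum>i\<in>A. (cmod (u i))\<^sup>2) = (\<Sum>i\<in>A. cnj (u i) * u i)"
    by (simp only: cnj_mult_self of_real_sum)
  also have "\<dots> = (\<Sum>i\<in>A. \<Sum>k\<in>C. cnj (c k) * (cnj (U i k) * u i))"
    by (subst (1) u_def) (simp add: sum_distrib_left sum_distrib_right mult_ac)
  also have "\<dots> = (\<Sum>k\<in>C. \<Sum>i\<in>A. cnj (c k) * (cnj (U i k) * u i))" by (rule sum.swap)
  also have "\<dots> = (\<Sum>k\<in>C. cnj (c k) * (\<Sum>i\<in>A. cnj (U i k) * u i))"
    by (simp add: sum_distrib_left)
  also have "\<dots> = (\<Sum>k\<in>C. cnj (c k) * c k)"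
    using ip C by (intro sum.cong) (auto simp: u_def)
  also have "\<dots> = complex_of_real (\<Sum>k\<in>C. (cmod (c k))\<^sup>2)"
    by (simp only: cnj_mult_self of_real_sum)
  finally show "(\<Sum>i\<in>A. (cmod (\<Sum>l\<in>C. c l * U i l))\<^sup>2) = 1"
    using c by (simp only: u_def of_real_eq_iff)
qed

text \<open>Deflation: once the pairs indexed by \<open>B\<close> are found, both systems are
  completed to unitary bases and a singular pair of the block on \<open>A - B\<close> is taken;
  \<open>block_image\<close>, applied to T and to its adjoint, turns it into the pair for one more
  index.\<close>

lemma singular_value_decomposition:
  fixes T :: "'g \<Rightarrow> 'g \<Rightarrow> complex"
  assumes A: "finite A"
  obtains s where "singular_values_on A T s"
proof -
  have "\<exists>U V s. orthonormal_on A B U \<and> orthonormal_on A B V \<and> (\<forall>k\<in>B. 0 \<le> s k \<and>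
      (\<forall>i\<in>A. (\<Sum>j\<in>A. T i j * V j k) = complex_of_real (s k) * U i k) \<and>
      (\<forall>j\<in>A. (\<Sum>i\<in>A. cnj (T i j) * U i k) = complex_of_real (s k) * V j k))"
    if "B \<subseteq> A" for B
    using finite_subset[OF that A] that
  proof (induction B rule: finite_induct)
    case empty
    show ?case by (simp add: orthonormal_on_def)
  next
    case (insert k0 B)
    then obtain U1 V1 s where ind: "orthonormal_on A B U1" "orthonormal_on A B V1"
      "\<forall>k\<in>B. 0 \<le> s k \<and>
      (\<forall>i\<in>A. (\<Sum>j\<in>A. T i j * V1 j k) = complex_of_real (s k) * U1 i k) \<and>
      (\<forall>j\<in>A. (\<Sum>i\<in>A. cnj (T i j) * U1 i k) = complex_of_real (s k) * V1 j k)" by auto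
    have BA: "B \<subseteq> A" "k0 \<in> A" using insert by auto
    obtain U where U: "unitary_on A U" "\<And>a k. k \<in> B \<Longrightarrow> U a k = U1 a k"
      by (rule orthonormal_on_extend[OF A BA(1) ind(1)], rule that)
    obtain V where V: "unitary_on A V" "\<And>a k. k \<in> B \<Longrightarrow> V a k = V1 a k"
      by (rule orthonormal_on_extend[OF A BA(1) ind(2)], rule that)
    have s: "0 \<le> s k" "i \<in> A \<Longrightarrow> (\<Sum>j\<in>A. T i j * V j k) = s k * U i k"
       "j \<in> A \<Longrightarrow> (\<Sum>i\<in>A. cnj (T i j) * U i k) = s k * V j k" if "k \<in> B" for k i j
      using ind(3) that by (auto simp: U V)
    define C where "C = A - B"
    have C: "finite C" "C \<noteq> {}" "C \<subseteq> A" "A - C = B" using A BA insert.hyps by (auto simp: C_def)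
    define T' where "T' = (\<lambda>k l. \<Sum>i\<in>A. \<Sum>j\<in>A. cnj (U i k) * T i j * V j l)"
    obtain s0 :: real and c d :: "'g \<Rightarrow> complex" where sp: "s0 \<ge> 0" "(\<Sum>i\<in>C. (cmod (c i))\<^sup>2) = 1"
      "(\<Sum>i\<in>C. (cmod (d i))\<^sup>2) = 1"
      "\<And>i. i \<in> C \<Longrightarrow> (\<Sum>j\<in>C. T' i j * d j) = s0 * c i"
      "\<And>j. j \<in> C \<Longrightarrow> (\<Sum>i\<in>C. cnj (T' i j) * c i) = s0 * d j"
      by (rule singular_pair_on[OF C(1,2), of T'], rule that)
    define u where "u = (\<lambda>i. \<Sum>k\<in>C. c k * U i k)"
    define v where "v = (\<lambda>i. \<Sum>k\<in>C. d k * V i k)"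
    have Tv: "(\<Sum>j\<in>A. T i j * v j) = s0 * u i" if "i \<in> A" for i
      using block_image[OF A U(1) V(1) BA(1), of T s d s0 c i] s sp that
      unfolding T'_def u_def v_def C_def by blast
    have Tu: "(\<Sum>i\<in>A. cnj (T i j) * u i) = s0 * v j" if "j \<in> A" for j
      unfolding u_def v_def C_def
    proof (rule block_image[OF A V(1) U(1) BA(1), of "\<lambda>i j. cnj (T j i)" s c s0 d j])
      show "(\<Sum>i\<in>A. cnj (cnj (T j i)) * V i k) = complex_of_real (s k) * U j k"
        if "k \<in> B" "j \<in> A" for k j using s that by simp
      fix k assume k: "k \<in> A - B"
      have "(\<Sum>i\<in>A. \<Sum>j\<in>A. cnj (V i k) * cnj (T j i) * U j l) = cnj (T' l k)" for l
      proof -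
        have "(\<Sum>i\<in>A. \<Sum>j\<in>A. cnj (V i k) * cnj (T j i) * U j l)
           = (\<Sum>j\<in>A. \<Sum>i\<in>A. cnj (V i k) * cnj (T j i) * U j l)" by (rule sum.swap)
        thus ?thesis by (simp add: T'_def mult_ac)
      qed
      thus "(\<Sum>l\<in>A - B. (\<Sum>i\<in>A. \<Sum>j\<in>A. cnj (V i k) * cnj (T j i) * U j l) * c l) = s0 * d k"
        using sp(5)[of k] k by (simp add: C_def)
    qed (fact that)
    have oU: "orthonormal_on A B U" and oV: "orthonormal_on A B V"
      using U(1) V(1) BA(1) unfolding unitary_on_iff_orthonormal_on orthonormal_on_def by blast+
    have "orthonormal_on A (insert k0 B) (\<lambda>a k. if k = k0 then u a else U a k)"
      using unit_combination[OF A U(1) C(3) sp(2)] C(4) insert.hyps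
      by (intro orthonormal_on_insert oU) (auto simp: u_def)
    moreover have "orthonormal_on A (insert k0 B) (\<lambda>a k. if k = k0 then v a else V a k)"
      using unit_combination[OF A V(1) C(3) sp(3)] C(4) insert.hyps
      by (intro orthonormal_on_insert oV) (auto simp: v_def)
    ultimately show ?case
      using s sp(1) Tv Tu
      by (intro exI[of _ "\<lambda>a k. if k = k0 then u a else U a k"]
            exI[of _ "\<lambda>a k. if k = k0 then v a else V a k"]
            exI[of _ "\<lambda>k. if k = k0 then s0 else s k"] conjI) auto
  qed
  from this[OF order_refl] obtain U V s where UV: "orthonormal_on A A U" "orthonormal_on A A V"
    and s': "\<forall>k\<in>A. 0 \<le> s k \<and>
      (\<forall>i\<in>A. (\<Sum>j\<in>A. T i j * V j k) = complex_of_real (s k) * U i k) \<and>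
      (\<forall>j\<in>A. (\<Sum>i\<in>A. cnj (T i j) * U i k) = complex_of_real (s k) * V j k)"
    by (elim exE conjE) (rule that)
  have s: "0 \<le> s k" "i \<in> A \<Longrightarrow> (\<Sum>j\<in>A. T i j * V j k) = complex_of_real (s k) * U i k"
    if "k \<in> A" for k i using s' that by auto
  note UV = UV[folded unitary_on_iff_orthonormal_on]
  have "T i j = (\<Sum>k\<in>A. U i k * s k * cnj (V j k))" if ij: "i \<in> A" "j \<in> A" for i j
  proof -
    have "(\<Sum>k\<in>A. U i k * s k * cnj (V j k)) = (\<Sum>k\<in>A. (\<Sum>l\<in>A. T i l * V l k) * cnj (V j k))"
      using s ij by (intro sum.cong) auto
    also have "\<dots> = (\<Sum>k\<in>A. \<Sum>l\<in>A. T i l * (V l k * cnj (V j k)))"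
      by (simp add: sum_distrib_right mult.assoc)
    also have "\<dots> = (\<Sum>l\<in>A. \<Sum>k\<in>A. T i l * (V l k * cnj (V j k)))" by (rule sum.swap)
    also have "\<dots> = (\<Sum>l\<in>A. T i l * (\<Sum>k\<in>A. V l k * cnj (V j k)))" by (simp add: sum_distrib_left)
    also have "\<dots> = (\<Sum>l\<in>A. T i l * (if l = j then 1 else 0))"
      using unitary_on_rows[OF A UV(2) _ ij(2)] by (intro sum.cong) auto
    finally show ?thesis
      using A ij by (simp add: if_distrib[of "\<lambda>x. _ * x"] cong: if_cong)
  qed
  hence "singular_values_on A T s"
    using UV s by (auto simp: singular_values_on_def)
  thus ?thesis by (rule that)
qed

section \<open>Schatten norms\<close>

lemma parseval_on:
  assumes A: "finite A" and V: "unitary_on A V"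
  shows "(\<Sum>l\<in>A. (cmod (\<Sum>j\<in>A. cnj (x j) * V j l))\<^sup>2) = (\<Sum>j\<in>A. (cmod (x j))\<^sup>2)"
proof -
  have "complex_of_real (\<Sum>l\<in>A. (cmod (\<Sum>j\<in>A. cnj (x j) * V j l))\<^sup>2)
      = (\<Sum>l\<in>A. cnj (\<Sum>j\<in>A. cnj (x j) * V j l) * (\<Sum>j\<in>A. cnj (x j) * V j l))"
    by (simp only: cnj_mult_self of_real_sum)
  also have "\<dots> = (\<Sum>l\<in>A. \<Sum>j\<in>A. \<Sum>i\<in>A. cnj (x i) * x j * (V i l * cnj (V j l)))"
    by (simp add: sum_product mult_ac)
  also have "\<dots> = (\<Sum>j\<in>A. \<Sum>l\<in>A. \<Sum>i\<in>A. cnj (x i) * x j * (V i l * cnj (V j l)))"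
    by (rule sum.swap)
  also have "\<dots> = (\<Sum>j\<in>A. \<Sum>i\<in>A. \<Sum>l\<in>A. cnj (x i) * x j * (V i l * cnj (V j l)))"
    by (rule sum.cong[OF refl], rule sum.swap)
  also have "\<dots> = (\<Sum>j\<in>A. \<Sum>i\<in>A. cnj (x i) * x j * (\<Sum>l\<in>A. V i l * cnj (V j l)))"
    by (simp add: sum_distrib_left)
  also have "\<dots> = (\<Sum>j\<in>A. \<Sum>i\<in>A. if i = j then cnj (x j) * x j else 0)"
    by (intro sum.cong refl) (auto simp: unitary_on_rows[OF A V])
  also have "\<dots> = (\<Sum>j\<in>A. cnj (x j) * x j)" using A by simp
  also have "\<dots> = complex_of_real (\<Sum>j\<in>A. (cmod (x j))\<^sup>2)"
    by (simp only: cnj_mult_self of_real_sum)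
  finally show ?thesis by (simp only: of_real_eq_iff)
qed

lemma singular_values_onE:
  assumes A: "finite A" and "singular_values_on A T s"
  obtains U V where "unitary_on A U" "unitary_on A V" "\<And>k. k \<in> A \<Longrightarrow> 0 \<le> s k"
    "\<And>i j. i \<in> A \<Longrightarrow> j \<in> A \<Longrightarrow> T i j = (\<Sum>k\<in>A. U i k * complex_of_real (s k) * cnj (V j k))"
    "\<And>i l. i \<in> A \<Longrightarrow> l \<in> A \<Longrightarrow> (\<Sum>j\<in>A. T i j * V j l) = complex_of_real (s l) * U i l"
    "\<And>j l. j \<in> A \<Longrightarrow> l \<in> A \<Longrightarrow> (\<Sum>i\<in>A. cnj (T i j) * U i l) = complex_of_real (s l) * V j l"
proof -
  from assms obtain U V where U: "unitary_on A U" and V: "unitary_on A V"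
    and s: "\<forall>k\<in>A. 0 \<le> s k"
    and T: "\<forall>i\<in>A. \<forall>j\<in>A. T i j = (\<Sum>k\<in>A. U i k * complex_of_real (s k) * cnj (V j k))"
    unfolding singular_values_on_def by blast
  show ?thesis
  proof (rule that[OF U V])
    fix i l assume il: "i \<in> A" "l \<in> A"
    have "(\<Sum>j\<in>A. T i j * V j l) = (\<Sum>j\<in>A. \<Sum>k\<in>A. U i k * s k * (cnj (V j k) * V j l))"
      using T il by (intro sum.cong refl) (simp add: sum_distrib_right mult.assoc)
    also have "\<dots> = (\<Sum>k\<in>A. \<Sum>j\<in>A. U i k * s k * (cnj (V j k) * V j l))" by (rule sum.swap)
    also have "\<dots> = (\<Sum>k\<in>A. U i k * s k * (\<Sum>j\<in>A. cnj (V j k) * V j l))"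
      by (simp add: sum_distrib_left)
    also have "\<dots> = (\<Sum>k\<in>A. if k = l then U i k * s k else 0)"
      using V il unfolding unitary_on_def by (intro sum.cong refl) auto
    finally show "(\<Sum>j\<in>A. T i j * V j l) = complex_of_real (s l) * U i l" using A il by simp
  next
    fix j l assume il: "j \<in> A" "l \<in> A"
    have "(\<Sum>i\<in>A. cnj (T i j) * U i l) = (\<Sum>i\<in>A. \<Sum>k\<in>A. V j k * s k * (cnj (U i k) * U i l))"
      using T il by (intro sum.cong refl) (simp add: sum_distrib_left sum_distrib_right mult_ac)
    also have "\<dots> = (\<Sum>k\<in>A. \<Sum>i\<in>A. V j k * s k * (cnj (U i k) * U i l))" by (rule sum.swap)
    also have "\<dots> = (\<Sum>k\<in>A. V j k * s k * (\<Sum>i\<in>A. cnj (U i k) * U i l))"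
      by (simp add: sum_distrib_left)
    also have "\<dots> = (\<Sum>k\<in>A. if k = l then V j k * s k else 0)"
      using U il unfolding unitary_on_def by (intro sum.cong refl) auto
    finally show "(\<Sum>i\<in>A. cnj (T i j) * U i l) = complex_of_real (s l) * V j l" using A il by simp
  qed (use s T in auto)
qed

lemma unitary_on_col_norm:
  assumes "unitary_on A U" "l \<in> A"
  shows "(\<Sum>i\<in>A. (cmod (U i l))\<^sup>2) = 1"
proof -
  have "complex_of_real (\<Sum>i\<in>A. (cmod (U i l))\<^sup>2) = (\<Sum>i\<in>A. cnj (U i l) * U i l)"
    by (simp only: cnj_mult_self of_real_sum)
  also have "\<dots> = 1" using assms by (auto simp: unitary_on_def)
  finally show ?thesis by (simp only: of_real_eq_1_iff)
qed

text \<open>Both right singular bases diagonalise the same Gram matrix, so the change of basis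
  \<open>W\<close> connects only equal singular values. The squared moduli of \<open>W\<close> are
  doubly stochastic, hence sums of any function of the singular values agree. This gives the
  definite description in \<open>schatten_norm\<close> a meaning.\<close>

lemma singular_values_on_unique:
  fixes g :: "real \<Rightarrow> real"
  assumes A: "finite A" and s: "singular_values_on A T s" and s': "singular_values_on A T s'"
  shows "(\<Sum>k\<in>A. g (s k)) = (\<Sum>k\<in>A. g (s' k))" and "s ` A \<subseteq> s' ` A"
proof -
  obtain U V where UV: "unitary_on A U" "unitary_on A V" "\<And>k. k \<in> A \<Longrightarrow> 0 \<le> s k"
    "\<And>i l. i \<in> A \<Longrightarrow> l \<in> A \<Longrightarrow> (\<Sum>j\<in>A. T i j * V j l) = complex_of_real (s l) * U i l"
    "\<And>j l. j \<in> A \<Longrightarrow> l \<in> A \<Longrightarrow> (\<Sum>i\<in>A. cnj (T i j) * U i l) = complex_of_real (s l) * V j l"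
    by (rule singular_values_onE[OF A s]) blast
  obtain U' V' where UV': "unitary_on A U'" "unitary_on A V'" "\<And>k. k \<in> A \<Longrightarrow> 0 \<le> s' k"
    "\<And>i l. i \<in> A \<Longrightarrow> l \<in> A \<Longrightarrow> (\<Sum>j\<in>A. T i j * V' j l) = complex_of_real (s' l) * U' i l"
    "\<And>j l. j \<in> A \<Longrightarrow> l \<in> A \<Longrightarrow> (\<Sum>i\<in>A. cnj (T i j) * U' i l) = complex_of_real (s' l) * V' j l"
    by (rule singular_values_onE[OF A s']) blast
  define W where "W = (\<lambda>k l. \<Sum>j\<in>A. cnj (V j k) * V' j l)"
  have W: "s k = s' l" if kl: "k \<in> A" "l \<in> A" and nz: "W k l \<noteq> 0" for k l
  proof -
    define X where "X = (\<Sum>i\<in>A. \<Sum>j\<in>A. cnj (s k * U i k) * T i j * V' j l)"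
    have "X = (\<Sum>j\<in>A. \<Sum>i\<in>A. cnj (s k * U i k) * T i j * V' j l)"
      unfolding X_def by (rule sum.swap)
    also have "\<dots> = (\<Sum>j\<in>A. s k * cnj (\<Sum>i\<in>A. cnj (T i j) * U i k) * V' j l)"
      by (simp add: sum_distrib_left sum_distrib_right mult_ac)
    also have "\<dots> = (\<Sum>j\<in>A. s k * cnj (s k * V j k) * V' j l)"
      using UV(5) kl by (intro sum.cong refl) (simp only:)
    also have "\<dots> = s k * s k * W k l" by (simp add: W_def sum_distrib_left mult_ac)
    finally have X1: "X = s k * s k * W k l" .
    have "X = (\<Sum>i\<in>A. \<Sum>j\<in>A. cnj (\<Sum>j\<in>A. T i j * V j k) * T i j * V' j l)"
      unfolding X_def using UV(4) kl by (intro sum.cong refl) (simp only:)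
    also have "\<dots> = (\<Sum>i\<in>A. cnj (\<Sum>j\<in>A. T i j * V j k) * (\<Sum>j\<in>A. T i j * V' j l))"
      by (simp only: sum_distrib_left mult.assoc)
    also have "\<dots> = (\<Sum>i\<in>A. cnj (\<Sum>j\<in>A. T i j * V j k) * (s' l * U' i l))"
      using UV'(4) kl by (intro sum.cong refl) (simp only:)
    also have "\<dots> = (\<Sum>i\<in>A. \<Sum>j\<in>A. s' l * cnj (V j k) * (cnj (T i j) * U' i l))"
      by (simp add: sum_distrib_left sum_distrib_right mult_ac)
    also have "\<dots> = (\<Sum>j\<in>A. \<Sum>i\<in>A. s' l * cnj (V j k) * (cnj (T i j) * U' i l))"
      by (rule sum.swap)
    also have "\<dots> = (\<Sum>j\<in>A. s' l * cnj (V j k) * (\<Sum>i\<in>A. cnj (T i j) * U' i l))"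
      by (simp only: sum_distrib_left)
    also have "\<dots> = (\<Sum>j\<in>A. s' l * cnj (V j k) * (s' l * V' j l))"
      using UV'(5) kl by (intro sum.cong refl) (simp only:)
    also have "\<dots> = s' l * s' l * W k l" by (simp add: W_def sum_distrib_left mult_ac)
    finally have "complex_of_real (s k * s k) = complex_of_real (s' l * s' l)"
      using X1 nz by simp
    hence "(s k)\<^sup>2 = (s' l)\<^sup>2" by (simp only: of_real_eq_iff power2_eq_square)
    thus ?thesis using UV(3)[OF kl(1)] UV'(3)[OF kl(2)] by (simp add: power2_eq_iff_nonneg)
  qed
  have row: "(\<Sum>l\<in>A. (cmod (W k l))\<^sup>2) = 1" if "k \<in> A" for k
    unfolding W_def parseval_on[OF A UV'(2)] using unitary_on_col_norm[OF UV(2) that] .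
  have col: "(\<Sum>k\<in>A. (cmod (W k l))\<^sup>2) = 1" if "l \<in> A" for l
  proof -
    have "cmod (W k l) = cmod (\<Sum>j\<in>A. cnj (V' j l) * V j k)" for k
    proof -
      have "W k l = cnj (\<Sum>j\<in>A. cnj (V' j l) * V j k)" by (simp add: W_def mult.commute)
      thus ?thesis by (simp only: complex_mod_cnj)
    qed
    thus ?thesis
      using parseval_on[OF A UV(2), of "\<lambda>j. V' j l"] unitary_on_col_norm[OF UV'(2) that] by simp
  qed
  have "(\<Sum>k\<in>A. g (s k)) = (\<Sum>k\<in>A. g (s k) * (\<Sum>l\<in>A. (cmod (W k l))\<^sup>2))"
    using row by simp
  also have "\<dots> = (\<Sum>k\<in>A. \<Sum>l\<in>A. g (s k) * (cmod (W k l))\<^sup>2)" by (simp add: sum_distrib_left)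
  also have "\<dots> = (\<Sum>k\<in>A. \<Sum>l\<in>A. g (s' l) * (cmod (W k l))\<^sup>2)"
    using W by (intro sum.cong refl) (metis mult_zero_right norm_zero zero_power2)
  also have "\<dots> = (\<Sum>l\<in>A. \<Sum>k\<in>A. g (s' l) * (cmod (W k l))\<^sup>2)" by (rule sum.swap)
  also have "\<dots> = (\<Sum>l\<in>A. g (s' l))" using col by (simp add: sum_distrib_left[symmetric])
  finally show "(\<Sum>k\<in>A. g (s k)) = (\<Sum>k\<in>A. g (s' k))" .
  show "s ` A \<subseteq> s' ` A"
  proof
    fix x assume "x \<in> s ` A"
    then obtain k where k: "k \<in> A" "x = s k" by blast
    have "\<exists>l\<in>A. W k l \<noteq> 0"
      using row[OF k(1)] by (metis (no_types, lifting) norm_zero sum.neutral zero_neq_one zero_power2)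
    thus "x \<in> s' ` A" using W k by blast
  qed
qed

lemma schatten_norm_eq:
  assumes A: "finite A" and s: "singular_values_on A T s"
  shows "schatten_norm p A T = (if p = \<infinity> then Max (insert 0 (s ` A))
           else (\<Sum>k\<in>A. s k powr real_of_ereal p) powr (1 / real_of_ereal p))"
  unfolding schatten_norm_def
proof (rule the_equality)
  fix v assume "\<exists>s. singular_values_on A T s \<and> v = (if p = \<infinity> then Max (insert 0 (s ` A))
           else (\<Sum>k\<in>A. s k powr real_of_ereal p) powr (1 / real_of_ereal p))"
  then obtain s' where s': "singular_values_on A T s'" and v: "v = (if p = \<infinity> then Max (insert 0 (s' ` A))
           else (\<Sum>k\<in>A. s' k powr real_of_ereal p) powr (1 / real_of_ereal p))" by blast
  have "s ` A = s' ` A"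
    using singular_values_on_unique(2)[OF A s s'] singular_values_on_unique(2)[OF A s' s] by blast
  thus "v = (if p = \<infinity> then Max (insert 0 (s ` A))
           else (\<Sum>k\<in>A. s k powr real_of_ereal p) powr (1 / real_of_ereal p))"
    unfolding v using singular_values_on_unique(1)[OF A s s', of "\<lambda>x. x powr real_of_ereal p"] by simp
qed (use s in auto)

lemma singular_value_le_schatten_norm:
  assumes A: "finite A" and s: "singular_values_on A T s" and p: "0 < p" and k: "k \<in> A"
  shows "s k \<le> schatten_norm p A T"
proof (cases "p = \<infinity>")
  case True
  thus ?thesis using A k by (simp add: schatten_norm_eq[OF A s])
next
  case False
  then obtain r where r: "p = ereal r" "0 < r" using p by (cases p) auto
  have s0: "0 \<le> s k" using s k by (auto simp: singular_values_on_def)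
  have "s k = (s k powr r) powr (1 / r)" using r s0 by (simp add: powr_powr)
  also have "\<dots> \<le> (\<Sum>k\<in>A. s k powr r) powr (1 / r)"
    using r A k by (intro powr_mono2 member_le_sum) auto
  finally show ?thesis using r by (simp add: schatten_norm_eq[OF A s])
qed

text \<open>The sum is the pairing of T with the indicator vectors of \<open>X\<close> and
  \<open>Y\<close>, whose lengths are the two square roots. Expanding them in the singular bases and
  using Cauchy-Schwarz bounds it by the largest singular value, which every Schatten norm
  dominates.\<close>

lemma schatten_norm_ge:
  assumes A: "finite A" and XY: "X \<subseteq> A" "Y \<subseteq> A" and p: "0 < p"
  shows "cmod (\<Sum>x\<in>X. \<Sum>y\<in>Y. T x y) \<le> schatten_norm p A T * (sqrt (card X) * sqrt (card Y))"
proof -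
  obtain s where s: "singular_values_on A T s" using singular_value_decomposition[OF A] by blast
  obtain U V where UV: "unitary_on A U" "unitary_on A V" "\<And>k. k \<in> A \<Longrightarrow> 0 \<le> s k"
    "\<And>i j. i \<in> A \<Longrightarrow> j \<in> A \<Longrightarrow> T i j = (\<Sum>k\<in>A. U i k * complex_of_real (s k) * cnj (V j k))"
    by (rule singular_values_onE[OF A s]) blast
  define a where "a = (\<lambda>k. \<Sum>x\<in>X. U x k)"
  define b where "b = (\<lambda>k. \<Sum>y\<in>Y. V y k)"
  define \<sigma> where "\<sigma> = schatten_norm p A T"
  have coef: "(\<Sum>k\<in>A. (cmod (\<Sum>x\<in>Z. W x k))\<^sup>2) = real (card Z)"
    if W: "unitary_on A W" and Z: "Z \<subseteq> A" for W Z
  proof -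
    have "(\<Sum>x\<in>Z. W x k) = (\<Sum>j\<in>A. cnj (if j \<in> Z then 1 else 0) * W j k)" for k
      using Z A by (simp add: if_distrib[of "\<lambda>x. cnj x * _"] sum.If_cases Int_absorb1 cong: if_cong)
    hence "(\<Sum>k\<in>A. (cmod (\<Sum>x\<in>Z. W x k))\<^sup>2) = (\<Sum>j\<in>A. (cmod (if j \<in> Z then 1 else 0))\<^sup>2)"
      using parseval_on[OF A W, of "\<lambda>j. if j \<in> Z then 1 else 0"] by simp
    also have "\<dots> = real (card Z)"
      using Z A by (simp add: if_distrib[of cmod] if_distrib[of "\<lambda>x. x\<^sup>2"] sum.If_cases Int_absorb1 cong: if_cong)
    finally show ?thesis .
  qed
  have "(\<Sum>x\<in>X. \<Sum>y\<in>Y. T x y) = (\<Sum>x\<in>X. \<Sum>y\<in>Y. \<Sum>k\<in>A. s k * (U x k * cnj (V y k)))"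
    using UV(4) XY by (intro sum.cong refl) (auto simp: mult_ac intro!: sum.cong)
  also have "\<dots> = (\<Sum>x\<in>X. \<Sum>k\<in>A. \<Sum>y\<in>Y. s k * (U x k * cnj (V y k)))"
    by (rule sum.cong[OF refl], rule sum.swap)
  also have "\<dots> = (\<Sum>k\<in>A. \<Sum>x\<in>X. \<Sum>y\<in>Y. s k * (U x k * cnj (V y k)))" by (rule sum.swap)
  also have "\<dots> = (\<Sum>k\<in>A. s k * (a k * cnj (b k)))"
  proof -
    have "a k * cnj (b k) = (\<Sum>x\<in>X. \<Sum>y\<in>Y. U x k * cnj (V y k))" for k
      by (simp only: a_def b_def cnj_sum sum_product)
    thus ?thesis by (simp only: sum_distrib_left)
  qed
  finally have "cmod (\<Sum>x\<in>X. \<Sum>y\<in>Y. T x y) \<le> (\<Sum>k\<in>A. cmod (s k * (a k * cnj (b k))))"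
    by (simp add: sum_norm_le)
  also have "\<dots> \<le> (\<Sum>k\<in>A. \<sigma> * (cmod (a k) * cmod (b k)))"
    using UV(3) singular_value_le_schatten_norm[OF A s p]
    by (intro sum_mono) (auto simp: norm_mult \<sigma>_def intro!: mult_right_mono)
  also have "\<dots> = \<sigma> * (\<Sum>k\<in>A. \<bar>cmod (a k)\<bar> * \<bar>cmod (b k)\<bar>)" by (simp add: sum_distrib_left)
  also have "\<dots> \<le> \<sigma> * (L2_set (\<lambda>k. cmod (a k)) A * L2_set (\<lambda>k. cmod (b k)) A)"
  proof (rule mult_left_mono[OF L2_set_mult_ineq])
    show "0 \<le> \<sigma>"
      unfolding \<sigma>_def schatten_norm_eq[OF A s] using A by (auto intro: Max_ge)
  qed
  also have "\<dots> = \<sigma> * (sqrt (card X) * sqrt (card Y))"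
    using coef[OF UV(1) XY(1)] coef[OF UV(2) XY(2)] by (simp add: L2_set_def a_def b_def)
  finally show ?thesis by (simp add: \<sigma>_def)
qed

text \<open>Schur's test for T times its adjoint bounds each squared singular value by
  \<open>R\<close>. Then s^r is at most \<open>R^((r - 2) / 2)\<close> times s^2, and the squares
  add up to the squared Hilbert-Schmidt norm.\<close>

lemma schatten_norm_le:
  assumes A: "finite A" and p: "2 < p"
    and R: "\<And>x. x \<in> A \<Longrightarrow> (\<Sum>x'\<in>A. cmod (\<Sum>y\<in>A. T x y * cnj (T x' y))) \<le> R"
    and R0: "0 \<le> R"
    and S: "(\<Sum>x\<in>A. \<Sum>y\<in>A. (cmod (T x y))\<^sup>2) \<le> S"
  shows "schatten_norm p A T \<le> (if p = \<infinity> then sqrt R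
    else (R powr ((real_of_ereal p - 2) / 2) * S) powr (1 / real_of_ereal p))"
proof -
  obtain s where s: "singular_values_on A T s" using singular_value_decomposition[OF A] by blast
  obtain U V where UV: "unitary_on A U" "unitary_on A V" "\<And>k. k \<in> A \<Longrightarrow> 0 \<le> s k"
    "\<And>i l. i \<in> A \<Longrightarrow> l \<in> A \<Longrightarrow> (\<Sum>j\<in>A. T i j * V j l) = complex_of_real (s l) * U i l"
    "\<And>j l. j \<in> A \<Longrightarrow> l \<in> A \<Longrightarrow> (\<Sum>i\<in>A. cnj (T i j) * U i l) = complex_of_real (s l) * V j l"
    by (rule singular_values_onE[OF A s]) blast
  have sR: "s k \<le> sqrt R" if k: "k \<in> A" for k
  proof -
    \<comment> \<open>The eigenvector equation for s^2 is evaluated at a coordinate where the left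
      singular vector has maximal modulus; there it compares s^2 with a single row sum.\<close>
    define m where "m = Max ((\<lambda>x. cmod (U x k)) ` A)"
    have "m \<in> (\<lambda>x. cmod (U x k)) ` A" unfolding m_def using A k by (intro Max_in) auto
    then obtain x where x: "x \<in> A" "m = cmod (U x k)" by blast
    have mx: "cmod (U x' k) \<le> m" if "x' \<in> A" for x'
      unfolding m_def using A that by (intro Max_ge) auto
    have "m \<noteq> 0"
    proof
      assume "m = 0"
      hence "cmod (U x' k) = 0" if "x' \<in> A" for x' using mx[OF that] by simp
      thus False using unitary_on_col_norm[OF UV(1) k] by simp
    qed
    hence m: "m > 0" using x by simp
    have "(\<Sum>x'\<in>A. (\<Sum>y\<in>A. T x y * cnj (T x' y)) * U x' k)
        = (\<Sum>x'\<in>A. \<Sum>y\<in>A. T x y * (cnj (T x' y) * U x' k))"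
      by (simp only: sum_distrib_right mult.assoc)
    also have "\<dots> = (\<Sum>y\<in>A. \<Sum>x'\<in>A. T x y * (cnj (T x' y) * U x' k))" by (rule sum.swap)
    also have "\<dots> = (\<Sum>y\<in>A. T x y * (\<Sum>x'\<in>A. cnj (T x' y) * U x' k))"
      by (simp only: sum_distrib_left)
    also have "\<dots> = (\<Sum>y\<in>A. s k * (T x y * V y k))"
      using UV(5) k by (intro sum.cong refl) simp
    also have "\<dots> = s k * (s k * U x k)"
      by (simp only: sum_distrib_left[symmetric] UV(4)[OF x(1) k])
    finally have "(s k)\<^sup>2 * m = cmod (\<Sum>x'\<in>A. (\<Sum>y\<in>A. T x y * cnj (T x' y)) * U x' k)"
      using UV(3)[OF k] x by (simp add: norm_mult power2_eq_square)
    also have "\<dots> \<le> (\<Sum>x'\<in>A. cmod (\<Sum>y\<in>A. T x y * cnj (T x' y)) * m)"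
      by (rule sum_norm_le) (auto simp: norm_mult intro!: mult_left_mono mx)
    also have "\<dots> \<le> R * m" using R[OF x(1)] m by (simp add: sum_distrib_right[symmetric])
    finally have "(s k)\<^sup>2 \<le> R" using m by simp
    thus ?thesis using real_le_rsqrt by blast
  qed
  have s2: "(\<Sum>k\<in>A. (s k)\<^sup>2) \<le> S"
  proof -
    have "(\<Sum>x\<in>A. \<Sum>y\<in>A. (cmod (T x y))\<^sup>2) = (\<Sum>x\<in>A. \<Sum>l\<in>A. (s l)\<^sup>2 * (cmod (U x l))\<^sup>2)"
    proof (rule sum.cong[OF refl])
      fix x assume x: "x \<in> A"
      have "(\<Sum>y\<in>A. (cmod (T x y))\<^sup>2) = (\<Sum>l\<in>A. (cmod (\<Sum>j\<in>A. T x j * V j l))\<^sup>2)"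
        using parseval_on[OF A UV(2), of "\<lambda>j. cnj (T x j)"] by simp
      also have "\<dots> = (\<Sum>l\<in>A. (s l)\<^sup>2 * (cmod (U x l))\<^sup>2)"
        using UV(4)[OF x] by (intro sum.cong refl) (simp add: norm_mult power_mult_distrib)
      finally show "(\<Sum>y\<in>A. (cmod (T x y))\<^sup>2) = (\<Sum>l\<in>A. (s l)\<^sup>2 * (cmod (U x l))\<^sup>2)" .
    qed
    also have "\<dots> = (\<Sum>l\<in>A. \<Sum>x\<in>A. (s l)\<^sup>2 * (cmod (U x l))\<^sup>2)" by (rule sum.swap)
    also have "\<dots> = (\<Sum>l\<in>A. (s l)\<^sup>2)"
      using unitary_on_col_norm[OF UV(1)] by (simp add: sum_distrib_left[symmetric])
    finally show ?thesis using S by simp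
  qed
  show ?thesis
  proof (cases "p = \<infinity>")
    case True
    thus ?thesis using A sR R0 by (simp add: schatten_norm_eq[OF A s])
  next
    case False
    then obtain r where r: "p = ereal r" "2 < r" using p by (cases p) auto
    have "s k powr r \<le> R powr ((r - 2) / 2) * (s k)\<^sup>2" if k: "k \<in> A" for k
    proof (cases "s k = 0")
      case False
      hence sk: "s k > 0" using UV(3)[OF k] by simp
      have "s k powr r = s k powr (r - 2) * s k powr 2" by (simp flip: powr_add)
      also have "s k powr 2 = (s k)\<^sup>2" using sk by simp
      also have "s k powr (r - 2) \<le> sqrt R powr (r - 2)"
        using sk r sR[OF k] by (intro powr_mono2) auto
      also have "sqrt R powr (r - 2) = R powr ((r - 2) / 2)"
        using R0 by (simp add: powr_half_sqrt[symmetric] powr_powr)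
      finally show ?thesis by (simp add: mult_right_mono)
    qed simp
    hence "(\<Sum>k\<in>A. s k powr r) \<le> R powr ((r - 2) / 2) * (\<Sum>k\<in>A. (s k)\<^sup>2)"
      by (simp add: sum_distrib_left sum_mono)
    also have "\<dots> \<le> R powr ((r - 2) / 2) * S" by (intro mult_left_mono s2) simp
    finally show ?thesis
      using r by (simp add: schatten_norm_eq[OF A s]) (intro powr_mono2, auto intro: sum_nonneg)
  qed
qed

section \<open>Laurent series and an incidence matrix\<close>

no_notation index_mat (infixl "$$" 100)
notation fls_nth (infixl "$$" 75)

text \<open>Degree is counted in \<open>t = 1/\<pi>\<close>, so the coefficient of t^d is
  \<open>x $$ (- d)\<close>, and \<open>d\<close> may be negative. These sets are the balls of the
  valuation; \<open>deg_le 0\<close> is the ring of integers.\<close>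

definition deg_le :: "int \<Rightarrow> ('a::zero) fls set" where
  "deg_le d = {x. \<forall>k. k < - d \<longrightarrow> x $$ k = 0}"

lemma deg_leD: "x \<in> deg_le d \<Longrightarrow> k < - d \<Longrightarrow> x $$ k = 0"
  by (simp add: deg_le_def)

lemma deg_le_mono: "x \<in> deg_le d \<Longrightarrow> d \<le> e \<Longrightarrow> x \<in> deg_le e"
  by (simp add: deg_le_def)

lemma deg_le_0 [simp]: "0 \<in> deg_le d"
  by (simp add: deg_le_def)

lemma deg_le_1 [simp]: "0 \<le> d \<Longrightarrow> (1 :: 'a::zero_neq_one fls) \<in> deg_le d"
  by (simp add: deg_le_def)

lemma deg_le_add: "x \<in> deg_le d \<Longrightarrow> y \<in> deg_le d \<Longrightarrow> x + (y::'a::comm_ring_1 fls) \<in> deg_le d"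
  by (simp add: deg_le_def)

lemma deg_le_diff: "x \<in> deg_le d \<Longrightarrow> y \<in> deg_le d \<Longrightarrow> x - (y::'a::comm_ring_1 fls) \<in> deg_le d"
  by (simp add: deg_le_def)

lemma deg_le_uminus [simp]: "- x \<in> deg_le d \<longleftrightarrow> (x::'a::comm_ring_1 fls) \<in> deg_le d"
  by (simp add: deg_le_def)

lemma deg_le_sum: "(\<And>i. i \<in> I \<Longrightarrow> f i \<in> deg_le d) \<Longrightarrow> (\<Sum>i\<in>I. f i :: 'a::comm_ring_1 fls) \<in> deg_le d"
  by (induction I rule: infinite_finite_induct) (auto intro: deg_le_add)

lemma deg_le_iff_subdegree: "x \<noteq> 0 \<Longrightarrow> x \<in> deg_le d \<longleftrightarrow> - d \<le> fls_subdegree x"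
  by (auto simp: deg_le_def intro: fls_subdegree_geI)

lemma deg_le_mult:
  assumes "x \<in> deg_le d" "y \<in> deg_le e"
  shows "x * (y::'a::field fls) \<in> deg_le (d + e)"
proof (cases "x = 0 \<or> y = 0")
  case False
  thus ?thesis using assms by (auto simp: deg_le_iff_subdegree)
qed auto

lemma deg_le_mult':
  "x \<in> deg_le d \<Longrightarrow> y \<in> deg_le e \<Longrightarrow> d + e \<le> f \<Longrightarrow> x * (y::'a::field fls) \<in> deg_le f"
  using deg_le_mult deg_le_mono by blast

lemma leading_nth_mult:
  assumes "x \<in> deg_le d" "y \<in> deg_le e"
  shows "(x * (y::'a::field fls)) $$ (- (d + e)) = x $$ (- d) * y $$ (- e)"
proof (cases "x $$ (- d) = 0 \<or> y $$ (- e) = 0")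
  case True
  hence "x \<in> deg_le (d - 1) \<or> y \<in> deg_le (e - 1)"
    using assms by (auto simp: deg_le_def) (metis add.commute add_diff_cancel_left' dual_order.order_iff_strict zle_diff1_eq diff_minus_eq_add minus_diff_eq)+
  hence "x * y \<in> deg_le (d + e - 1)"
    using deg_le_mult[of x "d - 1" y e] deg_le_mult[of x d y "e - 1"] assms
    by (auto simp: algebra_simps)
  thus ?thesis using True deg_leD[of "x * y" "d + e - 1" "- (d + e)"] by auto
next
  case False
  hence "fls_subdegree x = - d" "fls_subdegree y = - e"
    using assms by (auto intro!: fls_subdegree_eqI simp: deg_le_def)
  thus ?thesis using fls_times_base[of x y] by (simp add: algebra_simps)
qed

definition t_pow :: "nat \<Rightarrow> 'a::field fls" where
  "t_pow n = fls_X_inv ^ n"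

lemma t_pow_0 [simp]: "t_pow 0 = 1"
  by (simp add: t_pow_def)

lemma t_pow_add: "t_pow (m + n) = t_pow m * t_pow n"
  by (simp add: t_pow_def power_add)

lemma t_pow_nth [simp]: "t_pow n $$ k = (if k = - int n then 1 else 0)"
  by (simp add: t_pow_def)

lemma t_pow_mult_nth [simp]:
  "(t_pow n * (x::'a::field fls)) $$ k = x $$ (k + int n)"
  by (simp add: t_pow_def fls_X_inv_power_times_conv_shift)

lemma t_pow_deg_le [simp]: "t_pow n \<in> (deg_le d :: 'a::field fls set) \<longleftrightarrow> int n \<le> d"
  by (auto simp: deg_le_def)

lemma t_pow_mult_deg_le [simp]:
  "t_pow n * (x::'a::field fls) \<in> deg_le d \<longleftrightarrow> x \<in> deg_le (d - int n)"
proof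
  assume *: "t_pow n * x \<in> deg_le d"
  show "x \<in> deg_le (d - int n)"
    unfolding deg_le_def
  proof (intro CollectI allI impI)
    fix k assume "k < - (d - int n)"
    thus "x $$ k = 0" using deg_leD[OF *, of "k - int n"] by simp
  qed
qed (auto simp: deg_le_def)

lemma inv_poly_ring_0 [simp]: "0 \<in> inv_poly_ring"
  and inv_poly_ring_1 [simp]: "(1 :: 'a::field fls) \<in> inv_poly_ring"
  and inv_poly_ring_const [simp]: "fls_const c \<in> inv_poly_ring"
  and inv_poly_ring_X [simp]: "t_pow n \<in> (inv_poly_ring :: 'a::field fls set)"
  by (auto simp: inv_poly_ring_def)

lemma inv_poly_ring_add: "x \<in> inv_poly_ring \<Longrightarrow> y \<in> inv_poly_ring \<Longrightarrow> x + (y::'a::field fls) \<in> inv_poly_ring"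
  by (simp add: inv_poly_ring_def)

lemma inv_poly_ring_diff: "x \<in> inv_poly_ring \<Longrightarrow> y \<in> inv_poly_ring \<Longrightarrow> x - (y::'a::field fls) \<in> inv_poly_ring"
  by (simp add: inv_poly_ring_def)

lemma inv_poly_ring_uminus [simp]: "- x \<in> inv_poly_ring \<longleftrightarrow> (x::'a::field fls) \<in> inv_poly_ring"
  by (simp add: inv_poly_ring_def)

lemma inv_poly_ring_mult:
  assumes "x \<in> inv_poly_ring" "y \<in> inv_poly_ring"
  shows "x * (y::'a::field fls) \<in> inv_poly_ring"
  unfolding inv_poly_ring_def
proof (intro CollectI allI impI)
  fix n :: int assume n: "n > 0"
  show "(x * y) $$ n = 0"
    unfolding fls_times_nth(2)
  proof (intro sum.neutral ballI)
    fix i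
    show "x $$ i * y $$ (n - i) = 0"
      using assms n by (cases "i > 0") (auto simp: inv_poly_ring_def)
  qed
qed

text \<open>Polynomials in t of degree strictly below \<open>n\<close>; the strict bound makes their
  number exactly q^n.\<close>

definition polys :: "nat \<Rightarrow> ('a::zero) fls set" where
  "polys n = inv_poly_ring \<inter> deg_le (int n - 1)"

lemma polys_nth: "x \<in> polys n \<longleftrightarrow> (\<forall>k. (k > 0 \<or> k \<le> - int n) \<longrightarrow> x $$ k = 0)"
  by (auto simp: polys_def inv_poly_ring_def deg_le_def)

lemma polys_add: "x \<in> polys n \<Longrightarrow> y \<in> polys n \<Longrightarrow> x + (y::'a::field fls) \<in> polys n"
  by (simp add: polys_nth)

lemma polys_diff: "x \<in> polys n \<Longrightarrow> y \<in> polys n \<Longrightarrow> x - (y::'a::field fls) \<in> polys n"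
  by (simp add: polys_nth)

lemma ex_polys_nth:
  obtains x :: "'a::field fls" where "x \<in> polys n" "\<And>k. k < n \<Longrightarrow> x $$ (- int k) = g k"
proof -
  define f where "f = (\<lambda>k::int. if - int n < k \<and> k \<le> 0 then g (nat (- k)) else 0)"
  have nth: "Abs_fls f $$ k = f k" for k
    by (rule nth_Abs_fls_lower_bound[of "- int n"]) (simp add: f_def)
  show ?thesis
    by (rule that[of "Abs_fls f"]) (auto simp: polys_nth nth f_def[THEN fun_cong])
qed

lemma bij_betw_polys:
  "bij_betw (\<lambda>x. \<lambda>k\<in>{..<n}. x $$ (- int k)) (polys n :: 'a::field fls set) ({..<n} \<rightarrow>\<^sub>E UNIV)"
  unfolding bij_betw_def
proof
  show "inj_on (\<lambda>x. \<lambda>k\<in>{..<n}. x $$ (- int k)) (polys n :: 'a fls set)"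
  proof (rule inj_onI)
    fix x y :: "'a fls"
    assume xy: "x \<in> polys n" "y \<in> polys n"
      and eq: "(\<lambda>k\<in>{..<n}. x $$ (- int k)) = (\<lambda>k\<in>{..<n}. y $$ (- int k))"
    have *: "x $$ (- int k) = y $$ (- int k)" if "k < n" for k
      using fun_cong[OF eq, of k] that by simp
    show "x = y"
    proof (rule fls_eqI)
      fix k show "x $$ k = y $$ k"
        using *[of "nat (- k)"] xy by (cases "k > 0 \<or> k \<le> - int n") (auto simp: polys_nth)
    qed
  qed
  show "(\<lambda>x. \<lambda>k\<in>{..<n}. x $$ (- int k)) ` (polys n :: 'a fls set) = ({..<n} \<rightarrow>\<^sub>E UNIV)"
  proof (intro equalityI image_subsetI subsetI)
    show "(\<lambda>k\<in>{..<n}. x $$ (- int k)) \<in> {..<n} \<rightarrow>\<^sub>E UNIV" for x :: "'a fls"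
      by (subst restrict_PiE_iff) simp
  next
    fix g :: "nat \<Rightarrow> 'a" assume g: "g \<in> {..<n} \<rightarrow>\<^sub>E UNIV"
    obtain x :: "'a fls" where x: "x \<in> polys n" "\<And>k. k < n \<Longrightarrow> x $$ (- int k) = g k"
      by (rule ex_polys_nth[of n g], rule that)
    have "(\<lambda>k\<in>{..<n}. x $$ (- int k)) = g"
      using g x by (auto simp: PiE_def extensional_def)
    thus "g \<in> (\<lambda>x. \<lambda>k\<in>{..<n}. x $$ (- int k)) ` (polys n :: 'a fls set)" using x by blast
  qed
qed

lemma finite_polys [simp]: "finite (polys n :: 'a::{field,finite} fls set)"
  using bij_betw_finite[OF bij_betw_polys[of n, where ?'a = 'a]] by (simp add: finite_PiE)

lemma card_polys: "card (polys n :: 'a::{field,finite} fls set) = card (UNIV :: 'a set) ^ n"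
  using bij_betw_same_card[OF bij_betw_polys[of n]] by (simp add: card_PiE)

text \<open>Signed indicator of two cosets of \<open>deg_le (n - 1)\<close>. In the positive coset
  \<open>w\<close> is monic of degree n + 1, in the negative one monic of degree n, and this degree
  is what the Cartan type records. Single cosets, rather than all elements of these degrees, give
  both signs the same mass.\<close>

definition level_sign :: "nat \<Rightarrow> ('a::field) fls \<Rightarrow> real" where
  "level_sign n w = of_bool (w - t_pow (Suc n) \<in> deg_le (int n - 1))
                  - of_bool (w - t_pow n \<in> deg_le (int n - 1))"

lemma level_sign_exclusive:
  fixes w :: "'a::field fls"
  assumes "w - t_pow (Suc n) \<in> deg_le (int n - 1)"
  shows "w - t_pow n \<notin> deg_le (int n - 1)"
proof
  assume "w - t_pow n \<in> deg_le (int n - 1)"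
  from deg_leD[OF this, of "- int n - 1"] deg_leD[OF assms, of "- int n - 1"]
  show False by simp
qed

lemma level_sign_cong:
  assumes "w - w' \<in> deg_le (int n - 1)"
  shows "level_sign n w = level_sign n w'"
proof -
  have "w - c \<in> deg_le (int n - 1) \<longleftrightarrow> w' - c \<in> deg_le (int n - 1)" for c
    using deg_le_add[of "w' - c" _ "w - w'"] deg_le_diff[of "w - c" _ "w - w'"] assms by fastforce
  thus ?thesis by (simp add: level_sign_def)
qed

lemma level_sign_eq_0:
  assumes "w \<notin> deg_le (int n + 1)"
  shows "level_sign n w = 0"
proof -
  have "w - c \<notin> deg_le (int n - 1)" if "c \<in> deg_le (int n + 1)" for c
    using deg_le_add[of "w - c" "int n + 1" c] deg_le_mono[of "w - c" "int n - 1" "int n + 1"] that assms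
    by auto
  thus ?thesis by (simp add: level_sign_def)
qed

text \<open>A polynomial \<open>b\<close> with \<open>a * b\<close> equal to the difference of the two test levels exists, and
  translation by \<open>b\<close> exchanges the positive and the negative part.\<close>
lemma sum_level_sign_eq_0:
  fixes a c :: "'a::{field,finite} fls"
  assumes a: "a \<in> polys n" "a \<notin> deg_le 1"
  shows "(\<Sum>y\<in>polys n. level_sign n (c + a * y)) = 0"
proof -
  have "a \<noteq> 0" using a by auto
  define r where "r = nat (- fls_subdegree a)"
  have sd: "2 \<le> - fls_subdegree a" "- fls_subdegree a \<le> int n - 1"
    using a \<open>a \<noteq> 0\<close> deg_le_iff_subdegree[OF \<open>a \<noteq> 0\<close>, of 1] deg_le_iff_subdegree[OF \<open>a \<noteq> 0\<close>, of "int n - 1"]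
    by (auto simp: polys_def)
  have r: "2 \<le> r" "r < n" "fls_subdegree a = - int r" using sd by (auto simp: r_def)
  define l where "l = a $$ (- int r)"
  have l: "l \<noteq> 0" using \<open>a \<noteq> 0\<close> r(3) by (metis l_def nth_fls_subdegree_nonzero)
  define m where "m = a $$ (1 - int r)"
  \<comment> \<open>The two coefficients make \<open>a * b\<close> agree with t^(n+1) - t^n in
    degrees n + 1 and n: a triangular system whose pivot \<open>l\<close> is the leading coefficient
    of \<open>a\<close>. As \<open>a\<close> has degree r \<ge> 2, \<open>b\<close> has degree n + 1
    - r < n and translation by it preserves \<open>polys n\<close>.\<close>
  define c1 where "c1 = 1 / l"
  define c0 where "c0 = (- 1 - c1 * m) / l"
  define b where "b = fls_const c1 * t_pow (n + 1 - r) + fls_const c0 * t_pow (n - r)"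
  have b: "b \<in> polys n" using r by (auto simp: polys_nth b_def)
  have alow: "a $$ k = 0" if "k < - int r" for k using that r by simp
  have ab: "a * b = fls_const c1 * (t_pow (n + 1 - r) * a) + fls_const c0 * (t_pow (n - r) * a)"
    by (simp add: b_def algebra_simps)
  have d: "a * b - t_pow (Suc n) + t_pow n \<in> deg_le (int n - 1)"
    unfolding deg_le_def ab
  proof (intro CollectI allI impI)
    fix k assume "k < - (int n - 1)"
    then consider "k < - int n - 1" | "k = - int n - 1" | "k = - int n" by linarith
    thus "(fls_const c1 * (t_pow (n + 1 - r) * a) + fls_const c0 * (t_pow (n - r) * a)
       - t_pow (Suc n) + t_pow n) $$ k = 0"
    proof cases
      case 1 thus ?thesis using r alow by (simp add: of_nat_diff)
    next
      case 2
      have "k + int (n + 1 - r) = - int r" "k + int (n - r) < - int r" using 2 r by auto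
      thus ?thesis using 2 l r alow by (simp add: l_def[symmetric] c1_def del: of_nat_diff)
    next
      case 3
      have "k + int (n + 1 - r) = 1 - int r" "k + int (n - r) = - int r" using 3 r by auto
      thus ?thesis using 3 l r
        by (simp add: l_def[symmetric] m_def[symmetric] c0_def del: of_nat_diff)
    qed
  qed
  define Sp where "Sp = {y \<in> polys n. c + a * y - t_pow (Suc n) \<in> deg_le (int n - 1)}"
  define Sm where "Sm = {y \<in> polys n. c + a * y - t_pow n \<in> deg_le (int n - 1)}"
  have key: "c + a * y - t_pow (Suc n) \<in> deg_le (int n - 1) \<longleftrightarrow>
        c + a * (y - b) - t_pow n \<in> deg_le (int n - 1)" for y
  proof -
    have e: "c + a * y - t_pow (Suc n) = (c + a * (y - b) - t_pow n) + (a * b - t_pow (Suc n) + t_pow n)"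
      by (simp add: algebra_simps)
    have e': "c + a * (y - b) - t_pow n = (c + a * y - t_pow (Suc n)) - (a * b - t_pow (Suc n) + t_pow n)"
      by (simp add: algebra_simps)
    show ?thesis using deg_le_add[OF _ d] deg_le_diff[OF _ d] e e' by metis
  qed
  have "bij_betw (\<lambda>y. y - b) Sp Sm"
  proof (rule bij_betwI[where g = "\<lambda>y. y + b"])
    show "(\<lambda>y. y - b) \<in> Sp \<rightarrow> Sm" using key b by (auto simp: Sp_def Sm_def intro: polys_diff)
    show "(\<lambda>y. y + b) \<in> Sm \<rightarrow> Sp"
      using key[of "_ + b"] b by (auto simp: Sp_def Sm_def intro: polys_add)
  qed auto
  hence "card Sp = card Sm" by (rule bij_betw_same_card)
  moreover have "(\<Sum>y\<in>polys n. level_sign n (c + a * y)) = real (card Sp) - real (card Sm)"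
    by (simp add: level_sign_def sum_subtractf Sp_def Sm_def of_bool_def sum.If_cases Int_def)
  ultimately show ?thesis by simp
qed

text \<open>\<open>w\<close> has n + 1 coefficients in degrees n to 2 n, and exactly these can be
  adjusted by t^n y with \<open>y \<in> polys (n + 1)\<close>. This dictates the different sizes of
  the two coordinates of the index set below.\<close>

lemma unique_quotient:
  fixes w :: "'a::field fls"
  assumes w: "w \<in> deg_le (2 * int n)"
  shows "\<exists>!y. y \<in> polys (n + 1) \<and> t_pow n * y + w \<in> deg_le (int n - 1)"
proof -
  obtain y :: "'a fls" where y: "y \<in> polys (n + 1)" "\<And>k. k < n + 1 \<Longrightarrow> y $$ (- int k) = - w $$ (- int k - int n)"
    by (rule ex_polys_nth[of "n + 1" "\<lambda>k. - w $$ (- int k - int n)"], rule that)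
  show ?thesis
  proof (rule ex1I[of _ y])
    have "t_pow n * y + w \<in> deg_le (int n - 1)"
      unfolding deg_le_def
    proof (intro CollectI allI impI)
      fix k assume k: "k < - (int n - 1)"
      show "(t_pow n * y + w) $$ k = 0"
      proof (cases "k < - (2 * int n)")
        case True
        thus ?thesis using y(1) w by (simp add: polys_nth deg_leD)
      next
        case False
        define j where "j = nat (- k - int n)"
        have j: "j < n + 1" "- int j = k + int n" "k + int n - int n = k"
          using False k by (auto simp: j_def)
        show ?thesis using y(2)[OF j(1)] unfolding j(2,3) by simp
      qed
    qed
    thus "y \<in> polys (n + 1) \<and> t_pow n * y + w \<in> deg_le (int n - 1)" using y by simp
    fix z assume z: "z \<in> polys (n + 1) \<and> t_pow n * z + w \<in> deg_le (int n - 1)"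
    have "t_pow n * (z - y) \<in> deg_le (int n - 1)"
      using deg_le_diff[of "t_pow n * z + w" _ "t_pow n * y + w"] z
        \<open>t_pow n * y + w \<in> _\<close> by (simp add: algebra_simps)
    hence "z - y \<in> deg_le (-1)" by simp
    moreover have "z - y \<in> polys (n + 1)" using z y by (auto intro: polys_diff)
    ultimately have "(z - y) $$ k = 0" for k
      using deg_leD[of "z - y" "-1" k] by (cases "k > 0") (auto simp: polys_nth)
    hence "z - y = 0" by (intro fls_eqI) simp
    thus "z = y" by simp
  qed
qed

text \<open>Common core of the two families of group elements. \<open>\<alpha>\<close> and
  \<open>\<beta>\<close> absorb the terms in one index alone, which differ between the families;
  they only shift levels, and the bound \<open>2 * int n\<close> keeps them within the reach of
  \<open>unique_quotient\<close>.\<close>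

locale incidence =
  fixes n :: nat and \<alpha> \<beta> :: "'a::{field,finite} fls \<Rightarrow> 'a fls" and q :: real
  assumes n: "1 \<le> n" and q: "q = real (card (UNIV :: 'a set))"
    and \<alpha>: "x \<in> polys n \<Longrightarrow> \<alpha> x \<in> deg_le (2 * int n)"
    and \<beta>: "x \<in> polys n \<Longrightarrow> \<beta> x \<in> deg_le (2 * int n)"
begin

definition X :: "('a fls \<times> 'a fls) set" where "X = polys n \<times> polys (n + 1)"

definition \<rho> :: "'a fls \<times> 'a fls \<Rightarrow> 'a fls \<times> 'a fls \<Rightarrow> 'a fls" where
  "\<rho> x y = t_pow n * (snd y - snd x) + fst x * fst y + \<alpha> (fst x) + \<beta> (fst y)"

lemma finite_X [simp]: "finite X"
  by (simp add: X_def)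

lemma card_X: "real (card X) = q ^ (2 * n + 1)"
  by (simp add: X_def q card_cartesian_product card_polys power_add mult_2)

lemma unique_second:
  assumes x: "x \<in> X" and y2: "y2 \<in> polys n" and c: "c \<in> deg_le (2 * int n)"
  shows "\<exists>!y3. y3 \<in> polys (n + 1) \<and> \<rho> x (y2, y3) - c \<in> deg_le (int n - 1)"
proof -
  have "fst x * y2 \<in> deg_le (2 * int n)"
    using x y2 by (intro deg_le_mult'[of _ "int n - 1" _ "int n - 1"]) (auto simp: X_def polys_def)
  moreover have "snd x \<in> deg_le (int n)" using x by (auto simp: X_def polys_def)
  ultimately have "- (t_pow n * snd x) + fst x * y2 + \<alpha> (fst x) + \<beta> y2 - c \<in> deg_le (2 * int n)"
    using x y2 c \<alpha> \<beta> by (intro deg_le_add deg_le_diff) (auto simp: X_def)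
  from unique_quotient[OF this] show ?thesis
    by (simp add: \<rho>_def algebra_simps)
qed

text \<open>The set is the graph of a function of the first coordinate. Hence both levels have the
  same mass in every row.\<close>

lemma card_level:
  assumes x: "x \<in> X" and c: "c \<in> deg_le (2 * int n)"
  shows "real (card {y \<in> X. \<rho> x y - c \<in> deg_le (int n - 1)}) = q ^ n"
proof -
  define g where "g = (\<lambda>y2. THE y3. y3 \<in> polys (n + 1) \<and> \<rho> x (y2, y3) - c \<in> deg_le (int n - 1))"
  have g: "g y2 \<in> polys (n + 1) \<and> \<rho> x (y2, g y2) - c \<in> deg_le (int n - 1)" if "y2 \<in> polys n" for y2
    unfolding g_def by (rule theI'[OF unique_second[OF x that c]])
  have g': "y3 = g y2" if "y2 \<in> polys n" "y3 \<in> polys (n + 1)" "\<rho> x (y2, y3) - c \<in> deg_le (int n - 1)" for y2 y3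
    using unique_second[OF x that(1) c] g[OF that(1)] that by blast
  have "{y \<in> X. \<rho> x y - c \<in> deg_le (int n - 1)} = (\<lambda>y2. (y2, g y2)) ` polys n"
    using g g' by (auto simp: X_def)
  moreover have "inj_on (\<lambda>y2. (y2, g y2)) (polys n)" by (auto simp: inj_on_def)
  ultimately show ?thesis by (simp add: card_image card_polys q)
qed

definition T :: "'a fls \<times> 'a fls \<Rightarrow> 'a fls \<times> 'a fls \<Rightarrow> real" where
  "T x y = level_sign n (\<rho> x y)"

lemma levels: "t_pow n \<in> (deg_le (2 * int n) :: 'a fls set)"
  "t_pow (Suc n) \<in> (deg_le (2 * int n) :: 'a fls set)"
  using n by (simp_all)

lemma sum_square_T: "(\<Sum>x\<in>X. \<Sum>y\<in>X. (T x y)\<^sup>2) = 2 * q ^ n * q ^ (2 * n + 1)"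
proof -
  have "(\<Sum>y\<in>X. (T x y)\<^sup>2) = 2 * q ^ n" if x: "x \<in> X" for x
  proof -
    have "(T x y)\<^sup>2 = of_bool (\<rho> x y - t_pow (Suc n) \<in> deg_le (int n - 1))
                  + of_bool (\<rho> x y - t_pow n \<in> deg_le (int n - 1))" for y
      using level_sign_exclusive[of "\<rho> x y" n] by (auto simp: T_def level_sign_def)
    thus ?thesis
      using card_level[OF x levels(1)] card_level[OF x levels(2)]
      by (simp add: sum.distrib of_bool_def sum.If_cases Int_def)
  qed
  thus ?thesis by (simp add: card_X)
qed

text \<open>For each level \<open>c\<close> exactly one \<open>y3\<close> brings
  \<open>\<rho> x\<close> to \<open>c\<close>, and \<open>\<rho> x' - \<rho> x\<close> equals
  \<open>\<delta>\<close>, which is free of \<open>y3\<close>. So the sum collapses to the signs of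
  \<open>\<rho> x'\<close> at the two levels shifted by \<open>\<delta>\<close>.\<close>

lemma gram_inner:
  assumes x: "x \<in> X" and x': "x' \<in> X" and y2: "y2 \<in> polys n"
  defines "\<delta> \<equiv> t_pow n * (snd x - snd x') + (fst x' - fst x) * y2 + \<alpha> (fst x') - \<alpha> (fst x)"
  shows "(\<Sum>y3\<in>polys (n + 1). T x (y2, y3) * T x' (y2, y3))
    = level_sign n (t_pow (Suc n) + \<delta>) - level_sign n (t_pow n + \<delta>)"
proof -
  have one: "(\<Sum>y3\<in>polys (n + 1). of_bool (\<rho> x (y2, y3) - c \<in> deg_le (int n - 1)) * T x' (y2, y3))
      = level_sign n (c + \<delta>)" if c: "c \<in> deg_le (2 * int n)" for c
  proof -
    obtain y3 where y3: "y3 \<in> polys (n + 1)" "\<rho> x (y2, y3) - c \<in> deg_le (int n - 1)"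
      and uni: "\<And>z. z \<in> polys (n + 1) \<Longrightarrow> \<rho> x (y2, z) - c \<in> deg_le (int n - 1) \<Longrightarrow> z = y3"
      using unique_second[OF x y2 c] by blast
    have "(\<Sum>z\<in>polys (n + 1). of_bool (\<rho> x (y2, z) - c \<in> deg_le (int n - 1)) * T x' (y2, z))
        = (\<Sum>z\<in>polys (n + 1). if z = y3 then T x' (y2, y3) else 0)"
    proof (rule sum.cong[OF refl])
      fix z :: "'a fls" assume "z \<in> polys (n + 1)"
      hence "z \<noteq> y3 \<Longrightarrow> \<not> \<rho> x (y2, z) - c \<in> deg_le (int n - 1)" using uni by blast
      thus "of_bool (\<rho> x (y2, z) - c \<in> deg_le (int n - 1)) * T x' (y2, z) =
          (if z = y3 then T x' (y2, y3) else 0)"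
        using y3 by (cases "z = y3") simp_all
    qed
    also have "\<dots> = T x' (y2, y3)" using y3 by simp
    also have "\<dots> = level_sign n (c + \<delta>)"
      unfolding T_def
    proof (rule level_sign_cong)
      have "\<rho> x' (y2, y3) - (c + \<delta>) = \<rho> x (y2, y3) - c"
        by (simp add: \<rho>_def \<delta>_def algebra_simps)
      thus "\<rho> x' (y2, y3) - (c + \<delta>) \<in> deg_le (int n - 1)" using y3(2) by (simp only:)
    qed
    finally show ?thesis .
  qed
  have "T x (y2, y3) * T x' (y2, y3) =
      of_bool (\<rho> x (y2, y3) - t_pow (Suc n) \<in> deg_le (int n - 1)) * T x' (y2, y3)
    - of_bool (\<rho> x (y2, y3) - t_pow n \<in> deg_le (int n - 1)) * T x' (y2, y3)" for y3
    by (simp only: T_def[of x] level_sign_def left_diff_distrib)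
  thus ?thesis
    by (simp only: sum_subtractf one[OF levels(1)] one[OF levels(2)])
qed

lemma gram_eq:
  assumes x: "x \<in> X" and x': "x' \<in> X"
  defines "e \<equiv> t_pow n * (snd x - snd x') + \<alpha> (fst x') - \<alpha> (fst x)"
  shows "(\<Sum>y\<in>X. T x y * T x' y) = (\<Sum>y2\<in>polys n. level_sign n (t_pow (Suc n) + e + (fst x' - fst x) * y2))
     - (\<Sum>y2\<in>polys n. level_sign n (t_pow n + e + (fst x' - fst x) * y2))"
proof -
  have "(\<Sum>y\<in>X. T x y * T x' y) = (\<Sum>y2\<in>polys n. \<Sum>y3\<in>polys (n + 1). T x (y2, y3) * T x' (y2, y3))"
    by (simp add: X_def sum.cartesian_product)
  also have "\<dots> = (\<Sum>y2\<in>polys n. level_sign n (t_pow (Suc n) + e + (fst x' - fst x) * y2)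
      - level_sign n (t_pow n + e + (fst x' - fst x) * y2))"
  proof (rule sum.cong[OF refl])
    fix y2 :: "'a fls" assume y2: "y2 \<in> polys n"
    have eq: "c + (t_pow n * (snd x - snd x') + (fst x' - fst x) * y2 + \<alpha> (fst x') - \<alpha> (fst x))
        = c + e + (fst x' - fst x) * y2" for c
      by (simp add: e_def)
    show "(\<Sum>y3\<in>polys (n + 1). T x (y2, y3) * T x' (y2, y3)) =
        level_sign n (t_pow (Suc n) + e + (fst x' - fst x) * y2)
      - level_sign n (t_pow n + e + (fst x' - fst x) * y2)"
      unfolding gram_inner[OF x x' y2] eq ..
  qed
  finally show ?thesis by (simp add: sum_subtractf)
qed

text \<open>If the first coordinates differ in degree at least 2, translation in \<open>y2\<close>
  cancels both sums. Otherwise their difference times \<open>y2\<close> has degree at most n, so all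
  signs vanish unless \<open>e\<close> has degree at most n + 1; in that remaining case counting the
  \<open>y2\<close> is enough.\<close>

lemma gram_bound:
  assumes x: "x \<in> X" and x': "x' \<in> X"
  defines "e \<equiv> t_pow n * (snd x - snd x') + \<alpha> (fst x') - \<alpha> (fst x)"
  shows "\<bar>\<Sum>y\<in>X. T x y * T x' y\<bar> \<le>
    (if fst x' - fst x \<in> deg_le 1 \<and> e \<in> deg_le (int n + 1) then 2 * q ^ n else 0)"
proof -
  have b: "\<bar>level_sign n w\<bar> \<le> 1" for w :: "'a fls"
    by (simp add: level_sign_def of_bool_def)
  have s: "\<bar>\<Sum>y2\<in>polys n. level_sign n (c + (fst x' - fst x) * y2)\<bar> \<le> q ^ n" for c
  proof -
    have "\<bar>\<Sum>y2\<in>polys n. level_sign n (c + (fst x' - fst x) * y2)\<bar> \<le> (\<Sum>y2\<in>(polys n :: 'a fls set). 1)"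
      by (rule order_trans[OF sum_abs]) (intro sum_mono b)
    thus ?thesis by (simp add: card_polys q)
  qed
  have dif: "fst x' - fst x \<in> polys n" using x x' by (auto simp: X_def intro: polys_diff)
  show ?thesis
  proof (cases "fst x' - fst x \<in> deg_le 1")
    case False
    thus ?thesis
      using gram_eq[OF x x'] sum_level_sign_eq_0[OF dif False] by simp
  next
    case d1: True
    show ?thesis
    proof (cases "e \<in> deg_le (int n + 1)")
      case True
      thus ?thesis using d1 gram_eq[OF x x'] s[of "t_pow (Suc n) + e"] s[of "t_pow n + e"]
        by (simp add: e_def[symmetric])
    next
      case False
      have "level_sign n (c + e + (fst x' - fst x) * y2) = 0"
        if y2: "y2 \<in> polys n" and c: "c \<in> deg_le (int n + 1)" for y2 c
      proof (rule level_sign_eq_0)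
        have "(fst x' - fst x) * y2 \<in> deg_le (int n + 1)"
          using d1 y2 by (intro deg_le_mult'[of _ 1 _ "int n - 1"]) (auto simp: polys_def)
        hence *: "c + (fst x' - fst x) * y2 \<in> deg_le (int n + 1)" using c by (rule deg_le_add[rotated])
        have eq: "e = (c + e + (fst x' - fst x) * y2) - (c + (fst x' - fst x) * y2)" by simp
        show "c + e + (fst x' - fst x) * y2 \<notin> deg_le (int n + 1)"
          using deg_le_diff[OF _ *] eq False by metis
      qed
      thus ?thesis using gram_eq[OF x x'] False by (simp add: e_def[symmetric])
    qed
  qed
qed

text \<open>At most \<open>q^4\<close> indices \<open>x'\<close> contribute: q^2 first coordinates
  within degree 1 of that of \<open>x\<close>, and for each of them q^2 second coordinates, because
  the condition on \<open>e\<close> fixes t^n times the second coordinate up to degree n +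
  1.\<close>

lemma gram_row_sum:
  assumes x: "x \<in> X"
  shows "(\<Sum>x'\<in>X. \<bar>\<Sum>y\<in>X. T x y * T x' y\<bar>) \<le> 2 * q ^ (n + 4)"
proof -
  define e where "e = (\<lambda>x'. t_pow n * (snd x - snd x') + \<alpha> (fst x') - \<alpha> (fst x))"
  define N where "N = {x'\<in>X. fst x' - fst x \<in> deg_le 1 \<and> e x' \<in> deg_le (int n + 1)}"
  have "(\<Sum>x'\<in>X. \<bar>\<Sum>y\<in>X. T x y * T x' y\<bar>)
      \<le> (\<Sum>x'\<in>X. if fst x' - fst x \<in> deg_le 1 \<and> e x' \<in> deg_le (int n + 1) then 2 * q ^ n else 0)"
    unfolding e_def by (intro sum_mono gram_bound x)
  also have "\<dots> = real (card N) * (2 * q ^ n)"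
    by (simp add: sum.If_cases N_def Int_def)
  also have "real (card N) * (2 * q ^ n) \<le> q ^ 4 * (2 * q ^ n)"
  proof (rule mult_right_mono)
    define D where "D = (\<lambda>x2. {x3 \<in> polys (n + 1). e (x2, x3) \<in> deg_le (int n + 1)})"
    define E where "E = {x2 \<in> polys n. x2 - fst x \<in> deg_le 1}"
    have p2: "z \<in> polys m \<Longrightarrow> z \<in> deg_le 1 \<Longrightarrow> z \<in> polys 2" for z :: "'a fls" and m
      by (simp add: polys_def)
    have fin: "finite E" "finite (D x2)" for x2
      by (auto simp: E_def D_def)
    have "card E \<le> card (polys 2 :: 'a fls set)"
    proof (rule card_inj_on_le[of "\<lambda>x2. x2 - fst x"])
      show "(\<lambda>x2. x2 - fst x) ` E \<subseteq> polys 2"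
        using x by (auto simp: E_def X_def intro!: p2[of _ n] intro: polys_diff)
    qed (auto simp: inj_on_def)
    moreover have cD: "card (D x2) \<le> card (polys 2 :: 'a fls set)" for x2
    proof (cases "D x2 = {}")
      case False
      then obtain z where z: "z \<in> D x2" by blast
      show ?thesis
      proof (rule card_inj_on_le[of "\<lambda>x3. x3 - z"])
        show "(\<lambda>x3. x3 - z) ` D x2 \<subseteq> polys 2"
        proof clarify
          fix x3 assume x3: "x3 \<in> D x2"
          have "e (x2, z) - e (x2, x3) = t_pow n * (x3 - z)"
            by (simp add: e_def algebra_simps)
          moreover have "e (x2, z) - e (x2, x3) \<in> deg_le (int n + 1)"
            using z x3 by (auto simp: D_def intro: deg_le_diff)
          ultimately have "x3 - z \<in> deg_le 1" by simp
          moreover have "x3 - z \<in> polys (n + 1)" using z x3 by (auto simp: D_def intro: polys_diff)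
          ultimately show "x3 - z \<in> polys 2" by (rule p2[rotated])
        qed
      qed (auto simp: inj_on_def)
    qed simp
    moreover have "card N \<le> (\<Sum>x2\<in>E. card (D x2))"
    proof -
      have "N \<subseteq> Sigma E D" by (auto simp: N_def E_def D_def X_def)
      hence "card N \<le> card (Sigma E D)" using fin by (intro card_mono finite_SigmaI) auto
      thus ?thesis using fin by (simp add: card_SigmaI)
    qed
    moreover have "(\<Sum>x2\<in>E. card (D x2)) \<le> card E * card (polys 2 :: 'a fls set)"
      using sum_bounded_above[of E "\<lambda>x2. card (D x2)", OF cD] by simp
    ultimately have "card N \<le> card (polys 2 :: 'a fls set) * card (polys 2 :: 'a fls set)"
      by (meson le_trans mult_le_mono1)
    also have "\<dots> = card (UNIV :: 'a set) ^ 4"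
      by (simp add: card_polys flip: power_add)
    finally show "real (card N) \<le> q ^ 4" unfolding q by (metis of_nat_mono of_nat_power)
  qed (simp add: q)
  finally show ?thesis by (simp add: power_add mult_ac)
qed

lemma sum_T_weighted:
  fixes m :: "'a fls \<times> 'a fls \<Rightarrow> 'a fls \<times> 'a fls \<Rightarrow> complex"
  assumes "\<And>x y. x \<in> X \<Longrightarrow> y \<in> X \<Longrightarrow> \<rho> x y - t_pow (Suc n) \<in> deg_le (int n - 1) \<Longrightarrow> m x y = a"
    and "\<And>x y. x \<in> X \<Longrightarrow> y \<in> X \<Longrightarrow> \<rho> x y - t_pow n \<in> deg_le (int n - 1) \<Longrightarrow> m x y = b"
  shows "(\<Sum>x\<in>X. \<Sum>y\<in>X. m x y * complex_of_real (T x y)) = of_real (card X * q ^ n) * (a - b)"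
proof -
  have "(\<Sum>y\<in>X. m x y * complex_of_real (T x y)) = of_real (q ^ n) * (a - b)" if x: "x \<in> X" for x
  proof -
    have "(\<Sum>y\<in>X. m x y * complex_of_real (T x y)) = (\<Sum>y\<in>X.
        (if \<rho> x y - t_pow (Suc n) \<in> deg_le (int n - 1) then a else 0)
      - (if \<rho> x y - t_pow n \<in> deg_le (int n - 1) then b else 0))"
      using assms[OF x] level_sign_exclusive[of "\<rho> x _" n]
      by (intro sum.cong refl) (auto simp: T_def level_sign_def)
    also have "\<dots> = of_nat (card {y \<in> X. \<rho> x y - t_pow (Suc n) \<in> deg_le (int n - 1)}) * a
       - of_nat (card {y \<in> X. \<rho> x y - t_pow n \<in> deg_le (int n - 1)}) * b"
      by (simp add: sum_subtractf sum.If_cases Int_def)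
    also have "\<dots> = of_real (real (card {y \<in> X. \<rho> x y - t_pow (Suc n) \<in> deg_le (int n - 1)})) * a
       - of_real (real (card {y \<in> X. \<rho> x y - t_pow n \<in> deg_le (int n - 1)})) * b"
      by simp
    also have "\<dots> = of_real (q ^ n) * (a - b)"
      unfolding card_level[OF x levels(1)] card_level[OF x levels(2)] by (simp add: right_diff_distrib)
    finally show ?thesis .
  qed
  thus ?thesis by simp
qed

end

section \<open>Testing a Schur multiplier\<close>

text \<open>The bound of \<open>schatten_norm_le\<close>: an interpolation between the operator norm
  estimate \<open>sqrt R\<close> and the Hilbert-Schmidt estimate \<open>sqrt S\<close>.\<close>

definition schatten_bound :: "ereal \<Rightarrow> real \<Rightarrow> real \<Rightarrow> real" where
  "schatten_bound p R S = (if p = \<infinity> then sqrt R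
    else (R powr ((real_of_ereal p - 2) / 2) * S) powr (1 / real_of_ereal p))"

lemma schatten_bound_pos: "0 < R \<Longrightarrow> 0 < S \<Longrightarrow> 0 < schatten_bound p R S"
  by (simp add: schatten_bound_def)

text \<open>Dividing a matrix by \<open>B\<close> divides both \<open>R\<close> and \<open>S\<close>
  by \<open>B\<close> squared, and the bound is homogeneous of degree one in the matrix.\<close>

lemma schatten_bound_normalise:
  assumes p: "2 < p" and R: "0 < R" and S: "0 < S"
  defines "B \<equiv> schatten_bound p R S"
  shows "schatten_bound p (R / B\<^sup>2) (S / B\<^sup>2) = 1"
proof (cases "p = \<infinity>")
  case True
  thus ?thesis using R by (simp add: B_def schatten_bound_def)
next
  case False
  then obtain r where r: "p = ereal r" "2 < r" using p by (cases p) auto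
  define Q where "Q = R powr ((r - 2) / 2) * S"
  have Q: "Q > 0" using R S by (simp add: Q_def)
  have B: "B = Q powr (1 / r)" using r by (simp add: B_def schatten_bound_def Q_def)
  have B0: "B > 0" using Q by (simp add: B)
  have Br: "B powr r = Q" using Q r by (simp add: B powr_powr)
  have "(B\<^sup>2) powr ((r - 2) / 2) = (B powr 2) powr ((r - 2) / 2)" using B0 by simp
  also have "\<dots> = B powr (2 * ((r - 2) / 2))" by (rule powr_powr)
  also have "2 * ((r - 2) / 2) = r - 2" by simp
  finally have "(B\<^sup>2) powr ((r - 2) / 2) = B powr (r - 2)" .
  hence "(R / B\<^sup>2) powr ((r - 2) / 2) * (S / B\<^sup>2) = Q / (B powr (r - 2) * B\<^sup>2)"
    using R B0 by (simp add: powr_divide Q_def)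
  also have "B powr (r - 2) * B\<^sup>2 = B powr r"
    using B0 by (simp flip: powr_numeral powr_add)
  finally have "(R / B\<^sup>2) powr ((r - 2) / 2) * (S / B\<^sup>2) = 1" using Br Q by simp
  thus ?thesis using r by (simp add: schatten_bound_def)
qed

text \<open>Injectivity makes the normalised \<open>T\<close> a genuine submatrix of a matrix over
  \<open>\<Omega>\<close>, as is needed for a norm without amplification. Its multiplied version is
  paired with the indicator vectors of the two images, each of length
  \<open>sqrt (card I)\<close>.\<close>

lemma schur_mult_norm_test:
  fixes gx gy :: "'i \<Rightarrow> 'g" and T :: "'i \<Rightarrow> 'i \<Rightarrow> real" and M :: "'g \<Rightarrow> 'g \<Rightarrow> complex"
  assumes I: "finite I" and gx: "inj_on gx I" "gx ` I \<subseteq> \<Omega>" and gy: "inj_on gy I" "gy ` I \<subseteq> \<Omega>"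
    and p: "2 < p" and R: "0 < R" and S: "0 < S"
    and rows: "\<And>x. x \<in> I \<Longrightarrow> (\<Sum>x'\<in>I. \<bar>\<Sum>y\<in>I. T x y * T x' y\<bar>) \<le> R"
    and sq: "(\<Sum>x\<in>I. \<Sum>y\<in>I. (T x y)\<^sup>2) \<le> S"
    and N: "schur_mult_norm p \<Omega> M \<le> ereal N"
  shows "cmod (\<Sum>x\<in>I. \<Sum>y\<in>I. M (gx x) (gy y) * complex_of_real (T x y))
           \<le> schatten_bound p R S * card I * N"
proof -
  define B where "B = schatten_bound p R S"
  have B: "B > 0" using schatten_bound_pos[OF R S] by (simp add: B_def)
  \<comment> \<open>Schatten norms are defined over one index set for rows and columns, so both
    images are placed in their union and \<open>H\<close> is padded with zeros.\<close>
  define A where "A = gx ` I \<union> gy ` I"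
  have A: "finite A" "A \<subseteq> \<Omega>" "gx ` I \<subseteq> A" "gy ` I \<subseteq> A" using I gx gy by (auto simp: A_def)
  define H where "H = (\<lambda>g h. if g \<in> gx ` I \<and> h \<in> gy ` I
      then complex_of_real (T (inv_into I gx g) (inv_into I gy h) / B) else 0)"
  have H: "H (gx x) (gy y) = complex_of_real (T x y / B)" if "x \<in> I" "y \<in> I" for x y
    using that gx gy by (simp add: H_def)
  have H0: "H g h = 0" if "g \<notin> gx ` I \<or> h \<notin> gy ` I" for g h using that by (auto simp: H_def)
  have ry: "(\<Sum>h\<in>A. F h) = (\<Sum>y\<in>I. F (gy y))" if "\<And>h. h \<notin> gy ` I \<Longrightarrow> F h = 0" for F :: "'g \<Rightarrow> 'z::comm_monoid_add"
    using sum.mono_neutral_right[OF A(1) A(4), of F] that sum.reindex[OF gy(1), of F] by simp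
  have rx: "(\<Sum>h\<in>A. F h) = (\<Sum>x\<in>I. F (gx x))" if "\<And>h. h \<notin> gx ` I \<Longrightarrow> F h = 0" for F :: "'g \<Rightarrow> 'z::comm_monoid_add"
    using sum.mono_neutral_right[OF A(1) A(3), of F] that sum.reindex[OF gx(1), of F] by simp
  have gram: "cmod (\<Sum>y\<in>A. H (gx x) y * cnj (H (gx x') y)) = \<bar>\<Sum>y\<in>I. T x y * T x' y\<bar> / B\<^sup>2"
    if "x \<in> I" "x' \<in> I" for x x'
  proof -
    have "(\<Sum>y\<in>A. H (gx x) y * cnj (H (gx x') y)) = (\<Sum>y\<in>I. complex_of_real (T x y * T x' y / B\<^sup>2))"
      using that by (subst ry) (auto simp: H H0 power2_eq_square)
    also have "\<dots> = complex_of_real ((\<Sum>y\<in>I. T x y * T x' y) / B\<^sup>2)"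
      by (simp only: of_real_sum sum_divide_distrib)
    finally show ?thesis by (simp only: norm_of_real) simp
  qed
  have "schatten_norm p A H \<le> schatten_bound p (R / B\<^sup>2) (S / B\<^sup>2)"
    unfolding schatten_bound_def
  proof (rule schatten_norm_le[OF A(1) p])
    fix g assume "g \<in> A"
    show "(\<Sum>g'\<in>A. cmod (\<Sum>y\<in>A. H g y * cnj (H g' y))) \<le> R / B\<^sup>2"
    proof (cases "g \<in> gx ` I")
      case False
      thus ?thesis using R by (simp add: H0)
    next
      case True
      then obtain x where x: "x \<in> I" "g = gx x" by blast
      have "(\<Sum>g'\<in>A. cmod (\<Sum>y\<in>A. H g y * cnj (H g' y))) = (\<Sum>x'\<in>I. cmod (\<Sum>y\<in>A. H (gx x) y * cnj (H (gx x') y)))"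
        unfolding x by (rule rx) (simp add: H0)
      also have "\<dots> = (\<Sum>x'\<in>I. \<bar>\<Sum>y\<in>I. T x y * T x' y\<bar>) / B\<^sup>2"
        unfolding sum_divide_distrib by (intro sum.cong refl gram x)
      also have "\<dots> \<le> R / B\<^sup>2" by (intro divide_right_mono rows x) simp
      finally show ?thesis .
    qed
  next
    have "(\<Sum>x\<in>A. \<Sum>y\<in>A. (cmod (H x y))\<^sup>2) = (\<Sum>x\<in>I. \<Sum>y\<in>A. (cmod (H (gx x) y))\<^sup>2)"
      by (rule rx) (simp add: H0)
    also have "\<dots> = (\<Sum>x\<in>I. \<Sum>y\<in>I. (cmod (H (gx x) (gy y)))\<^sup>2)"
      by (intro sum.cong refl ry) (simp add: H0)
    also have "\<dots> = (\<Sum>x\<in>I. \<Sum>y\<in>I. (T x y)\<^sup>2 / B\<^sup>2)"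
    proof (intro sum.cong refl)
      fix x y assume "x \<in> I" "y \<in> I"
      thus "(cmod (H (gx x) (gy y)))\<^sup>2 = (T x y)\<^sup>2 / B\<^sup>2"
        by (simp only: H norm_of_real) (simp add: power_divide)
    qed
    also have "\<dots> = (\<Sum>x\<in>I. \<Sum>y\<in>I. (T x y)\<^sup>2) / B\<^sup>2" by (simp only: sum_divide_distrib)
    also have "\<dots> \<le> S / B\<^sup>2" by (intro divide_right_mono sq) simp
    finally show "(\<Sum>x\<in>A. \<Sum>y\<in>A. (cmod (H x y))\<^sup>2) \<le> S / B\<^sup>2" .
  qed (use R in simp)
  hence H1: "schatten_norm p A H \<le> 1"
    using schatten_bound_normalise[OF p R S] by (simp add: B_def)
  have "ereal (schatten_norm p A (\<lambda>x y. M x y * H x y)) \<le> schur_mult_norm p \<Omega> M"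
    unfolding schur_mult_norm_def using A H1 by (intro Sup_upper) blast
  hence MN: "schatten_norm p A (\<lambda>x y. M x y * H x y) \<le> N"
    using N order_trans by fastforce
  have "(\<Sum>x\<in>I. \<Sum>y\<in>I. M (gx x) (gy y) * complex_of_real (T x y))
      = B * (\<Sum>g\<in>gx ` I. \<Sum>h\<in>gy ` I. M g h * H g h)"
  proof -
    have "(\<Sum>g\<in>gx ` I. \<Sum>h\<in>gy ` I. M g h * H g h) = (\<Sum>x\<in>I. \<Sum>y\<in>I. M (gx x) (gy y) * H (gx x) (gy y))"
      by (simp add: sum.reindex[OF gx(1)] sum.reindex[OF gy(1)])
    also have "\<dots> = (\<Sum>x\<in>I. \<Sum>y\<in>I. M (gx x) (gy y) * complex_of_real (T x y) / B)"
      by (intro sum.cong refl) (simp add: H)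
    also have "\<dots> = (\<Sum>x\<in>I. \<Sum>y\<in>I. M (gx x) (gy y) * complex_of_real (T x y)) / B"
      by (simp only: sum_divide_distrib)
    finally show ?thesis using B by simp
  qed
  hence "cmod (\<Sum>x\<in>I. \<Sum>y\<in>I. M (gx x) (gy y) * complex_of_real (T x y))
      = B * cmod (\<Sum>g\<in>gx ` I. \<Sum>h\<in>gy ` I. M g h * H g h)"
    using B by (simp add: norm_mult)
  also have "\<dots> \<le> B * (schatten_norm p A (\<lambda>x y. M x y * H x y) * (sqrt (card (gx ` I)) * sqrt (card (gy ` I))))"
    using p B by (cases p) (auto intro!: mult_left_mono schatten_norm_ge A)
  also have "\<dots> = B * (schatten_norm p A (\<lambda>x y. M x y * H x y) * card I)"
    using gx gy by (simp add: card_image)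
  also have "\<dots> \<le> B * (N * card I)"
    using B by (intro mult_left_mono mult_right_mono MN) auto
  finally show ?thesis by (simp add: B_def mult_ac)
qed

text \<open>The test with a single index. It bounds \<open>f\<close> by the norm, which settles
  small degrees, and it shows that the norm cannot be negative.\<close>

lemma schur_mult_norm_coefficient:
  assumes "a \<in> \<Omega>" "b \<in> \<Omega>" "2 < p" "schur_mult_norm p \<Omega> M \<le> ereal N"
  shows "cmod (M a b) \<le> N"
proof -
  have "schatten_bound p 1 1 = 1" by (simp add: schatten_bound_def)
  thus ?thesis
    using schur_mult_norm_test[of "{()}" "\<lambda>_. a" \<Omega> "\<lambda>_. b" p 1 1 "\<lambda>_ _. 1" M N] assms by simp
qed

lemma schatten_bound_incidence:
  assumes p: "4 < p" and q: "1 < q"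
  obtains C \<theta> :: real where "0 < C" "0 < \<theta>" "\<theta> < 1"
    "\<And>n. schatten_bound p (2 * q ^ (n + 4)) (2 * q ^ n * q ^ (2 * n + 1)) = C * \<theta> ^ n * q ^ n"
proof (cases "p = \<infinity>")
  case True
  show ?thesis
  proof (rule that[of "sqrt (2 * q ^ 4)" "1 / sqrt q"])
    fix n
    have "(1 / sqrt q) ^ n * q ^ n = (q / sqrt q) ^ n"
      by (simp add: power_divide)
    also have "q / sqrt q = sqrt q" using q by (simp add: real_div_sqrt)
    finally show "schatten_bound p (2 * q ^ (n + 4)) (2 * q ^ n * q ^ (2 * n + 1))
       = sqrt (2 * q ^ 4) * (1 / sqrt q) ^ n * q ^ n"
      using q by (simp add: True schatten_bound_def power_add real_sqrt_mult real_sqrt_power mult_ac)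
  qed (use q in auto)
next
  case False
  then obtain r where r: "p = ereal r" "4 < r" using p by (cases p) auto
  define e where "e = (r - 2) / 2"
  define C where "C = ((2 * q ^ 4) powr e * (2 * q)) powr (1 / r)"
  define \<theta> where "\<theta> = q powr ((e + 3) / r - 1)"
  \<comment> \<open>Here \<open>e\<close> comes from \<open>R\<close>, of order q^n, and 3 from
    \<open>S\<close>, of order q^(3n). Since \<open>(e + 3) / r - 1 = 2 / r - 1 / 2\<close>, the
    inequality is equivalent to \<open>4 < r\<close>.\<close>
  have "(e + 3) / r < 1" using r by (simp add: e_def field_simps)
  hence th: "\<theta> < 1" 
    unfolding \<theta>_def using q powr_less_mono[of "(e + 3) / r - 1" 0 q] by simp
  show ?thesis
  proof (rule that[of C \<theta>])
    show "0 < C" using q by (simp add: C_def)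
    show "0 < \<theta>" using q by (simp add: \<theta>_def)
    fix n
    have "(2 * q ^ (n + 4)) powr e * (2 * q ^ n * q ^ (2 * n + 1))
       = ((2 * q ^ 4) powr e * (2 * q)) * (q powr (real n * e) * q powr (real n * 3))"
    proof -
      have "(2 * q ^ (n + 4)) powr e = (2 * q ^ 4) powr e * (q ^ n) powr e"
        using q by (simp add: power_add powr_mult mult_ac)
      also have "(q ^ n) powr e = q powr (real n * e)"
        using q by (simp add: powr_powr flip: powr_realpow)
      finally have 1: "(2 * q ^ (n + 4)) powr e = (2 * q ^ 4) powr e * q powr (real n * e)" .
      have "q powr (real n * 3) = q ^ (n * 3)"
        using q by (simp flip: powr_realpow)
      also have "\<dots> = q ^ n * q ^ (2 * n)" by (simp add: mult.commute flip: power_add)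
      finally show ?thesis using 1 by (simp add: mult_ac)
    qed
    also have "q powr (real n * e) * q powr (real n * 3) = q powr (real n * (e + 3))"
      by (simp add: algebra_simps flip: powr_add)
    finally have eq: "(2 * q ^ (n + 4)) powr e * (2 * q ^ n * q ^ (2 * n + 1))
        = ((2 * q ^ 4) powr e * (2 * q)) * q powr (real n * (e + 3))" .
    have "schatten_bound p (2 * q ^ (n + 4)) (2 * q ^ n * q ^ (2 * n + 1))
        = ((2 * q ^ (n + 4)) powr e * (2 * q ^ n * q ^ (2 * n + 1))) powr (1 / r)"
      using r by (simp add: schatten_bound_def e_def)
    also note eq
    also have "(((2 * q ^ 4) powr e * (2 * q)) * q powr (real n * (e + 3))) powr (1 / r) = C * q powr (real n * (e + 3) / r)"
      using q by (simp add: powr_mult powr_powr C_def)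
    also have "q powr (real n * (e + 3) / r) = q powr (real n * ((e + 3) / r - 1)) * q powr (real n)"
      by (simp add: algebra_simps flip: powr_add)
    also have "q powr (real n * ((e + 3) / r - 1)) = \<theta> ^ n"
      using q by (simp add: \<theta>_def powr_power mult.commute)
    also have "q powr real n = q ^ n" using q by (simp add: powr_realpow)
    finally show "schatten_bound p (2 * q ^ (n + 4)) (2 * q ^ n * q ^ (2 * n + 1)) = C * \<theta> ^ n * q ^ n"
      by simp
  qed (fact th)
qed

lemma (in incidence) multiplier_difference:
  fixes gx gy :: "'a fls \<times> 'a fls \<Rightarrow> 'g" and M :: "'g \<Rightarrow> 'g \<Rightarrow> complex"
  assumes gx: "inj_on gx X" "gx ` X \<subseteq> \<Omega>" and gy: "inj_on gy X" "gy ` X \<subseteq> \<Omega>"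
    and p: "2 < p" and N: "schur_mult_norm p \<Omega> M \<le> ereal N"
    and a: "\<And>x y. x \<in> X \<Longrightarrow> y \<in> X \<Longrightarrow> \<rho> x y - t_pow (Suc n) \<in> deg_le (int n - 1) \<Longrightarrow> M (gx x) (gy y) = a"
    and b: "\<And>x y. x \<in> X \<Longrightarrow> y \<in> X \<Longrightarrow> \<rho> x y - t_pow n \<in> deg_le (int n - 1) \<Longrightarrow> M (gx x) (gy y) = b"
  shows "q ^ n * cmod (a - b) \<le> schatten_bound p (2 * q ^ (n + 4)) (2 * q ^ n * q ^ (2 * n + 1)) * N"
proof -
  have q0: "q > 0" by (simp add: q card_gt_0_iff)
  have "cmod (\<Sum>x\<in>X. \<Sum>y\<in>X. M (gx x) (gy y) * complex_of_real (T x y))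
     \<le> schatten_bound p (2 * q ^ (n + 4)) (2 * q ^ n * q ^ (2 * n + 1)) * card X * N"
    by (rule schur_mult_norm_test[OF finite_X gx gy p _ _ gram_row_sum _ N])
       (use q0 sum_square_T in auto)
  also have "(\<Sum>x\<in>X. \<Sum>y\<in>X. M (gx x) (gy y) * complex_of_real (T x y)) = of_real (card X * q ^ n) * (a - b)"
    by (rule sum_T_weighted[OF a b])
  also have "cmod \<dots> = card X * (q ^ n * cmod (a - b))"
    using q0 by (simp add: norm_mult norm_power)
  finally have "card X * (q ^ n * cmod (a - b)) \<le> card X * (schatten_bound p (2 * q ^ (n + 4)) (2 * q ^ n * q ^ (2 * n + 1)) * N)"
    by (simp add: mult_ac)
  moreover have "real (card X) > 0" using q0 by (simp add: card_X)
  ultimately show ?thesis by simp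
qed

section \<open>Symplectic matrices and the Cartan decomposition\<close>

definition M4 :: "'a \<Rightarrow> 'a \<Rightarrow> 'a \<Rightarrow> 'a \<Rightarrow> 'a \<Rightarrow> 'a \<Rightarrow> 'a \<Rightarrow> 'a \<Rightarrow> 'a \<Rightarrow> 'a \<Rightarrow> 'a \<Rightarrow> 'a \<Rightarrow> 'a \<Rightarrow> 'a \<Rightarrow> 'a \<Rightarrow> 'a \<Rightarrow> ('a::zero) m4" where
  "M4 a00 a01 a02 a03 a10 a11 a12 a13 a20 a21 a22 a23 a30 a31 a32 a33
   = (\<lambda>i j. if i < 4 \<and> j < 4 then
       [[a00, a01, a02, a03], [a10, a11, a12, a13], [a20, a21, a22, a23], [a30, a31, a32, a33]] ! i ! j else 0)"

lemma M4_nth [simp]: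
  "M4 a00 a01 a02 a03 a10 a11 a12 a13 a20 a21 a22 a23 a30 a31 a32 a33 0 0 = a00"
  "M4 a00 a01 a02 a03 a10 a11 a12 a13 a20 a21 a22 a23 a30 a31 a32 a33 0 1 = a01"
  "M4 a00 a01 a02 a03 a10 a11 a12 a13 a20 a21 a22 a23 a30 a31 a32 a33 0 2 = a02"
  "M4 a00 a01 a02 a03 a10 a11 a12 a13 a20 a21 a22 a23 a30 a31 a32 a33 0 3 = a03"
  "M4 a00 a01 a02 a03 a10 a11 a12 a13 a20 a21 a22 a23 a30 a31 a32 a33 1 0 = a10"
  "M4 a00 a01 a02 a03 a10 a11 a12 a13 a20 a21 a22 a23 a30 a31 a32 a33 1 1 = a11"
  "M4 a00 a01 a02 a03 a10 a11 a12 a13 a20 a21 a22 a23 a30 a31 a32 a33 1 2 = a12"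
  "M4 a00 a01 a02 a03 a10 a11 a12 a13 a20 a21 a22 a23 a30 a31 a32 a33 1 3 = a13"
  "M4 a00 a01 a02 a03 a10 a11 a12 a13 a20 a21 a22 a23 a30 a31 a32 a33 2 0 = a20"
  "M4 a00 a01 a02 a03 a10 a11 a12 a13 a20 a21 a22 a23 a30 a31 a32 a33 2 1 = a21"
  "M4 a00 a01 a02 a03 a10 a11 a12 a13 a20 a21 a22 a23 a30 a31 a32 a33 2 2 = a22"
  "M4 a00 a01 a02 a03 a10 a11 a12 a13 a20 a21 a22 a23 a30 a31 a32 a33 2 3 = a23"
  "M4 a00 a01 a02 a03 a10 a11 a12 a13 a20 a21 a22 a23 a30 a31 a32 a33 3 0 = a30"
  "M4 a00 a01 a02 a03 a10 a11 a12 a13 a20 a21 a22 a23 a30 a31 a32 a33 3 1 = a31"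
  "M4 a00 a01 a02 a03 a10 a11 a12 a13 a20 a21 a22 a23 a30 a31 a32 a33 3 2 = a32"
  "M4 a00 a01 a02 a03 a10 a11 a12 a13 a20 a21 a22 a23 a30 a31 a32 a33 3 3 = a33"

  by (simp_all add: M4_def)

lemmas M4_nth_Suc_0 [simp] = M4_nth[unfolded One_nat_def]

lemma less_4_iff: "(i::nat) < 4 \<longleftrightarrow> i = 0 \<or> i = 1 \<or> i = 2 \<or> i = 3"
  by auto

lemma all_less_4: "(\<forall>i<4. P i) \<longleftrightarrow> P 0 \<and> P 1 \<and> P 2 \<and> P (3::nat)"
  by (auto simp: less_4_iff)

lemma sum_less_4: "(\<Sum>k<4. f k) = f 0 + f 1 + f 2 + f (3::nat)"
  by (simp add: eval_nat_numeral add.assoc)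

lemma is_m4_M4 [simp]: "is_m4 (M4 a00 a01 a02 a03 a10 a11 a12 a13 a20 a21 a22 a23 a30 a31 a32 a33)"
  by (auto simp: is_m4_def M4_def)

lemma is_m4_eqI:
  assumes "is_m4 A" "is_m4 B" "\<And>i j. i < 4 \<Longrightarrow> j < 4 \<Longrightarrow> A i j = B i j"
  shows "A = B"
proof (intro ext)
  fix i j show "A i j = B i j"
    using assms by (cases "i < 4 \<and> j < 4") (auto simp: is_m4_def)
qed

lemma eq_M4_iff:
  assumes "is_m4 A"
  shows "A = M4 a00 a01 a02 a03 a10 a11 a12 a13 a20 a21 a22 a23 a30 a31 a32 a33 \<longleftrightarrow> A 0 0 = a00 & A 0 1 = a01 & A 0 2 = a02 & A 0 3 = a03 & A 1 0 = a10 & A 1 1 = a11 & A 1 2 = a12 & A 1 3 = a13 & A 2 0 = a20 & A 2 1 = a21 & A 2 2 = a22 & A 2 3 = a23 & A 3 0 = a30 & A 3 1 = a31 & A 3 2 = a32 & A 3 3 = a33"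
    (is "?l \<longleftrightarrow> ?r")
proof
  assume ?r
  show ?l
  proof (rule is_m4_eqI[OF assms is_m4_M4])
    fix i j :: nat assume "i < 4" "j < 4"
    thus "A i j = M4 a00 a01 a02 a03 a10 a11 a12 a13 a20 a21 a22 a23 a30 a31 a32 a33 i j"
      using \<open>?r\<close> unfolding less_4_iff by (elim disjE) (simp_all only: M4_nth)
  qed
qed (simp only: M4_nth simp_thms)

lemma m4_mult_nth: "i < 4 \<Longrightarrow> j < 4 \<Longrightarrow>
    m4_mult A B i j = A i 0 * B 0 j + A i 1 * B 1 j + A i 2 * B 2 j + A i 3 * B 3 j"
  by (simp add: m4_mult_def sum_less_4)

lemma is_m4_mult [simp]: "is_m4 (m4_mult A B)"
  by (auto simp: is_m4_def m4_mult_def)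

lemma m4_mult_M4: "m4_mult (M4 a00 a01 a02 a03 a10 a11 a12 a13 a20 a21 a22 a23 a30 a31 a32 a33) (M4 b00 b01 b02 b03 b10 b11 b12 b13 b20 b21 b22 b23 b30 b31 b32 b33)
  = M4 (a00 * b00 + a01 * b10 + a02 * b20 + a03 * b30) (a00 * b01 + a01 * b11 + a02 * b21 + a03 * b31) (a00 * b02 + a01 * b12 + a02 * b22 + a03 * b32) (a00 * b03 + a01 * b13 + a02 * b23 + a03 * b33) (a10 * b00 + a11 * b10 + a12 * b20 + a13 * b30) (a10 * b01 + a11 * b11 + a12 * b21 + a13 * b31) (a10 * b02 + a11 * b12 + a12 * b22 + a13 * b32) (a10 * b03 + a11 * b13 + a12 * b23 + a13 * b33) (a20 * b00 + a21 * b10 + a22 * b20 + a23 * b30) (a20 * b01 + a21 * b11 + a22 * b21 + a23 * b31) (a20 * b02 + a21 * b12 + a22 * b22 + a23 * b32) (a20 * b03 + a21 * b13 + a22 * b23 + a23 * b33) (a30 * b00 + a31 * b10 + a32 * b20 + a33 * b30) (a30 * b01 + a31 * b11 + a32 * b21 + a33 * b31) (a30 * b02 + a31 * b12 + a32 * b22 + a33 * b32) (a30 * b03 + a31 * b13 + a32 * b23 + a33 * b33)"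
  by (subst eq_M4_iff) (simp_all add: m4_mult_nth)

lemma m4_mult_assoc: "m4_mult (m4_mult A B) C = m4_mult A (m4_mult B (C :: 'a::comm_ring_1 m4))"
  by (rule is_m4_eqI) (simp_all add: m4_mult_nth algebra_simps)

lemma is_m4_one [simp]: "is_m4 (m4_one :: 'a::comm_ring_1 m4)"
  by (auto simp: is_m4_def m4_one_def)

lemma is_m4_transpose [simp]: "is_m4 (m4_transpose A) \<longleftrightarrow> is_m4 A"
  by (auto simp: is_m4_def m4_transpose_def)

lemma is_m4_J4 [simp]: "is_m4 (J4 :: 'a::comm_ring_1 m4)"
  by (auto simp: is_m4_def J4_def)

lemma m4_one_mult [simp]: "is_m4 A \<Longrightarrow> m4_mult m4_one A = (A :: 'a::comm_ring_1 m4)"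
  by (rule is_m4_eqI) (auto simp: m4_mult_nth m4_one_def less_4_iff)

lemma m4_mult_one [simp]: "is_m4 A \<Longrightarrow> m4_mult A m4_one = (A :: 'a::comm_ring_1 m4)"
  by (rule is_m4_eqI) (auto simp: m4_mult_nth m4_one_def less_4_iff)

lemma m4_transpose_mult:
  "m4_transpose (m4_mult A B) = m4_mult (m4_transpose B) (m4_transpose (A :: 'a::comm_ring_1 m4))"
proof (rule is_m4_eqI)
  fix i j :: nat assume "i < 4" "j < 4"
  thus "m4_transpose (m4_mult A B) i j = m4_mult (m4_transpose B) (m4_transpose A) i j"
    unfolding m4_transpose_def by (simp add: m4_mult_nth mult.commute)
qed auto

lemma m4_transpose_one [simp]: "m4_transpose (m4_one :: 'a::comm_ring_1 m4) = m4_one"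
  by (auto simp: m4_transpose_def m4_one_def fun_eq_iff)

section \<open>Symplectic groups over subrings\<close>

definition closed_ring :: "('a::comm_ring_1) set \<Rightarrow> bool" where
  "closed_ring R \<longleftrightarrow> 0 \<in> R \<and> 1 \<in> R \<and> (\<forall>x\<in>R. - x \<in> R) \<and> (\<forall>x\<in>R. \<forall>y\<in>R. x + y \<in> R \<and> x * y \<in> R)"

lemma power_series_ring_eq: "power_series_ring = deg_le 0"
  by (auto simp: power_series_ring_def deg_le_def)

lemma closed_ring_UNIV [simp]: "closed_ring UNIV"
  by (simp add: closed_ring_def)

lemma closed_ring_power_series [simp]: "closed_ring (power_series_ring :: 'a::field fls set)"
  unfolding closed_ring_def power_series_ring_eq
  using deg_le_mult[of _ 0 _ 0] by (auto intro: deg_le_add)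

lemma closed_ring_inv_poly [simp]: "closed_ring (inv_poly_ring :: 'a::field fls set)"
  by (auto simp: closed_ring_def intro: inv_poly_ring_add inv_poly_ring_mult)

lemma m4_mult_entries:
  assumes "closed_ring R" "\<forall>i j. A i j \<in> R" "\<forall>i j. B i j \<in> R"
  shows "m4_mult A B i j \<in> R"
proof (cases "i < 4 \<and> j < 4")
  case True
  thus ?thesis using assms by (simp add: m4_mult_nth closed_ring_def)
next
  case False
  thus ?thesis using assms by (auto simp: m4_mult_def closed_ring_def)
qed

lemma Sp4_is_m4: "A \<in> Sp4 R \<Longrightarrow> is_m4 A"
  by (simp add: Sp4_def)

lemma Sp4_mono: "A \<in> Sp4 R \<Longrightarrow> R \<subseteq> S \<Longrightarrow> A \<in> Sp4 S"
  by (auto simp: Sp4_def)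

lemma Sp4_mult:
  assumes R: "closed_ring R" and A: "A \<in> Sp4 R" and B: "B \<in> Sp4 R"
  shows "m4_mult A B \<in> Sp4 R"
proof -
  have "m4_mult (m4_mult (m4_transpose (m4_mult A B)) J4) (m4_mult A B)
      = m4_mult (m4_mult (m4_transpose B) (m4_mult (m4_mult (m4_transpose A) J4) A)) B"
    by (simp only: m4_transpose_mult m4_mult_assoc)
  also have "\<dots> = J4" using A B by (simp add: Sp4_def)
  finally show ?thesis using A B R by (simp add: Sp4_def m4_mult_entries)
qed

lemma Sp4_one [simp]: "closed_ring R \<Longrightarrow> m4_one \<in> Sp4 R"
  by (auto simp: Sp4_def closed_ring_def) (auto simp: m4_one_def)

lemma J4_square: "m4_mult J4 J4 = (\<lambda>i j. - (m4_one i j :: 'a::comm_ring_1))"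
proof (rule is_m4_eqI)
  show "is_m4 (\<lambda>i j. - (m4_one i j :: 'a))" using is_m4_one by (simp add: is_m4_def)
qed (auto simp: m4_mult_nth J4_def m4_one_def less_4_iff)

lemma m4_mult_uminus: "m4_mult (\<lambda>i j. - A i j) B = (\<lambda>i j. - (m4_mult A B i j :: 'a::comm_ring_1))"
  by (auto simp: fun_eq_iff m4_mult_def sum_negf)

text \<open>From A^t J A = J and J^2 = -1 the inverse of a symplectic matrix is -J A^t J. In this
  form its entries visibly stay in the same subring.\<close>

definition m4_adj :: "('a::comm_ring_1) m4 \<Rightarrow> 'a m4" where
  "m4_adj A = m4_mult (m4_mult (\<lambda>i j. - J4 i j) (m4_transpose A)) J4"

lemma m4_adj_mult: "A \<in> Sp4 R \<Longrightarrow> m4_mult (m4_adj A) A = m4_one"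
proof -
  assume A: "A \<in> Sp4 R"
  have "m4_mult (m4_adj A) A = m4_mult (\<lambda>i j. - J4 i j) (m4_mult (m4_mult (m4_transpose A) J4) A)"
    by (simp only: m4_adj_def m4_mult_assoc)
  also have "\<dots> = m4_mult (\<lambda>i j. - J4 i j) J4" using A by (simp add: Sp4_def)
  also have "\<dots> = m4_one" by (simp add: m4_mult_uminus J4_square)
  finally show ?thesis .
qed

lemma m4_left_inverse_imp_right:
  fixes A B :: "'a::field m4"
  assumes "m4_mult B A = m4_one"
  shows "m4_mult A B = m4_one"
proof (rule is_m4_eqI)
  fix i j :: nat assume ij: "i < 4" "j < 4"
  have "(\<Sum>k<4. A i k * B k j) = (if i = j then 1 else 0)"
  proof (rule left_inverse_imp_right_inverse_on)
    fix i j :: nat assume "i \<in> {..<4}" "j \<in> {..<4}"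
    thus "(\<Sum>k<4. B i k * A k j) = (if i = j then 1 else 0)"
      using fun_cong[OF fun_cong[OF assms, of i], of j] by (simp add: m4_mult_def m4_one_def)
  qed (use ij in auto)
  thus "m4_mult A B i j = m4_one i j" using ij by (simp add: m4_mult_def m4_one_def)
qed auto

lemma m4_mult_adj: "A \<in> Sp4 R \<Longrightarrow> m4_mult A (m4_adj A) = (m4_one :: 'a::field m4)"
  by (rule m4_left_inverse_imp_right[OF m4_adj_mult])

lemma Sp4_adj:
  fixes A :: "'a::field m4"
  assumes R: "closed_ring R" and A: "A \<in> Sp4 R"
  shows "m4_adj A \<in> Sp4 R"
proof -
  have J: "J4 i j \<in> R" "- J4 i j \<in> R" for i j using R by (auto simp: J4_def closed_ring_def)
  have ent: "m4_adj A i j \<in> R" for i j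
    unfolding m4_adj_def using A R J
    by (intro m4_mult_entries) (auto simp: m4_transpose_def Sp4_def intro!: m4_mult_entries)
  let ?B = "m4_adj A"
  have BA: "m4_mult (m4_transpose ?B) (m4_transpose A) = m4_one"
    using m4_mult_adj[OF A] by (simp add: m4_transpose_mult[symmetric])
  have "m4_mult (m4_mult (m4_transpose ?B) J4) ?B
      = m4_mult (m4_mult (m4_transpose ?B) (m4_mult (m4_mult (m4_transpose A) J4) A)) ?B"
    using A by (simp add: Sp4_def)
  also have "\<dots> = m4_mult (m4_mult (m4_mult (m4_transpose ?B) (m4_transpose A)) J4) (m4_mult A ?B)"
    by (simp only: m4_mult_assoc)
  also have "\<dots> = J4" unfolding BA m4_mult_adj[OF A] by simp
  finally show ?thesis using ent by (simp add: Sp4_def m4_adj_def)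
qed

lemma m4_inv_eqI:
  fixes A B :: "'a::field m4"
  assumes "is_m4 A" "is_m4 B" "m4_mult B A = m4_one"
  shows "m4_inv A = B"
  unfolding m4_inv_def
proof (rule the_equality)
  fix C assume C: "is_m4 C \<and> m4_mult C A = m4_one"
  have "C = m4_mult C (m4_mult A B)" using C m4_left_inverse_imp_right[OF assms(3)] by simp
  also have "\<dots> = m4_mult (m4_mult C A) B" by (simp only: m4_mult_assoc)
  also have "\<dots> = B" using C assms by simp
  finally show "C = B" .
qed (use assms in auto)

lemma Sp4D:
  assumes "A \<in> Sp4 R"
  shows "A 0 0 * A 3 1 + A 1 0 * A 2 1 - A 2 0 * A 1 1 - A 3 0 * A 0 1 = 0"
    and "A 0 0 * A 3 2 + A 1 0 * A 2 2 - A 2 0 * A 1 2 - A 3 0 * A 0 2 = 0"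
    and "A 0 0 * A 3 3 + A 1 0 * A 2 3 - A 2 0 * A 1 3 - A 3 0 * A 0 3 = 1"
    and "A 0 1 * A 3 2 + A 1 1 * A 2 2 - A 2 1 * A 1 2 - A 3 1 * A 0 2 = 1"
    and "A 0 1 * A 3 3 + A 1 1 * A 2 3 - A 2 1 * A 1 3 - A 3 1 * A 0 3 = 0"
    and "A 0 2 * A 3 3 + A 1 2 * A 2 3 - A 2 2 * A 1 3 - A 3 2 * A 0 3 = 0"
proof -
  have E: "m4_mult (m4_mult (m4_transpose A) J4) A i j = J4 i j" for i j
    using assms by (simp add: Sp4_def)
  note simps = m4_mult_nth m4_transpose_def J4_def
  show "A 0 0 * A 3 1 + A 1 0 * A 2 1 - A 2 0 * A 1 1 - A 3 0 * A 0 1 = 0"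
    using E[of 0 1] by (simp add: simps algebra_simps)
  show "A 0 0 * A 3 2 + A 1 0 * A 2 2 - A 2 0 * A 1 2 - A 3 0 * A 0 2 = 0"
    using E[of 0 2] by (simp add: simps algebra_simps)
  show "A 0 0 * A 3 3 + A 1 0 * A 2 3 - A 2 0 * A 1 3 - A 3 0 * A 0 3 = 1"
    using E[of 0 3] by (simp add: simps algebra_simps)
  show "A 0 1 * A 3 2 + A 1 1 * A 2 2 - A 2 1 * A 1 2 - A 3 1 * A 0 2 = 1"
    using E[of 1 2] by (simp add: simps algebra_simps)
  show "A 0 1 * A 3 3 + A 1 1 * A 2 3 - A 2 1 * A 1 3 - A 3 1 * A 0 3 = 0"
    using E[of 1 3] by (simp add: simps algebra_simps)
  show "A 0 2 * A 3 3 + A 1 2 * A 2 3 - A 2 2 * A 1 3 - A 3 2 * A 0 3 = 0"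
    using E[of 2 3] by (simp add: simps algebra_simps)
qed

text \<open>The entries of A^t J A are the pairings of the columns under an alternating form, so the
  six pairs of distinct columns suffice.\<close>

lemma Sp4I:
  fixes A :: "'a::comm_ring_1 m4"
  assumes A: "is_m4 A" and R: "0 \<in> R" "\<forall>i<4. \<forall>j<4. A i j \<in> R"
    and eqs: "A 0 0 * A 3 1 + A 1 0 * A 2 1 = A 2 0 * A 1 1 + A 3 0 * A 0 1"
      "A 0 0 * A 3 2 + A 1 0 * A 2 2 = A 2 0 * A 1 2 + A 3 0 * A 0 2"
      "A 0 0 * A 3 3 + A 1 0 * A 2 3 = 1 + A 2 0 * A 1 3 + A 3 0 * A 0 3"
      "A 0 1 * A 3 2 + A 1 1 * A 2 2 = 1 + A 2 1 * A 1 2 + A 3 1 * A 0 2"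
      "A 0 1 * A 3 3 + A 1 1 * A 2 3 = A 2 1 * A 1 3 + A 3 1 * A 0 3"
      "A 0 2 * A 3 3 + A 1 2 * A 2 3 = A 2 2 * A 1 3 + A 3 2 * A 0 3"
  shows "A \<in> Sp4 R"
proof -
  define w where "w = (\<lambda>i j. A 0 i * A 3 j + A 1 i * A 2 j - A 2 i * A 1 j - A 3 i * A 0 j)"
  have w0: "w 0 1 = 0" "w 0 2 = 0" "w 0 3 = 1" "w 1 2 = 1" "w 1 3 = 0" "w 2 3 = 0"
    unfolding w_def using eqs by simp_all
  have wa: "w i j = - w j i" "w i i = 0" for i j by (simp_all add: w_def algebra_simps)
  have "m4_mult (m4_mult (m4_transpose A) J4) A = J4"
  proof (rule is_m4_eqI)
    fix i j :: nat assume ij: "i < 4" "j < 4"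
    have "m4_mult (m4_mult (m4_transpose A) J4) A i j = w i j"
      using ij by (simp add: m4_mult_nth m4_transpose_def J4_def w_def algebra_simps)
    also have "\<dots> = J4 i j"
      using ij w0 wa(2) wa(1)[of 1 0] wa(1)[of 2 0] wa(1)[of 3 0] wa(1)[of 2 1] wa(1)[of 3 1] wa(1)[of 3 2]
      unfolding less_4_iff by (elim disjE) (simp_all add: J4_def)
    finally show "m4_mult (m4_mult (m4_transpose A) J4) A i j = J4 i j" .
  qed auto
  moreover have "A i j \<in> R" for i j
    using A R by (cases "i < 4 \<and> j < 4") (auto simp: is_m4_def)
  ultimately show ?thesis using A by (simp add: Sp4_def)
qed

section \<open>Double cosets of K and the two degree invariants\<close>

abbreviation (input) K4 :: "'a::field fls m4 set" where
  "K4 \<equiv> Sp4 power_series_ring"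

definition keq :: "'a::field fls m4 \<Rightarrow> 'a fls m4 \<Rightarrow> bool" where
  "keq g h \<longleftrightarrow> g \<in> double_coset K4 h"

lemma keqI: "k1 \<in> K4 \<Longrightarrow> k2 \<in> K4 \<Longrightarrow> g = m4_mult (m4_mult k1 h) k2 \<Longrightarrow> keq g h"
  by (auto simp: keq_def double_coset_def)

lemma keqE:
  assumes "keq g h"
  obtains k1 k2 where "k1 \<in> K4" "k2 \<in> K4" "g = m4_mult (m4_mult k1 h) k2"
  using assms by (auto simp: keq_def double_coset_def)

lemma keq_left: "k \<in> K4 \<Longrightarrow> is_m4 g \<Longrightarrow> keq (m4_mult k g) g"
  by (rule keqI[of k m4_one]) auto

lemma keq_right: "k \<in> K4 \<Longrightarrow> is_m4 g \<Longrightarrow> keq (m4_mult g k) g"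
  by (rule keqI[of m4_one k]) auto

lemma keq_trans:
  assumes "keq g h" "keq h l"
  shows "keq g l"
proof -
  obtain a b where ab: "a \<in> K4" "b \<in> K4" "g = m4_mult (m4_mult a h) b" using assms(1) by (rule keqE)
  obtain c d where cd: "c \<in> K4" "d \<in> K4" "h = m4_mult (m4_mult c l) d" using assms(2) by (rule keqE)
  show ?thesis
    by (rule keqI[of "m4_mult a c" "m4_mult d b"]) (use ab cd in \<open>auto simp: m4_mult_assoc intro: Sp4_mult\<close>)
qed

lemma keq_sym:
  assumes "keq g h" "is_m4 h"
  shows "keq h g"
proof -
  obtain a b where ab: "a \<in> K4" "b \<in> K4" "g = m4_mult (m4_mult a h) b" using assms(1) by (rule keqE)
  have "m4_mult (m4_mult (m4_adj a) g) (m4_adj b)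
      = m4_mult (m4_mult (m4_mult (m4_adj a) a) h) (m4_mult b (m4_adj b))"
    unfolding ab(3) by (simp only: m4_mult_assoc)
  also have "\<dots> = h"
    unfolding m4_adj_mult[OF ab(1)] m4_mult_adj[OF ab(2)] using assms(2) by simp
  finally show ?thesis
    using ab by (intro keqI[of "m4_adj a" "m4_adj b"]) (auto intro: Sp4_adj)
qed

definition entries_le :: "int \<Rightarrow> 'a::field fls m4 \<Rightarrow> bool" where
  "entries_le d g \<longleftrightarrow> (\<forall>i j. g i j \<in> deg_le d)"

definition minors_le :: "int \<Rightarrow> 'a::field fls m4 \<Rightarrow> bool" where
  "minors_le d g \<longleftrightarrow> (\<forall>i i' j j'. g i j * g i' j' - g i j' * g i' j \<in> deg_le d)"

lemma K4_entries: "k \<in> K4 \<Longrightarrow> k i j \<in> deg_le 0"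
  by (simp add: Sp4_def power_series_ring_eq)

lemma entries_le_mult:
  assumes "\<And>i j. a i j \<in> deg_le d" "\<And>i j. b i j \<in> deg_le e"
  shows "entries_le (d + e) (m4_mult a b)"
  unfolding entries_le_def m4_mult_def using assms by (auto intro!: deg_le_sum deg_le_mult)

text \<open>Cauchy-Binet: minors of the product are combinations of minors of \<open>g\<close> with
  coefficients in the ring of integers. Factors on the right are later treated by
  transposition.\<close>

lemma minors_le_left:
  assumes k: "\<And>i j. k i j \<in> deg_le 0" and g: "minors_le d g"
  shows "minors_le d (m4_mult k g)"
  unfolding minors_le_def
proof (intro allI)
  fix i i' j j' :: nat
  show "m4_mult k g i j * m4_mult k g i' j' - m4_mult k g i j' * m4_mult k g i' j \<in> deg_le d"
  proof (cases "i < 4 \<and> i' < 4 \<and> j < 4 \<and> j' < 4")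
    case True
    have "m4_mult k g i j * m4_mult k g i' j' - m4_mult k g i j' * m4_mult k g i' j
       = (\<Sum>a<4. \<Sum>b<4. (k i a * g a j) * (k i' b * g b j') - (k i a * g a j') * (k i' b * g b j))"
      using True by (simp add: m4_mult_def sum_product sum_subtractf)
    also have "\<dots> = (\<Sum>a<4. \<Sum>b<4. (k i a * k i' b) * (g a j * g b j' - g a j' * g b j))"
      by (intro sum.cong refl) (simp add: algebra_simps)
    also have "\<dots> \<in> deg_le d"
    proof (intro deg_le_sum)
      fix a b :: nat
      show "(k i a * k i' b) * (g a j * g b j' - g a j' * g b j) \<in> deg_le d"
        using g k by (intro deg_le_mult'[of _ 0 _ d] deg_le_mult'[of _ 0 _ 0]) (auto simp: minors_le_def)
    qed
    finally show ?thesis .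
  qed (auto simp: m4_mult_def)
qed

lemma minors_le_transpose: "minors_le d (m4_transpose g) \<longleftrightarrow> minors_le d g"
  unfolding minors_le_def m4_transpose_def by (metis mult.commute)

lemma minors_le_keq:
  assumes "keq g h" "minors_le d h"
  shows "minors_le d g"
proof -
  obtain a b where ab: "a \<in> K4" "b \<in> K4" "g = m4_mult (m4_mult a h) b" using assms(1) by (rule keqE)
  have "minors_le d (m4_mult (m4_transpose b) (m4_transpose (m4_mult a h)))"
  proof (rule minors_le_left)
    show "m4_transpose b i j \<in> deg_le 0" for i j using K4_entries[OF ab(2)] by (simp add: m4_transpose_def)
    show "minors_le d (m4_transpose (m4_mult a h))"
      unfolding minors_le_transpose by (rule minors_le_left[OF K4_entries[OF ab(1)] assms(2)])
  qed
  thus ?thesis unfolding ab(3) m4_transpose_mult[symmetric] minors_le_transpose .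
qed

lemma entries_le_keq:
  assumes "keq g h" "entries_le d h"
  shows "entries_le d g"
proof -
  obtain a b where ab: "a \<in> K4" "b \<in> K4" "g = m4_mult (m4_mult a h) b" using assms(1) by (rule keqE)
  have "entries_le (0 + d) (m4_mult a h)"
    using K4_entries[OF ab(1)] assms(2) by (intro entries_le_mult) (auto simp: entries_le_def)
  hence "entries_le (d + 0) g" unfolding ab(3)
    using K4_entries[OF ab(2)] by (intro entries_le_mult) (auto simp: entries_le_def)
  thus ?thesis by simp
qed

lemma keq_Sp4:
  assumes "keq g h" "h \<in> Sp4 UNIV"
  shows "g \<in> Sp4 UNIV"
proof -
  obtain a b where ab: "a \<in> K4" "b \<in> K4" "g = m4_mult (m4_mult a h) b" using assms(1) by (rule keqE)
  thus ?thesis using assms(2) Sp4_mono[of _ power_series_ring UNIV] by (auto intro!: Sp4_mult)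
qed

lemma entries_le_iff: "is_m4 g \<Longrightarrow> entries_le d g \<longleftrightarrow> (\<forall>i<4. \<forall>j<4. g i j \<in> deg_le d)"
  unfolding entries_le_def is_m4_def by (metis deg_le_0 not_less)

lemma minors_le_iff:
  assumes g: "is_m4 g"
  shows "minors_le d g \<longleftrightarrow> (\<forall>(i, i') \<in> {(0,1),(0,2),(0,3),(1,2),(1,3),(2,3)}.
    \<forall>(j, j') \<in> {(0,1),(0,2),(0,3),(1,2),(1,3),(2,3)}. g i j * g i' j' - g i j' * g i' j \<in> deg_le d)"
    (is "_ \<longleftrightarrow> ?R")
proof
  assume R: ?R
  define m where "m = (\<lambda>i i' j j'. g i j * g i' j' - g i j' * g i' j)"
  have mD: "m i i' j j' \<in> deg_le d" if "i < i'" "i' < 4" "j < j'" "j' < 4" for i i' j j'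
  proof -
    have "(i, i') \<in> {(0,1),(0,2),(0,3),(1,2),(1,3),(2,3)}" "(j, j') \<in> {(0,1),(0,2),(0,3),(1,2),(1,3),(2,3)}"
      using that by auto
    thus ?thesis using R unfolding m_def by blast
  qed
  have rows: "m i i' j j' = - m i' i j j'" and cols: "m i i' j j' = - m i i' j' j" for i i' j j'
    by (simp_all add: m_def algebra_simps)
  have out: "m i i' j j' = 0" if "4 \<le> i \<or> 4 \<le> i' \<or> 4 \<le> j \<or> 4 \<le> j' \<or> i = i' \<or> j = j'" for i i' j j'
    using that g by (auto simp: m_def is_m4_def)
  have "m i i' j j' \<in> deg_le d" for i i' j j'
  proof (cases "4 \<le> i \<or> 4 \<le> i' \<or> 4 \<le> j \<or> 4 \<le> j' \<or> i = i' \<or> j = j'")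
    case False
    then consider "i < i'" "j < j'" | "i < i'" "j' < j" | "i' < i" "j < j'" | "i' < i" "j' < j"
      by linarith
    thus ?thesis
    proof cases
      case 1 thus ?thesis using mD False by simp
    next
      case 2 thus ?thesis using mD[of i i' j' j] cols[of i i' j j'] False by simp
    next
      case 3 thus ?thesis using mD[of i' i j j'] rows[of i i' j j'] False by simp
    next
      case 4 thus ?thesis using mD[of i' i j' j] rows[of i i' j j'] cols[of i' i j j'] False by simp
    qed
  qed (simp add: out)
  thus "minors_le d g" by (simp add: minors_le_def m_def)
qed (auto simp: minors_le_def)

section \<open>Elimination with a pivot of maximal degree\<close>

lemma deg_le_divide:
  fixes x z :: "'a::field fls"
  assumes "z \<in> deg_le d" "z $$ (- d) \<noteq> 0" "x \<in> deg_le e"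
  shows "x / z \<in> deg_le (e - d)"
proof (cases "x = 0")
  case False
  have z: "z \<noteq> 0" "fls_subdegree z = - d" using assms by (auto intro!: fls_subdegree_eqI simp: deg_le_def)
  define y where "y = x / z"
  have x: "x = y * z" using z by (simp add: y_def)
  hence y: "y \<noteq> 0" using False by auto
  have "fls_subdegree x = fls_subdegree y + fls_subdegree z"
    unfolding x using y z(1) by (rule fls_subdegree_mult)
  hence "y \<in> deg_le (e - d)"
    using False z(2) assms(3) y by (simp add: deg_le_iff_subdegree)
  thus ?thesis by (simp add: y_def)
qed simp

lemma is_m4_nonzeroD:
  assumes "is_m4 g" "g i j \<noteq> 0"
  shows "i < 4 \<and> j < 4"
proof (rule ccontr)
  assume "\<not> (i < 4 \<and> j < 4)"
  hence "4 \<le> i \<or> 4 \<le> j" by auto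
  thus False using assms by (auto simp: is_m4_def)
qed

lemma max_entry:
  fixes g :: "'a::field fls m4"
  assumes g: "is_m4 g" and nz: "g r0 c0 \<noteq> 0"
  obtains d r c where "r < 4" "c < 4" "entries_le d g" "g r c $$ (- d) \<noteq> 0"
proof -
  define S where "S = (\<lambda>(r, c). fls_subdegree (g r c)) ` {(r, c) \<in> {..<4} \<times> {..<4}. g r c \<noteq> 0}"
  have fin: "finite S" unfolding S_def by (intro finite_imageI) (rule finite_subset[of _ "{..<4} \<times> {..<4}"], auto)
  have "(r0, c0) \<in> {(r, c) \<in> {..<4} \<times> {..<4}. g r c \<noteq> 0}" using is_m4_nonzeroD[OF g nz] nz by simp
  hence "S \<noteq> {}" unfolding S_def by blast
  hence "Min S \<in> S" using fin by (rule Min_in[rotated])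
  then obtain r c where rc: "r < 4" "c < 4" "g r c \<noteq> 0" "Min S = fls_subdegree (g r c)"
    by (auto simp: S_def)
  have "g i j \<in> deg_le (- Min S)" for i j
  proof (cases "g i j = 0")
    case False
    hence "(i, j) \<in> {(r, c) \<in> {..<4} \<times> {..<4}. g r c \<noteq> 0}" using is_m4_nonzeroD[OF g False] by simp
    hence "fls_subdegree (g i j) \<in> S" unfolding S_def by force
    thus ?thesis using False fin by (simp add: deg_le_iff_subdegree)
  qed simp
  thus ?thesis using rc by (intro that[of r c "- Min S"]) (auto simp: entries_le_def)
qed

lemma ball_less_4: "(\<forall>i<4. \<forall>j<4. P i j) \<longleftrightarrow> (\<forall>i\<in>{0,1,2,3::nat}. \<forall>j\<in>{0,1,2,3::nat}. P i j)"
  by (simp add: all_less_4)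

text \<open>The matrices are signed permutations in K, representing Weyl group elements that move
  any coordinate to the first place; the signs fall on other rows.\<close>

lemma row_to_top:
  assumes "r < 4"
  obtains k where "k \<in> (K4 :: 'a::field fls m4 set)" "\<And>g j. j < 4 \<Longrightarrow> m4_mult k g 0 j = g r j"
proof -
  let ?k1 = "M4 0 1 0 0  1 0 0 0  0 0 0 1  0 0 1 0 :: 'a fls m4"
  let ?k2 = "M4 0 0 1 0  0 0 0 1  (-1) 0 0 0  0 (-1) 0 0 :: 'a fls m4"
  let ?k3 = "M4 0 0 0 1  0 1 0 0  0 0 1 0  (-1) 0 0 0 :: 'a fls m4"
  have k: "?k1 \<in> K4" "?k2 \<in> K4" "?k3 \<in> K4"
    by (rule Sp4I; simp add: power_series_ring_eq ball_less_4)+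
  consider "r = 0" | "r = 1" | "r = 2" | "r = 3" using assms by linarith
  thus ?thesis
  proof cases
    case 1 thus ?thesis by (intro that[of m4_one]) (simp, simp add: m4_mult_nth m4_one_def)
  next
    case 2 thus ?thesis by (intro that[OF k(1)]) (simp add: m4_mult_nth)
  next
    case 3 thus ?thesis by (intro that[OF k(2)]) (simp add: m4_mult_nth)
  next
    case 4 thus ?thesis by (intro that[OF k(3)]) (simp add: m4_mult_nth)
  qed
qed

lemma column_to_last:
  assumes "c < 4"
  obtains k where "k \<in> (K4 :: 'a::field fls m4 set)" "\<And>g i. i < 4 \<Longrightarrow> m4_mult g k i 3 = g i c"
proof -
  let ?k1 = "M4 0 1 0 0  1 0 0 0  0 0 0 1  0 0 1 0 :: 'a fls m4"
  let ?k2 = "M4 0 0 1 0  0 0 0 1  (-1) 0 0 0  0 (-1) 0 0 :: 'a fls m4"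
  let ?k3 = "M4 0 0 0 1  0 1 0 0  0 0 1 0  (-1) 0 0 0 :: 'a fls m4"
  have k: "?k1 \<in> K4" "?k2 \<in> K4" "?k3 \<in> K4"
    by (rule Sp4I; simp add: power_series_ring_eq ball_less_4)+
  consider "c = 0" | "c = 1" | "c = 2" | "c = 3" using assms by linarith
  thus ?thesis
  proof cases
    case 1 thus ?thesis by (intro that[OF k(3)]) (simp add: m4_mult_nth)
  next
    case 2 thus ?thesis by (intro that[OF k(2)]) (simp add: m4_mult_nth)
  next
    case 3 thus ?thesis by (intro that[OF k(1)]) (simp add: m4_mult_nth)
  next
    case 4 thus ?thesis by (intro that[of m4_one]) (simp, simp add: m4_mult_nth m4_one_def)
  qed
qed

lemma lower_unipotent_K4:
  assumes "a \<in> deg_le 0" "b \<in> deg_le 0" "c \<in> deg_le 0"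
  shows "M4 1 0 0 0  a 1 0 0  b 0 1 0  c b (- a) 1 \<in> (K4 :: 'a::field fls m4 set)"
  by (rule Sp4I) (use assms in \<open>simp_all add: power_series_ring_eq ball_less_4\<close>)

lemma middle_K4:
  assumes "a \<in> deg_le 0" "b \<in> deg_le 0" "c \<in> deg_le 0" "d \<in> deg_le 0" "a * d - b * c = 1"
  shows "M4 1 0 0 0  0 a b 0  0 c d 0  0 0 0 1 \<in> (K4 :: 'a::field fls m4 set)"
  by (rule Sp4I) (use assms in \<open>simp_all add: power_series_ring_eq ball_less_4 algebra_simps\<close>)

text \<open>The corner entry has maximal degree, so all quotients by it are integral: a lower
  unipotent factor in K on the right clears the first row, one on the left the last column. The
  symplectic relations then force the remaining border and leave a middle block of determinant
  1.\<close>

lemma clear_border: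
  fixes g :: "'a::field fls m4"
  assumes g: "g \<in> Sp4 UNIV" and le: "entries_le d g" and lead: "g 0 3 $$ (- d) \<noteq> 0"
  obtains m11 m12 m21 m22 where
    "keq g (M4 0 0 0 (g 0 3)  0 m11 m12 0  0 m21 m22 0  (- 1 / g 0 3) 0 0 0)"
    "m11 * m22 - m12 * m21 = 1"
    "m11 \<in> deg_le d" "m12 \<in> deg_le d" "m21 \<in> deg_le d" "m22 \<in> deg_le d"
proof -
  define z where "z = g 0 3"
  have z: "z \<in> deg_le d" "z $$ (- d) \<noteq> 0" "z \<noteq> 0" using le lead by (auto simp: z_def entries_le_def)
  have quot: "h i j / z \<in> deg_le 0" if "entries_le d h" for h :: "'a fls m4" and i j
    using deg_le_divide[OF z(1,2), of "h i j" d] that by (auto simp: entries_le_def)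
  define L where "L = M4 1 0 0 0  (g 0 2 / z) 1 0 0  (- g 0 1 / z) 0 1 0
      (- g 0 0 / z) (- g 0 1 / z) (- (g 0 2 / z)) 1"
  have L: "L \<in> K4" unfolding L_def using quot[OF le] by (intro lower_unipotent_K4) auto
  have g03: "g 0 3 = z" by (simp add: z_def)
  define h where "h = m4_mult g L"
  have gm: "is_m4 g" using g by (rule Sp4_is_m4)
  have hg: "keq h g" unfolding h_def using L gm by (rule keq_right)
  have h0: "h 0 0 = 0" "h 0 1 = 0" "h 0 2 = 0" "h 0 3 = z"
    using z(3) by (simp_all add: h_def L_def m4_mult_nth g03 mult.commute)
  have hle: "entries_le d h" by (rule entries_le_keq[OF hg le])
  define L' where "L' = M4 1 0 0 0  (- h 1 3 / z) 1 0 0  (- h 2 3 / z) 0 1 0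
      (- h 3 3 / z) (- h 2 3 / z) (- (- h 1 3 / z)) 1"
  have L': "L' \<in> K4" unfolding L'_def using quot[OF hle] by (intro lower_unipotent_K4) auto
  define l where "l = m4_mult L' h"
  have lh: "keq l h" unfolding l_def using L' by (rule keq_left) (simp add: h_def)
  have l0: "l 0 0 = 0" "l 0 1 = 0" "l 0 2 = 0" "l 0 3 = z" "l 1 3 = 0" "l 2 3 = 0" "l 3 3 = 0"
    using z(3) h0 by (simp_all add: l_def L'_def m4_mult_nth mult.commute)
  have lle: "entries_le d l" by (rule entries_le_keq[OF lh hle])
  have lg: "keq l g" by (rule keq_trans[OF lh hg])
  have lS: "l \<in> Sp4 UNIV" by (rule keq_Sp4[OF lg g])
  note E = Sp4D[OF lS]
  have l3: "l 3 0 = - 1 / z" "l 3 1 = 0" "l 3 2 = 0"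
  proof -
    have "- (l 3 0 * z) = 1" using E(3) unfolding l0 by simp
    hence "l 3 0 * z = - 1" by (metis minus_minus)
    thus "l 3 0 = - 1 / z" using z(3) by (subst eq_divide_eq) simp
    show "l 3 1 = 0" "l 3 2 = 0" using E(5,6) z(3) unfolding l0 by simp_all
  qed
  have det: "l 1 1 * l 2 2 - l 1 2 * l 2 1 = 1"
    using E(4) l0 l3 by (simp add: mult.commute)
  \<comment> \<open>The vector \<open>(l 1 0, l 2 0)\<close> is parallel to both columns of the
    middle block; as that block has determinant 1, the vector is zero.\<close>
  have e1: "l 1 0 * l 2 1 = l 2 0 * l 1 1" and e2: "l 1 0 * l 2 2 = l 2 0 * l 1 2"
    using E(1,2) l0 l3 by simp_all
  have "l 1 0 = l 1 0 * (l 1 1 * l 2 2 - l 1 2 * l 2 1)" using det by simp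
  also have "\<dots> = l 1 1 * (l 1 0 * l 2 2) - l 1 2 * (l 1 0 * l 2 1)" by (simp add: algebra_simps)
  also have "\<dots> = 0" unfolding e1 e2 by (simp add: algebra_simps)
  finally have l10: "l 1 0 = 0" .
  have "l 2 0 = l 2 0 * (l 1 1 * l 2 2 - l 1 2 * l 2 1)" using det by simp
  also have "\<dots> = l 2 2 * (l 2 0 * l 1 1) - l 2 1 * (l 2 0 * l 1 2)" by (simp add: algebra_simps)
  also have "\<dots> = 0" unfolding e1[symmetric] e2[symmetric] by (simp add: algebra_simps)
  finally have l20: "l 2 0 = 0" .
  have "l = M4 0 0 0 z  0 (l 1 1) (l 1 2) 0  0 (l 2 1) (l 2 2) 0  (- 1 / z) 0 0 0"
    using l0 l3 l10 l20 by (subst eq_M4_iff) (auto simp: l_def)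
  moreover have "keq g l" by (rule keq_sym[OF lg gm])
  ultimately show ?thesis
    using det lle by (intro that[of "l 1 1" "l 1 2" "l 2 1" "l 2 2"]) (auto simp: z_def entries_le_def)
qed

definition anti :: "'a::field fls \<Rightarrow> 'a fls \<Rightarrow> 'a fls m4" where
  "anti z w = M4 0 0 0 z  0 0 w 0  0 (- 1 / w) 0 0  (- 1 / z) 0 0 0"

lemma clear_middle_core:
  fixes z :: "'a::field fls"
  assumes det: "m11 * m22 - m12 * m21 = 1"
    and le: "m11 \<in> deg_le e" "m12 \<in> deg_le e" "m22 \<in> deg_le e" and lead: "m12 $$ (- e) \<noteq> 0"
  shows "keq (M4 0 0 0 z  0 m11 m12 0  0 m21 m22 0  (- 1 / z) 0 0 0) (anti z m12)"
proof -
  have nz: "m12 \<noteq> 0" using lead by auto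
  define x where "x = m11 / m12"
  define y where "y = m22 / m12"
  have xy: "x \<in> deg_le 0" "y \<in> deg_le 0"
    using deg_le_divide[OF le(2) lead le(1)] deg_le_divide[OF le(2) lead le(3)] by (auto simp: x_def y_def)
  have "m21 = x * m22 - 1 / m12" using det nz by (simp add: x_def field_simps)
  hence "M4 0 0 0 z  0 m11 m12 0  0 m21 m22 0  (- 1 / z) 0 0 0
     = m4_mult (m4_mult (M4 1 0 0 0  0 1 0 0  0 y 1 0  0 0 0 1) (anti z m12)) (M4 1 0 0 0  0 1 0 0  0 x 1 0  0 0 0 1)"
    using nz by (simp add: anti_def m4_mult_M4 x_def y_def mult.commute)
  thus ?thesis
    by (rule keqI[rotated 2]) (auto intro!: middle_K4 xy)
qed

text \<open>The same elimination in SL2. Quarter turns on either side bring an entry of maximal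
  degree to the position that \<open>clear_middle_core\<close> expects.\<close>

lemma clear_middle:
  fixes z :: "'a::field fls"
  assumes det: "m11 * m22 - m12 * m21 = 1"
    and le: "m11 \<in> deg_le d" "m12 \<in> deg_le d" "m21 \<in> deg_le d" "m22 \<in> deg_le d"
  obtains w e where "keq (M4 0 0 0 z  0 m11 m12 0  0 m21 m22 0  (- 1 / z) 0 0 0) (anti z w)"
    "0 \<le> e" "e \<le> d" "w \<in> deg_le e" "w $$ (- e) \<noteq> 0"
proof -
  define m where "m = M4 0 0 0 0  0 m11 m12 0  0 m21 m22 0  0 0 0 0"
  have "m11 \<noteq> 0 \<or> m12 \<noteq> 0" using det by auto
  hence "m 1 1 \<noteq> 0 \<or> m 1 2 \<noteq> 0" by (simp add: m_def)
  then obtain c0 where "m 1 c0 \<noteq> 0" by blast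
  then obtain e r c where mx: "r < 4" "c < 4" "entries_le e m" "m r c $$ (- e) \<noteq> 0"
    using max_entry[of m 1 c0] unfolding m_def by (metis is_m4_M4)
  have me: "m11 \<in> deg_le e" "m12 \<in> deg_le e" "m21 \<in> deg_le e" "m22 \<in> deg_le e"
    using mx(3)[unfolded entries_le_def, rule_format, of 1 1] mx(3)[unfolded entries_le_def, rule_format, of 1 2]
      mx(3)[unfolded entries_le_def, rule_format, of 2 1] mx(3)[unfolded entries_le_def, rule_format, of 2 2]
    by (auto simp: m_def)
  \<comment> \<open>The determinant is 1, hence of degree 0, while its degree is at most 2 e; so the
    second exponent cannot be negative.\<close>
  have "m11 * m22 - m12 * m21 \<in> deg_le (2 * e)"
    using me by (intro deg_le_diff deg_le_mult'[of _ e _ e]) auto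
  hence e0: "0 \<le> e" using det deg_leD[of "1 :: 'a fls" "2 * e" 0] by (cases "0 < - (2 * e)") auto
  have md: "m r c \<in> deg_le d"
    using mx(1,2) le unfolding less_4_iff by (elim disjE) (simp_all add: m_def)
  have ed: "e \<le> d" using mx(4) deg_leD[OF md, of "- e"] by linarith
  let ?Z = "\<lambda>a b c d. M4 0 0 0 z  0 a b 0  0 c d 0  (- 1 / z) 0 0 0"
  let ?J = "M4 1 0 0 0  0 0 1 0  0 (-1) 0 0  0 0 0 1 :: 'a fls m4"
  have J: "?J \<in> K4" by (rule middle_K4) auto
  have right: "keq (?Z a b c d) (?Z (- b) a (- d) c)" for a b c d
  proof (rule keq_sym)
    have "?Z (- b) a (- d) c = m4_mult (?Z a b c d) ?J" by (simp add: m4_mult_M4)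
    thus "keq (?Z (- b) a (- d) c) (?Z a b c d)" using keq_right[OF J, of "?Z a b c d"] by simp
  qed simp
  have left: "keq (?Z a b c d) (?Z c d (- a) (- b))" for a b c d
  proof (rule keq_sym)
    have "?Z c d (- a) (- b) = m4_mult ?J (?Z a b c d)" by (simp add: m4_mult_M4)
    thus "keq (?Z c d (- a) (- b)) (?Z a b c d)" using keq_left[OF J, of "?Z a b c d"] by simp
  qed simp
  have "keq (?Z m11 m12 m21 m22) (anti z (m r c))"
  proof -
    consider "r = 1" "c = 1" | "r = 1" "c = 2" | "r = 2" "c = 1" | "r = 2" "c = 2"
      using mx(1,2,4) unfolding less_4_iff by (elim disjE) (simp_all add: m_def)
    thus ?thesis
    proof cases
      case 1
      hence "m r c = m11" by (simp add: m_def)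
      moreover have "keq (?Z (- m12) m11 (- m22) m21) (anti z m11)"
        using det me mx(4) calculation by (intro clear_middle_core[where e = e]) (auto simp: algebra_simps)
      ultimately show ?thesis using keq_trans[OF right] by simp
    next
      case 2
      hence eq: "m r c = m12" by (simp add: m_def)
      show ?thesis
        unfolding eq using det me mx(4) eq by (intro clear_middle_core[where e = e]) auto
    next
      case 3
      hence "m r c = m21" by (simp add: m_def)
      moreover have "keq (?Z (- m22) m21 m12 (- m11)) (anti z m21)"
        using det me mx(4) calculation by (intro clear_middle_core[where e = e]) (auto simp: algebra_simps)
      moreover have "keq (?Z m21 m22 (- m11) (- m12)) (?Z (- m22) m21 m12 (- m11))"
        using right[of m21 m22 "- m11" "- m12"] by simp
      ultimately show ?thesis using keq_trans[OF left keq_trans] by metis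
    next
      case 4
      hence "m r c = m22" by (simp add: m_def)
      moreover have "keq (?Z m21 m22 (- m11) (- m12)) (anti z m22)"
        using det me mx(4) calculation by (intro clear_middle_core[where e = e]) (auto simp: algebra_simps)
      ultimately show ?thesis using keq_trans[OF left] by simp
    qed
  qed
  moreover have "m r c \<in> deg_le e" using mx(3) by (simp add: entries_le_def)
  ultimately show ?thesis using e0 ed mx(4) that by blast
qed

text \<open>The Siegel unipotent radical, an abelian group: for this \<open>J\<close> the upper
  right block is symmetric about its antidiagonal. Among its minors is p^2 - r v.\<close>

definition U4 :: "'a::field fls \<Rightarrow> 'a fls \<Rightarrow> 'a fls \<Rightarrow> 'a fls m4" where
  "U4 r p v = M4 1 0 p r  0 1 v p  0 0 1 0  0 0 0 1"

text \<open>The usual diagonal representative has entries \<pi>^i and \<pi>^j, so in general it is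
  not in \<Gamma>. The unipotent one is, and the invariance of \<open>f\<close> applies to
  it.\<close>

abbreviation cartan_rep :: "nat \<Rightarrow> nat \<Rightarrow> 'a::field fls m4" where
  "cartan_rep i j \<equiv> U4 (t_pow i) 0 (t_pow j)"

lemma is_m4_U4 [simp]: "is_m4 (U4 r p v)"
  by (simp add: U4_def)

lemma U4_Sp4: "closed_ring R \<Longrightarrow> r \<in> R \<Longrightarrow> p \<in> R \<Longrightarrow> v \<in> R \<Longrightarrow> U4 r p v \<in> Sp4 R"
  by (intro Sp4I) (simp_all add: U4_def closed_ring_def ball_less_4)

lemma t_pow_nonzero [simp]: "t_pow n \<noteq> (0 :: 'a::field fls)"
  by (simp add: t_pow_def)

text \<open>In each of two orthogonal symplectic planes this is the SL2 identity writing an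
  antidiagonal matrix as a product of lower, upper and lower unipotents; the lower ones have entries
  -1/t^i and -1/t^j, hence lie in K.\<close>

lemma anti_keq_cartan_rep: "keq (anti (t_pow i) (t_pow j)) (cartan_rep i j :: 'a::field fls m4)"
proof -
  let ?L = "M4 1 0 0 0  0 1 0 0  0 (- 1 / t_pow j) 1 0  (- 1 / t_pow i) 0 0 1 :: 'a fls m4"
  have q: "1 / t_pow k \<in> (deg_le 0 :: 'a fls set)" for k
    using deg_le_divide[of "t_pow k" "int k" "1 :: 'a fls" 0] by (auto intro: deg_le_mono)
  have "?L \<in> K4" by (rule Sp4I) (use q in \<open>simp_all add: power_series_ring_eq ball_less_4\<close>)
  moreover have "anti (t_pow i) (t_pow j) = m4_mult (m4_mult ?L (cartan_rep i j)) ?L"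
    by (simp add: anti_def U4_def m4_mult_M4)
  ultimately show ?thesis by (intro keqI[of ?L ?L])
qed

lemma anti_normalise:
  fixes z w :: "'a::field fls"
  assumes z: "z \<in> deg_le (int i)" "z $$ (- int i) \<noteq> 0" and w: "w \<in> deg_le (int j)" "w $$ (- int j) \<noteq> 0"
  shows "keq (anti z w) (anti (t_pow i) (t_pow j))"
proof -
  have nz: "z \<noteq> 0" "w \<noteq> 0" using z w by auto
  let ?D = "M4 (z / t_pow i) 0 0 0  0 (w / t_pow j) 0 0  0 0 (t_pow j / w) 0  0 0 0 (t_pow i / z) :: 'a fls m4"
  have "z / t_pow i \<in> deg_le 0" "w / t_pow j \<in> deg_le 0" "t_pow j / w \<in> deg_le 0" "t_pow i / z \<in> deg_le 0"
    using deg_le_divide[of "t_pow i" "int i" z "int i"] deg_le_divide[of "t_pow j" "int j" w "int j"]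
      deg_le_divide[OF z, of "t_pow i" "int i"] deg_le_divide[OF w, of "t_pow j" "int j"] z w by auto
  hence "?D \<in> K4"
    by (intro Sp4I) (use nz in \<open>simp_all add: power_series_ring_eq ball_less_4\<close>)
  moreover have "anti z w = m4_mult ?D (anti (t_pow i) (t_pow j))"
    using nz by (simp add: anti_def m4_mult_M4)
  ultimately show ?thesis using keq_left[of ?D "anti (t_pow i) (t_pow j)"] by (simp add: anti_def)
qed

lemma cartan_decomposition:
  fixes g :: "'a::field fls m4"
  assumes g: "g \<in> Sp4 UNIV"
  obtains i j where "j \<le> i" "keq g (cartan_rep i j)"
proof -
  have gm: "is_m4 g" using g by (rule Sp4_is_m4)
  have "\<exists>r c. g r c \<noteq> 0" 
  proof (rule ccontr)
    assume "\<not> (\<exists>r c. g r c \<noteq> 0)"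
    thus False using Sp4D(3)[OF g] by simp
  qed
  then obtain d r c where mx: "r < 4" "c < 4" "entries_le d g" "g r c $$ (- d) \<noteq> 0"
    using max_entry[OF gm] by metis
  obtain k where k: "k \<in> (K4 :: 'a fls m4 set)" "\<And>g j. j < 4 \<Longrightarrow> m4_mult k g 0 j = g r j"
    using row_to_top[OF mx(1)] by metis
  obtain k' where k': "k' \<in> (K4 :: 'a fls m4 set)" "\<And>g i. i < 4 \<Longrightarrow> m4_mult g k' i 3 = g i c"
    using column_to_last[OF mx(2)] by metis
  define h where "h = m4_mult (m4_mult k g) k'"
  have hg: "keq h g" unfolding h_def by (rule keqI[OF k(1) k'(1) refl])
  have h03: "h 0 3 = g r c" using k'(2)[of 0] k(2)[OF mx(2)] by (simp add: h_def)
  have hle: "entries_le d h" by (rule entries_le_keq[OF hg mx(3)])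
  have hS: "h \<in> Sp4 UNIV" by (rule keq_Sp4[OF hg g])
  obtain m11 m12 m21 m22 where m:
    "keq h (M4 0 0 0 (h 0 3)  0 m11 m12 0  0 m21 m22 0  (- 1 / h 0 3) 0 0 0)"
    "m11 * m22 - m12 * m21 = 1"
    "m11 \<in> deg_le d" "m12 \<in> deg_le d" "m21 \<in> deg_le d" "m22 \<in> deg_le d"
    using clear_border[OF hS hle] mx(4) h03 by metis
  obtain w e where w: "keq (M4 0 0 0 (h 0 3)  0 m11 m12 0  0 m21 m22 0  (- 1 / h 0 3) 0 0 0) (anti (h 0 3) w)"
    "0 \<le> e" "e \<le> d" "w \<in> deg_le e" "w $$ (- e) \<noteq> 0"
    using clear_middle[OF m(2-6)] by metis
  have "keq (anti (h 0 3) w) (anti (t_pow (nat d)) (t_pow (nat e)))"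
  proof (rule anti_normalise)
    show "h 0 3 \<in> deg_le (int (nat d))" using hle w by (simp add: entries_le_def)
    show "h 0 3 $$ (- int (nat d)) \<noteq> 0" using mx(4) h03 w by simp
  qed (use w in auto)
  hence "keq h (cartan_rep (nat d) (nat e))"
    using keq_trans[OF m(1) keq_trans[OF w(1) keq_trans[OF _ anti_keq_cartan_rep]]] by simp
  hence "keq g (cartan_rep (nat d) (nat e))" using keq_sym[OF hg gm] by (rule keq_trans[rotated])
  thus ?thesis using w by (intro that[of "nat e" "nat d"]) auto
qed

lemma entries_le_U4:
  fixes r p v :: "'a::field fls"
  shows "entries_le d (U4 r p v) \<longleftrightarrow> (1 :: 'a fls) \<in> deg_le d \<and> r \<in> deg_le d \<and> p \<in> deg_le d \<and> v \<in> deg_le d"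
  unfolding entries_le_iff[OF is_m4_U4] by (simp add: U4_def ball_less_4 conj_ac)

lemma minors_le_U4:
  fixes r p v :: "'a::field fls"
  shows "minors_le d (U4 r p v) \<longleftrightarrow> (1 :: 'a fls) \<in> deg_le d \<and> r \<in> deg_le d \<and> p \<in> deg_le d \<and> v \<in> deg_le d
     \<and> p * p - r * v \<in> deg_le d"
  unfolding minors_le_iff[OF is_m4_U4] by (simp add: U4_def conj_ac)

lemma one_deg_le_iff: "(1 :: 'a::field fls) \<in> deg_le d \<longleftrightarrow> 0 \<le> d"
  using t_pow_deg_le[of 0 d] by simp

text \<open>The Cartan decomposition supplies some \<open>cartan_rep a b\<close>, whose entries and
  minors have maximal degrees a and a + b. Both degrees are unchanged by K on either side and so
  identify the representative: the type is read off without elimination.\<close>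

lemma keq_cartan_repI:
  fixes g :: "'a::field fls m4"
  assumes g: "g \<in> Sp4 UNIV"
    and e: "entries_le (int i) g" "\<not> entries_le (int i - 1) g"
    and m: "minors_le (int (i + j)) g" "\<not> minors_le (int (i + j) - 1) g"
  shows "keq g (cartan_rep i j)"
proof -
  obtain a b where ab: "b \<le> a" "keq g (cartan_rep a b)"
    by (rule cartan_decomposition[OF g], rule that)
  have ba: "keq (cartan_rep a b) g" by (rule keq_sym[OF ab(2)]) simp
  have E: "entries_le d g \<longleftrightarrow> int a \<le> d" for d
  proof -
    have "entries_le d g \<longleftrightarrow> entries_le d (cartan_rep a b :: 'a fls m4)"
      using entries_le_keq[OF ba] entries_le_keq[OF ab(2)] by (rule iffI)
    also have "\<dots> \<longleftrightarrow> int a \<le> d"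
      unfolding entries_le_U4 one_deg_le_iff t_pow_deg_le using ab(1) by auto
    finally show ?thesis .
  qed
  have M: "minors_le d g \<longleftrightarrow> int (a + b) \<le> d" for d
  proof -
    have "minors_le d g \<longleftrightarrow> minors_le d (cartan_rep a b :: 'a fls m4)"
      using minors_le_keq[OF ba] minors_le_keq[OF ab(2)] by (rule iffI)
    also have "\<dots> \<longleftrightarrow> int (a + b) \<le> d"
    proof -
      have "0 * 0 - t_pow a * t_pow b \<in> (deg_le d :: 'a fls set) \<longleftrightarrow> int (a + b) \<le> d"
        using t_pow_deg_le[of "a + b" d, where ?'a = 'a] by (simp only: t_pow_add) simp
      thus ?thesis
        unfolding minors_le_U4 one_deg_le_iff t_pow_deg_le using ab(1) by auto
    qed
    finally show ?thesis .
  qed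
  have "a = i" using E[of "int i"] E[of "int i - 1"] e by linarith
  moreover have "a + b = i + j" using M[of "int (i + j)"] M[of "int (i + j) - 1"] m by linarith
  ultimately show ?thesis using ab by simp
qed

section \<open>Moves between double cosets\<close>

text \<open>Translation by 1 permutes the field, so its cardinality is zero in it; with 2 = 0, odd
  cardinality would give 1 = 0.\<close>

lemma two_nonzero_of_odd_card:
  assumes "odd (card (UNIV :: 'k::{field,finite} set))"
  shows "(2 :: 'k) \<noteq> 0"
proof
  assume two: "(2 :: 'k) = 0"
  have "(\<Sum>x\<in>(UNIV :: 'k set). x) = (\<Sum>x\<in>UNIV. x + 1)"
    by (rule sum.reindex_bij_betw[symmetric]) (rule bij_plus_right)
  also have "\<dots> = (\<Sum>x\<in>UNIV. x) + of_nat (card (UNIV :: 'k set))" by (simp add: sum.distrib)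
  finally have "of_nat (card (UNIV :: 'k set)) = (0 :: 'k)" by simp
  moreover obtain m where "card (UNIV :: 'k set) = 2 * m + 1" using assms by (elim oddE)
  ultimately show False using two by simp
qed

abbreviation (input) \<Gamma>4 :: "'k::field fls m4 set" where
  "\<Gamma>4 \<equiv> Sp4 inv_poly_ring"

lemma U4_mult: "m4_mult (U4 r p v) (U4 r' p' v') = U4 (r + r') (p + p') (v + v')"
  by (simp add: U4_def m4_mult_M4 add.commute)

lemma U4_0: "U4 0 0 0 = m4_one"
  by (rule is_m4_eqI[OF is_m4_U4 is_m4_one]) (auto simp: U4_def m4_one_def less_4_iff)

lemma m4_inv_U4: "m4_inv (U4 r p v) = U4 (- r) (- p) (- v)"
  by (rule m4_inv_eqI) (simp_all add: U4_mult U4_0)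

lemma U4_inject: "U4 r p v = U4 r' p' v' \<longleftrightarrow> r = r' \<and> p = p' \<and> v = v'"
proof
  assume "U4 r p v = U4 r' p' v'"
  hence "U4 r p v i j = U4 r' p' v' i j" for i j by simp
  from this[of 0 3] this[of 0 2] this[of 1 2] show "r = r' \<and> p = p' \<and> v = v'"
    by (simp add: U4_def)
qed simp

lemma \<Gamma>4_imp_UNIV: "\<gamma> \<in> \<Gamma>4 \<Longrightarrow> \<gamma> \<in> Sp4 UNIV"
  by (erule Sp4_mono) simp

lemma polys_inv_poly: "x \<in> polys n \<Longrightarrow> x \<in> inv_poly_ring"
  by (simp add: polys_def)

lemma polys_deg_le: "x \<in> polys n \<Longrightarrow> int n - 1 \<le> d \<Longrightarrow> x \<in> deg_le d"
  by (auto simp: polys_def intro: deg_le_mono)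

lemma monic_of_diff:
  fixes w :: "'k::field fls"
  assumes "w - t_pow m \<in> deg_le (int n - 1)" "n \<le> m"
  shows "w \<in> deg_le (int m)" "w $$ (- int m) = 1"
proof -
  have "w - t_pow m \<in> deg_le (int m)" using assms by (auto intro: deg_le_mono)
  from deg_le_add[OF this, of "t_pow m"] show "w \<in> deg_le (int m)" by simp
  show "w $$ (- int m) = 1" using deg_leD[OF assms(1), of "- int m"] assms(2) by simp
qed

text \<open>Within the Siegel unipotent radical: the second invariant of \<open>U4 r p v\<close> is governed by
  the determinant \<open>p\<^sup>2 - r v\<close>, and fixing \<open>r\<close> turns it into a parabola.\<close>
lemma move_second_invariant:
  fixes f :: "'k::{field,finite} fls m4 \<Rightarrow> complex"
  assumes two: "(2 :: 'k) \<noteq> 0" and ij: "j < i" and p: "2 < p"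
    and inv: "\<And>\<gamma> \<gamma>'. \<gamma> \<in> \<Gamma>4 \<Longrightarrow> \<gamma>' \<in> \<Gamma>4 \<Longrightarrow> keq \<gamma> \<gamma>' \<Longrightarrow> f \<gamma> = f \<gamma>'"
    and N: "schur_mult_norm p \<Gamma>4 (\<lambda>x y. f (m4_mult (m4_inv x) y)) \<le> ereal N"
    and q: "q = real (card (UNIV :: 'k set))"
  shows "q ^ (i - j) * cmod (f (cartan_rep i (Suc j)) - f (cartan_rep i j))
    \<le> schatten_bound p (2 * q ^ (i - j + 4)) (2 * q ^ (i - j) * q ^ (2 * (i - j) + 1)) * N"
proof -
  define n where "n = i - j"
  have nn: "1 \<le> n" "i = j + n" using ij by (auto simp: n_def)
  \<comment> \<open>In -(y2 - h x2)^2 the cross term is 2 h x2 y2; the factor one half turns it into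
    the incidence term x2 y2. This is where odd q enters.\<close>
  define h where "h = fls_const (1 / 2 :: 'k)"
  have hh: "h + h = 1" using two by (simp add: h_def fls_plus_const)
  have h0: "h \<noteq> 0" using two by (simp add: h_def)
  have hd: "h * x \<in> deg_le d" if "x \<in> deg_le d" for x d using that by (simp add: h_def deg_le_def)
  have hp: "h * x \<in> inv_poly_ring" if "x \<in> inv_poly_ring" for x
    using that by (simp add: h_def inv_poly_ring_mult)
  have sq: "- (x * x) \<in> deg_le (2 * int n)" if "x \<in> deg_le (int n - 1)" for x :: "'k fls"
    using that by (auto intro: deg_le_mult')
  interpret incidence n "\<lambda>x. - ((h * x) * (h * x))" "\<lambda>y. - (y * y)" q
  proof
    fix x :: "'k fls" assume "x \<in> polys n"
    hence x: "x \<in> deg_le (int n - 1)" by (simp add: polys_def)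
    show "- (h * x * (h * x)) \<in> deg_le (2 * int n)" by (intro sq hd x)
    show "- (x * x) \<in> deg_le (2 * int n)" by (intro sq x)
  qed (use nn q in auto)
  \<comment> \<open>The whole corner t^i sits in \<open>gy\<close>, so all products share it and the
    first invariant is pinned to i. With the scaling by t^j the determinant p^2 - r v becomes
    -t^(2j) \<rho>, of degree i + j or i + j + 1 on the two levels.\<close>
  define gx :: "'k fls \<times> 'k fls \<Rightarrow> 'k fls m4" where "gx = (\<lambda>x. U4 0 (t_pow j * (h * fst x)) (t_pow j * snd x))"
  define gy :: "'k fls \<times> 'k fls \<Rightarrow> 'k fls m4" where "gy = (\<lambda>y. U4 (t_pow i) (t_pow j * fst y) (t_pow j * snd y))"
  have tp: "t_pow k \<in> inv_poly_ring" for k by simp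
  have gxG: "gx x \<in> \<Gamma>4" and gyG: "gy x \<in> \<Gamma>4" if "x \<in> X" for x
    using that tp unfolding gx_def gy_def X_def
    by (auto intro!: U4_Sp4 inv_poly_ring_mult hp dest: polys_inv_poly)
  have prod: "m4_mult (m4_inv (gx x)) (gy y)
      = U4 (t_pow i) (t_pow j * (fst y - h * fst x)) (t_pow j * (snd y - snd x))" for x y
    by (simp add: gx_def gy_def m4_inv_U4 U4_mult algebra_simps)
  have key: "f (m4_mult (m4_inv (gx x)) (gy y)) = f (cartan_rep i (j + \<epsilon>))"
    if x: "x \<in> X" and y: "y \<in> X" and r: "\<rho> x y - t_pow (n + \<epsilon>) \<in> deg_le (int n - 1)"
      and eps: "\<epsilon> \<le> 1" for x y \<epsilon>
  proof (rule inv)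
    have G: "m4_mult (m4_inv (gx x)) (gy y) \<in> \<Gamma>4"
      unfolding prod using x y tp unfolding X_def
      by (auto intro!: U4_Sp4 inv_poly_ring_mult hp inv_poly_ring_diff dest: polys_inv_poly)
    thus "m4_mult (m4_inv (gx x)) (gy y) \<in> \<Gamma>4" .
    show "cartan_rep i (j + \<epsilon>) \<in> \<Gamma>4" using tp by (auto intro!: U4_Sp4)
    note \<rho> = monic_of_diff[OF r le_add1]
    define P where "P = fst y - h * fst x"
    define V where "V = snd y - snd x"
    have "fst x \<in> deg_le (int n)" "fst y \<in> deg_le (int n)" "snd x \<in> deg_le (int n)" "snd y \<in> deg_le (int n)"
      using x y by (auto simp: X_def intro: polys_deg_le)
    hence P: "P \<in> deg_le (int n)" and V: "V \<in> deg_le (int n)"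
      unfolding P_def V_def by (intro deg_le_diff hd; simp)+
    have rho: "\<rho> x y = t_pow n * V - P * P"
    proof -
      have "\<rho> x y = t_pow n * (snd y - snd x) + (h + h) * (fst x * fst y)
          - h * fst x * (h * fst x) - fst y * fst y"
        unfolding \<rho>_def hh by simp
      also have "\<dots> = t_pow n * V - P * P" unfolding V_def P_def by (simp only: algebra_simps)
      finally show ?thesis .
    qed
    have det: "t_pow j * P * (t_pow j * P) - t_pow i * (t_pow j * V) = - (t_pow (2 * j) * \<rho> x y)"
      unfolding rho nn(2) mult_2 t_pow_add by (simp add: algebra_simps)
    have detle: "t_pow (2 * j) * \<rho> x y \<in> deg_le d \<longleftrightarrow> int (i + (j + \<epsilon>)) \<le> d" for d
    proof
      assume "int (i + (j + \<epsilon>)) \<le> d"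
      thus "t_pow (2 * j) * \<rho> x y \<in> deg_le d"
        using \<rho>(1) nn(2) by (auto intro: deg_le_mono)
    next
      assume "t_pow (2 * j) * \<rho> x y \<in> deg_le d"
      hence "\<rho> x y \<in> deg_le (d - int (2 * j))" by simp
      hence "\<not> - int (n + \<epsilon>) < - (d - int (2 * j))" using \<rho>(2) deg_leD by fastforce
      thus "int (i + (j + \<epsilon>)) \<le> d" using nn(2) by simp
    qed
    have PV: "t_pow j * P \<in> deg_le (int i)" "t_pow j * V \<in> deg_le (int i)" using P V nn(2) by simp_all
    show "keq (m4_mult (m4_inv (gx x)) (gy y)) (cartan_rep i (j + \<epsilon>))"
    proof (rule keq_cartan_repI[OF \<Gamma>4_imp_UNIV[OF G]])
      show "entries_le (int i) (m4_mult (m4_inv (gx x)) (gy y))"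
        unfolding prod entries_le_U4 P_def[symmetric] V_def[symmetric] using PV by simp
      show "\<not> entries_le (int i - 1) (m4_mult (m4_inv (gx x)) (gy y))"
        unfolding prod entries_le_U4 by simp
      show "minors_le (int (i + (j + \<epsilon>))) (m4_mult (m4_inv (gx x)) (gy y))"
        unfolding prod minors_le_U4 P_def[symmetric] V_def[symmetric] det deg_le_uminus detle
        using deg_le_mono[OF PV(1), of "int (i + (j + \<epsilon>))"] deg_le_mono[OF PV(2), of "int (i + (j + \<epsilon>))"]
        by (simp del: t_pow_mult_deg_le)
      show "\<not> minors_le (int (i + (j + \<epsilon>)) - 1) (m4_mult (m4_inv (gx x)) (gy y))"
        unfolding prod minors_le_U4 P_def[symmetric] V_def[symmetric] det deg_le_uminus detle by simp
    qed
  qed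
  have "q ^ n * cmod (f (cartan_rep i (Suc j)) - f (cartan_rep i j))
      \<le> schatten_bound p (2 * q ^ (n + 4)) (2 * q ^ n * q ^ (2 * n + 1)) * N"
  proof (rule multiplier_difference[OF _ _ _ _ p N])
    show "inj_on gx X" "inj_on gy X"
      using h0 by (auto simp: inj_on_def gx_def gy_def U4_inject prod_eq_iff)
    show "gx ` X \<subseteq> \<Gamma>4" "gy ` X \<subseteq> \<Gamma>4" using gxG gyG by auto
    show "f (m4_mult (m4_inv (gx x)) (gy y)) = f (cartan_rep i (Suc j))"
      if "x \<in> X" "y \<in> X" "\<rho> x y - t_pow (Suc n) \<in> deg_le (int n - 1)" for x y
      using key[of x y 1] that by simp
    show "f (m4_mult (m4_inv (gx x)) (gy y)) = f (cartan_rep i j)"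
      if "x \<in> X" "y \<in> X" "\<rho> x y - t_pow n \<in> deg_le (int n - 1)" for x y
      using key[of x y 0] that by simp
  qed
  thus ?thesis by (simp add: n_def)
qed

text \<open>Every upper unitriangular symplectic matrix has this form; \<open>a\<close> is the
  coordinate outside the Siegel radical. Multiplication by \<open>U4 z w 0\<close> creates the
  bilinear term \<open>a * w\<close> of \<open>U4_mult_G4\<close>, the source of the incidence
  relation in the second move.\<close>

definition G4 :: "'a::field fls \<Rightarrow> 'a fls \<Rightarrow> 'a fls \<Rightarrow> 'a fls \<Rightarrow> 'a fls m4" where
  "G4 s a w z = M4 1 a (w + s * a) z  0 1 s w  0 0 1 (- a)  0 0 0 1"

lemma U4_mult_G4: "m4_mult (U4 z w 0) (G4 s a 0 z') = G4 s a w (z' + z - a * w)"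
  by (simp add: U4_def G4_def m4_mult_M4 algebra_simps)

lemma is_m4_G4 [simp]: "is_m4 (G4 s a w z)"
  by (simp add: G4_def)

lemma G4_Sp4:
  assumes "closed_ring R" "s \<in> R" "a \<in> R" "w \<in> R" "z \<in> R"
  shows "G4 s a w z \<in> Sp4 R"
proof -
  have "0 \<in> R" "1 \<in> R" "w + s * a \<in> R" "- a \<in> R" using assms by (auto simp: closed_ring_def)
  thus ?thesis
    by (intro Sp4I) (use assms in \<open>simp_all add: G4_def ball_less_4 algebra_simps\<close>)
qed

lemma entries_le_G4:
  fixes s a w z :: "'a::field fls"
  shows "entries_le d (G4 s a w z) \<longleftrightarrow> (1 :: 'a fls) \<in> deg_le d \<and> a \<in> deg_le d \<and> w + s * a \<in> deg_le d \<and> z \<in> deg_le d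
     \<and> s \<in> deg_le d \<and> w \<in> deg_le d"
  unfolding entries_le_iff[OF is_m4_G4] by (simp add: G4_def ball_less_4 conj_ac)

lemma minors_le_G4I:
  fixes s a w z :: "'a::field fls"
  assumes "(1 :: 'a fls) \<in> deg_le d" "a \<in> deg_le d" "w + s * a \<in> deg_le d" "z \<in> deg_le d" "s \<in> deg_le d" "w \<in> deg_le d"
    "a * a \<in> deg_le d" "a * w \<in> deg_le d" "(w + s * a) * w \<in> deg_le d" "z * s \<in> deg_le d" "(w + s * a) * a \<in> deg_le d"
  shows "minors_le d (G4 s a w z)"
proof -
  have *: "a * w - z \<in> deg_le d" "(w + s * a) * w - z * s \<in> deg_le d"
    "- ((w + s * a) * a) - z \<in> deg_le d"
    using assms by (auto intro!: deg_le_diff)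
  have **: "a * s - (w + s * a) = - w" "- (s * a) - w = - (w + s * a)"
      "- w - s * a = - (w + s * a)"
    by (simp_all add: mult.commute)
  show ?thesis
    unfolding minors_le_iff[OF is_m4_G4] using assms * by (simp add: G4_def ** del: minus_add_distrib)
qed

text \<open>Here the element \<open>G4 s a w z\<close> has the sum of its two invariants determined by \<open>s\<close> and \<open>a\<close>
  (\<open>s = 0\<close> for an even sum, \<open>s\<close> of degree one for an odd sum), while \<open>z\<close> determines the first one.\<close>
lemma move_along_sum:
  fixes f :: "'k::{field,finite} fls m4 \<Rightarrow> complex"
  assumes ij: "2 \<le> j" "j \<le> i" and p: "2 < p"
    and inv: "\<And>\<gamma> \<gamma>'. \<gamma> \<in> \<Gamma>4 \<Longrightarrow> \<gamma>' \<in> \<Gamma>4 \<Longrightarrow> keq \<gamma> \<gamma>' \<Longrightarrow> f \<gamma> = f \<gamma>'"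
    and N: "schur_mult_norm p \<Gamma>4 (\<lambda>x y. f (m4_mult (m4_inv x) y)) \<le> ereal N"
    and q: "q = real (card (UNIV :: 'k set))"
  shows "q ^ j * cmod (f (cartan_rep (Suc i) (j - 1)) - f (cartan_rep i j))
    \<le> schatten_bound p (2 * q ^ (j + 4)) (2 * q ^ j * q ^ (2 * j + 1)) * N"
proof -
  \<comment> \<open>\<open>\<alpha>\<close> is the contribution of the fixed leading term t^m of
    \<open>a\<close> to the product a w; the variable part t^e y2 contributes x2 y2.\<close>
  interpret incidence j "\<lambda>x::'k fls. t_pow j * x" "\<lambda>y. 0" q
  proof
    fix x :: "'k fls" assume "x \<in> polys j"
    thus "t_pow j * x \<in> deg_le (2 * int j)" by (auto intro: polys_deg_le)
  qed (use ij q in auto)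
  \<comment> \<open>The sum is i + j = 2 m + \<sigma>. With \<open>a\<close> monic of degree m the
    minors reach degree 2 m, and for an odd sum \<open>s = t\<close> supplies the missing degree.
    The exponents e and e + \<sigma> in \<open>a\<close> and \<open>w\<close> make a w a multiple of
    t^(i-j).\<close>
  define e where "e = (i - j) div 2"
  define \<sigma> where "\<sigma> = (i - j) mod 2"
  define m where "m = e + j"
  have i: "i = 2 * e + \<sigma> + j" "\<sigma> \<le> 1" using ij by (auto simp: e_def \<sigma>_def)
  define s :: "'k fls" where "s = (if \<sigma> = 0 then 0 else t_pow 1)"
  have tp: "t_pow k \<in> inv_poly_ring" for k by simp
  have s: "s \<in> deg_le (int \<sigma>)" "s \<in> inv_poly_ring" using i(2) tp by (auto simp: s_def)
  define a :: "'k fls \<times> 'k fls \<Rightarrow> 'k fls" where "a = (\<lambda>y. t_pow m + t_pow e * fst y)"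
  define w :: "'k fls \<times> 'k fls \<Rightarrow> 'k fls" where "w = (\<lambda>x. t_pow (e + \<sigma>) * fst x)"
  define gx :: "'k fls \<times> 'k fls \<Rightarrow> 'k fls m4" where "gx = (\<lambda>x. U4 (t_pow i * snd x) (w x) 0)"
  define gy :: "'k fls \<times> 'k fls \<Rightarrow> 'k fls m4" where "gy = (\<lambda>y. G4 s (a y) 0 (t_pow i * snd y))"
  have aG: "a x \<in> inv_poly_ring" and wG: "w x \<in> inv_poly_ring" and zG: "t_pow i * snd x \<in> inv_poly_ring"
    if "x \<in> X" for x
    using that tp unfolding a_def w_def X_def
    by (auto intro!: inv_poly_ring_mult inv_poly_ring_add dest: polys_inv_poly)
  have gxG: "gx x \<in> \<Gamma>4" and gyG: "gy x \<in> \<Gamma>4" if "x \<in> X" for x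
    unfolding gx_def gy_def using aG[OF that] wG[OF that] zG[OF that] s by (auto intro!: U4_Sp4 G4_Sp4)
  have prod: "m4_mult (m4_inv (gx x)) (gy y) = G4 s (a y) (- w x) (t_pow (i - j) * \<rho> x y)" for x y
  proof -
    have t1: "t_pow i = t_pow (i - j) * (t_pow j :: 'k fls)" using ij by (simp flip: t_pow_add)
    have t2: "t_pow m * t_pow (e + \<sigma>) = t_pow (i - j) * (t_pow j :: 'k fls)"
    proof -
      have "m + (e + \<sigma>) = (i - j) + j" using i by (simp add: m_def)
      thus ?thesis by (metis t_pow_add)
    qed
    have t3: "t_pow e * t_pow (e + \<sigma>) = (t_pow (i - j) :: 'k fls)"
    proof -
      have "e + (e + \<sigma>) = i - j" using i by simp
      thus ?thesis by (metis t_pow_add)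
    qed
    have "a y * w x = (t_pow m * t_pow (e + \<sigma>)) * fst x + (t_pow e * t_pow (e + \<sigma>)) * (fst x * fst y)"
      by (simp add: a_def w_def algebra_simps)
    hence "a y * w x = t_pow (i - j) * t_pow j * fst x + t_pow (i - j) * (fst x * fst y)"
      unfolding t2 t3 .
    hence "t_pow i * snd y + - (t_pow i * snd x) - a y * - w x = t_pow (i - j) * \<rho> x y"
      unfolding t1 \<rho>_def by (simp add: algebra_simps)
    thus ?thesis by (simp add: gx_def gy_def m4_inv_U4 U4_mult_G4)
  qed
  have key: "f (m4_mult (m4_inv (gx x)) (gy y)) = f (cartan_rep (i + \<epsilon>) (j - \<epsilon>))"
    if x: "x \<in> X" and y: "y \<in> X" and r: "\<rho> x y - t_pow (j + \<epsilon>) \<in> deg_le (int j - 1)"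
      and eps: "\<epsilon> \<le> 1" for x y \<epsilon>
  proof (rule inv)
    have inverse: "m4_inv (gx x) \<in> \<Gamma>4"
      unfolding gx_def m4_inv_U4 using wG[OF x] zG[OF x] by (auto intro!: U4_Sp4)
    have G: "m4_mult (m4_inv (gx x)) (gy y) \<in> \<Gamma>4"
      by (intro Sp4_mult inverse gyG y) simp
    thus "m4_mult (m4_inv (gx x)) (gy y) \<in> \<Gamma>4" .
    show "cartan_rep (i + \<epsilon>) (j - \<epsilon>) \<in> \<Gamma>4" using tp by (auto intro!: U4_Sp4)
    define Z where "Z = t_pow (i - j) * \<rho> x y"
    define A where "A = a y"
    define W where "W = - w x"
    note \<rho> = monic_of_diff[OF r le_add1]
    have Z: "Z \<in> deg_le (int (i + \<epsilon>))" "Z $$ (- int (i + \<epsilon>)) = 1"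
    proof -
      have idx: "int (i + \<epsilon>) - int (i - j) = int (j + \<epsilon>)" "- int (i + \<epsilon>) + int (i - j) = - int (j + \<epsilon>)"
        using ij by auto
      show "Z \<in> deg_le (int (i + \<epsilon>))" unfolding Z_def t_pow_mult_deg_le idx by (rule \<rho>(1))
      show "Z $$ (- int (i + \<epsilon>)) = 1" unfolding Z_def t_pow_mult_nth idx by (rule \<rho>(2))
    qed
    have ey: "t_pow e * fst y \<in> deg_le (int m - 1)"
      using y by (auto simp: X_def m_def intro: polys_deg_le)
    have A: "A \<in> deg_le (int m)" "A $$ (- int m) = 1"
      using ey deg_leD[OF ey, of "- int m"]
      by (auto simp: A_def a_def intro!: deg_le_add intro: deg_le_mono)
    have W: "W \<in> deg_le (int m)"
      using x i(2) by (auto simp: X_def W_def w_def m_def intro: polys_deg_le)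
    have sA: "s * A \<in> deg_le (int m + int \<sigma>)" using s A by (auto intro: deg_le_mult')
    have WsA: "W + s * A \<in> deg_le (int m + int \<sigma>)"
      using sA W by (auto intro!: deg_le_add intro: deg_le_mono)
    have sum: "int (i + \<epsilon> + (j - \<epsilon>)) = 2 * int m + int \<sigma>" using i eps ij by (simp add: m_def)
    have Zs: "Z * s \<in> deg_le (2 * int m + int \<sigma>)"
      using i eps ij by (intro deg_le_mult'[OF Z(1) s(1)]) (simp add: m_def)
    have mi: "int m + int \<sigma> \<le> int (i + \<epsilon>)" using i by (simp add: m_def)
    \<comment> \<open>\<open>Z\<close> has degree i or i + 1 and also occurs in the minors;
      \<open>2 \<le> j\<close> keeps it below i + j, so it cannot disturb their leading
      coefficient.\<close>
    have Zlt: "int (i + \<epsilon>) < 2 * int m + int \<sigma>" using i eps ij by (simp add: m_def)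
    note prod' = prod[of x y, folded Z_def A_def W_def]
    show "keq (m4_mult (m4_inv (gx x)) (gy y)) (cartan_rep (i + \<epsilon>) (j - \<epsilon>))"
    proof (rule keq_cartan_repI[OF \<Gamma>4_imp_UNIV[OF G]])
      show "entries_le (int (i + \<epsilon>)) (m4_mult (m4_inv (gx x)) (gy y))"
        unfolding prod' entries_le_G4
        using deg_le_mono[OF A(1), of "int (i + \<epsilon>)"] deg_le_mono[OF WsA mi] Z(1)
          deg_le_mono[OF s(1), of "int (i + \<epsilon>)"] deg_le_mono[OF W, of "int (i + \<epsilon>)"] mi by simp
      show "\<not> entries_le (int (i + \<epsilon>) - 1) (m4_mult (m4_inv (gx x)) (gy y))"
      proof
        assume "entries_le (int (i + \<epsilon>) - 1) (m4_mult (m4_inv (gx x)) (gy y))"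
        hence "Z \<in> deg_le (int (i + \<epsilon>) - 1)" unfolding prod' entries_le_G4 by simp
        from deg_leD[OF this, of "- int (i + \<epsilon>)"] Z(2) show False by simp
      qed
      show "minors_le (int (i + \<epsilon> + (j - \<epsilon>))) (m4_mult (m4_inv (gx x)) (gy y))"
        unfolding prod' sum
      proof (rule minors_le_G4I)
        show "A * A \<in> deg_le (2 * int m + int \<sigma>)" "A * W \<in> deg_le (2 * int m + int \<sigma>)"
          using A W by (auto intro: deg_le_mult')
        show "(W + s * A) * W \<in> deg_le (2 * int m + int \<sigma>)" "(W + s * A) * A \<in> deg_le (2 * int m + int \<sigma>)"
          using A W WsA by (auto intro: deg_le_mult')
        show "Z \<in> deg_le (2 * int m + int \<sigma>)" using Z(1) Zlt by (auto intro: deg_le_mono)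
        show "W + s * A \<in> deg_le (2 * int m + int \<sigma>)" using WsA by (auto intro: deg_le_mono)
      qed (use A W s Zs in \<open>auto intro: deg_le_mono\<close>)
      show "\<not> minors_le (int (i + \<epsilon> + (j - \<epsilon>)) - 1) (m4_mult (m4_inv (gx x)) (gy y))"
        unfolding prod' sum
      proof
        assume min: "minors_le (2 * int m + int \<sigma> - 1) (G4 s A W Z)"
        show False
        proof (cases "\<sigma> = 0")
          case True
          \<comment> \<open>The minor on rows 0, 2 and columns 1, 3, counted from 0, is
            -A^2.\<close>
          have "A * A \<in> deg_le (2 * int m + int \<sigma> - 1)"
            using min[unfolded minors_le_def, rule_format, of 0 1 2 3] by (simp add: G4_def)
          from deg_leD[OF this, of "- (int m + int m)"] leading_nth_mult[OF A(1) A(1)] A(2) True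
          show False by simp
        next
          case False
          hence \<sigma>: "\<sigma> = 1" "s = t_pow 1" using i(2) by (auto simp: s_def)
          have "(W + s * A) $$ (- (int m + 1)) = 1"
            using \<sigma> A(2) deg_leD[OF W, of "- (int m + 1)"] by (simp add: add.commute)
          moreover have le: "W + s * A \<in> deg_le (int m + 1)" using WsA \<sigma> by simp
          ultimately have c: "((W + s * A) * A) $$ (- (int m + 1 + int m)) = 1"
            using leading_nth_mult[OF le A(1)] A(2) by simp
          \<comment> \<open>The minor on rows 0, 2 and columns 2, 3. Its leading term comes from s
            A^2, of degree 2 m + 1.\<close>
          have "(W + s * A) * (- A) - Z \<in> deg_le (2 * int m + int \<sigma> - 1)"
            using min[unfolded minors_le_def, rule_format, of 0 2 2 3] by (simp add: G4_def)
          from deg_leD[OF this, of "- (int m + 1 + int m)"]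
          have "((W + s * A) * A) $$ (- (int m + 1 + int m)) + Z $$ (- (int m + 1 + int m)) = 0"
            using \<sigma> by (simp add: add_eq_0_iff)
          moreover have "Z $$ (- (int m + 1 + int m)) = 0" using deg_leD[OF Z(1)] Zlt \<sigma> by simp
          ultimately show False using c by simp
        qed
      qed
    qed
  qed
  show ?thesis
  proof (rule multiplier_difference[OF _ _ _ _ p N])
    show "inj_on gx X"
      by (auto simp: inj_on_def gx_def U4_inject w_def prod_eq_iff)
    have "b = b' \<and> z = z'" if eq: "G4 s b 0 z = G4 s b' 0 z'" for b b' z z'
    proof -
      have "G4 s b 0 z i j = G4 s b' 0 z' i j" for i j using eq by simp
      from this[of 0 1] this[of 0 3] show ?thesis by (simp add: G4_def)
    qed
    thus "inj_on gy X"
      unfolding inj_on_def gy_def a_def by (fastforce simp: prod_eq_iff)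
    show "gx ` X \<subseteq> \<Gamma>4" "gy ` X \<subseteq> \<Gamma>4" using gxG gyG by auto
    show "f (m4_mult (m4_inv (gx x)) (gy y)) = f (cartan_rep (Suc i) (j - 1))"
      if "x \<in> X" "y \<in> X" "\<rho> x y - t_pow (Suc j) \<in> deg_le (int j - 1)" for x y
      using key[of x y 1] that by simp
    show "f (m4_mult (m4_inv (gx x)) (gy y)) = f (cartan_rep i j)"
      if "x \<in> X" "y \<in> X" "\<rho> x y - t_pow j \<in> deg_le (int j - 1)" for x y
      using key[of x y 0] that by simp
  qed
qed

text \<open>Both moves raise \<open>2 * i + j\<close> by one; choosing the first when \<open>2 * j < i\<close> and the second
  otherwise makes the errors geometrically small in that quantity.\<close>
lemma zigzag_decay:
  fixes F :: "nat \<Rightarrow> nat \<Rightarrow> complex" and D \<eta> :: real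
  assumes \<eta>: "0 < \<eta>" "\<eta> < 1" and D: "0 \<le> D"
    and A: "\<And>i j. j < i \<Longrightarrow> cmod (F i (Suc j) - F i j) \<le> D * (\<eta> ^ 6) ^ (i - j)"
    and B: "\<And>i j. 2 \<le> j \<Longrightarrow> j \<le> i \<Longrightarrow> cmod (F (Suc i) (j - 1) - F i j) \<le> D * (\<eta> ^ 6) ^ j"
    and fin: "\<And>i j. L \<le> 2 * i + j \<Longrightarrow> F i j = 0"
    and ij: "3 \<le> i" "j \<le> i"
  shows "cmod (F i j) \<le> D / (1 - \<eta>) * \<eta> ^ (2 * i + j)"
  using ij
proof (induction "L - (2 * i + j)" arbitrary: i j rule: less_induct)
  case less
  define \<kappa> where "\<kappa> = D / (1 - \<eta>)"
  show ?case
  proof (cases "L \<le> 2 * i + j")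
    case True
    thus ?thesis using fin[OF True] D \<eta> by simp
  next
    case False
    \<comment> \<open>The exponent 6 makes \<open>2 * i + j \<le> 6 * k\<close> hold for both moves:
      k = i - j when 2 j < i, and k = j when i \<le> 2 j. The errors then form a geometric series,
      whose sum \<open>\<kappa>\<close> is the fixed point of x \<mapsto> x \<eta> + D.\<close>
    have step: ?thesis if le: "i' \<ge> 3" "j' \<le> i'" "2 * i' + j' = Suc (2 * i + j)"
      and d: "cmod (F i' j' - F i j) \<le> D * (\<eta> ^ 6) ^ k" "2 * i + j \<le> 6 * k" for i' j' k
    proof -
      have "cmod (F i j) \<le> cmod (F i' j') + cmod (F i' j' - F i j)"
        by (metis norm_triangle_sub norm_minus_commute)
      also have "cmod (F i' j') \<le> \<kappa> * \<eta> ^ (2 * i' + j')"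
        unfolding \<kappa>_def by (rule less.hyps) (use le False in auto)
      also have "cmod (F i' j' - F i j) \<le> D * \<eta> ^ (2 * i + j)"
      proof -
        have "(\<eta> ^ 6) ^ k \<le> \<eta> ^ (2 * i + j)"
          unfolding power_mult[symmetric] using \<eta> d(2) by (intro power_decreasing) auto
        thus ?thesis using d(1) D mult_left_mono order_trans by blast
      qed
      finally have "cmod (F i j) \<le> (\<kappa> * \<eta> + D) * \<eta> ^ (2 * i + j)"
        unfolding le(3) by (simp add: algebra_simps)
      also have "\<kappa> * \<eta> + D = \<kappa>" using \<eta> by (simp add: \<kappa>_def field_simps)
      finally show ?thesis by (simp add: \<kappa>_def)
    qed
    show ?thesis
    proof (cases "2 * j < i")
      case True
      thus ?thesis using less.prems by (intro step[of i "Suc j" "i - j"] A) auto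
    next
      case False
      \<comment> \<open>From 3 \<le> i \<le> 2 j follows \<open>2 \<le> j\<close>, as
        \<open>B\<close> requires; hence the restriction to i \<ge> 3.\<close>
      thus ?thesis using less.prems by (intro step[of "Suc i" "j - 1" j] B) auto
    qed
  qed
qed

text \<open>For symplectic matrices this is the first Cartan invariant i. On \<Gamma> it is proper,
  since only finitely many polynomial matrices have bounded degree.\<close>

definition m4_deg :: "'a::field fls m4 \<Rightarrow> nat" where
  "m4_deg g = (LEAST d. entries_le (int d) g)"

lemma entries_le_cartan_rep: "j \<le> i \<Longrightarrow> entries_le (int i) (cartan_rep i j :: 'a::field fls m4)"
  by (simp add: entries_le_U4)

lemma entries_le_m4_deg:
  assumes "g \<in> Sp4 UNIV"
  shows "entries_le (int (m4_deg g)) g"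
proof -
  obtain i j where ij: "j \<le> i" "keq g (cartan_rep i j)"
    by (rule cartan_decomposition[OF assms], rule that)
  have "entries_le (int i) g" by (rule entries_le_keq[OF ij(2) entries_le_cartan_rep[OF ij(1)]])
  thus ?thesis unfolding m4_deg_def by (rule LeastI)
qed

lemma finite_Gamma_entries_le:
  "finite {\<gamma> \<in> \<Gamma>4. entries_le (int d) (\<gamma> :: 'k::{field,finite} fls m4)}"
proof -
  let ?B = "{..<4::nat} \<times> {..<4::nat} \<rightarrow>\<^sub>E (polys (d + 1) :: 'k fls set)"
  let ?h = "\<lambda>g i j. if i < (4::nat) \<and> j < (4::nat) then g (i, j) else (0 :: 'k fls)"
  have "{\<gamma> \<in> \<Gamma>4. entries_le (int d) (\<gamma> :: 'k fls m4)} \<subseteq> ?h ` ?B"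
  proof
    fix \<gamma> :: "'k fls m4" assume \<gamma>: "\<gamma> \<in> {\<gamma> \<in> \<Gamma>4. entries_le (int d) \<gamma>}"
    define g where "g = (\<lambda>x\<in>{..<4::nat} \<times> {..<4::nat}. \<gamma> (fst x) (snd x))"
    have "g \<in> ?B"
      unfolding g_def using \<gamma> by (subst restrict_PiE_iff) (auto simp: Sp4_def entries_le_def polys_def)
    moreover have "\<gamma> = ?h g"
      by (rule is_m4_eqI) (use \<gamma> in \<open>auto simp: g_def Sp4_def is_m4_def\<close>)
    ultimately show "\<gamma> \<in> ?h ` ?B" by blast
  qed
  moreover have "finite ?B" by (intro finite_PiE) auto
  ultimately show ?thesis using finite_subset by blast
qed

theorem theorem2p7:
  fixes p :: ereal
  assumes "odd (card (UNIV :: ('k::{field,finite}) set))"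
    and "4 < p"
  shows "\<exists>\<phi> :: 'k fls m4 \<Rightarrow> real.
     (\<forall>\<epsilon>>0. finite {\<gamma> \<in> Sp4 inv_poly_ring. \<epsilon> \<le> \<bar>\<phi> \<gamma>\<bar>}) \<and>
     (\<forall>f :: 'k fls m4 \<Rightarrow> complex.
        finite {\<gamma> \<in> Sp4 inv_poly_ring. f \<gamma> \<noteq> 0} \<and>
        (\<forall>\<gamma>\<in>Sp4 inv_poly_ring. \<forall>\<gamma>'\<in>Sp4 inv_poly_ring.
            \<gamma> \<in> double_coset (Sp4 power_series_ring) \<gamma>' \<longrightarrow> f \<gamma> = f \<gamma>')
        \<longrightarrow> (\<forall>\<gamma>\<in>Sp4 inv_poly_ring.
              ereal (cmod (f \<gamma>)) \<le> ereal (\<phi> \<gamma>) *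
                schur_mult_norm p (Sp4 inv_poly_ring) (\<lambda>x y. f (m4_mult (m4_inv x) y))))"
proof -
  have two: "(2 :: 'k) \<noteq> 0" by (rule two_nonzero_of_odd_card) fact
  define q where "q = real (card (UNIV :: 'k set))"
  have "card {0, 1 :: 'k} \<le> card (UNIV :: 'k set)" by (intro card_mono) auto
  hence q1: "1 < q" by (simp add: q_def)
  have p2: "2 < p" using assms(2) by (cases p) auto
  obtain C \<theta> :: real where C: "0 < C" and \<theta>: "0 < \<theta>" "\<theta> < 1"
    and bound: "\<And>n. schatten_bound p (2 * q ^ (n + 4)) (2 * q ^ n * q ^ (2 * n + 1)) = C * \<theta> ^ n * q ^ n"
    by (rule schatten_bound_incidence[OF assms(2) q1], rule that)
  \<comment> \<open>The sixth root converts the rate \<theta> per unit of n into a rate per unit of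
    2 i + j.\<close>
  define \<eta> where "\<eta> = root 6 \<theta>"
  have \<eta>: "0 < \<eta>" "\<eta> < 1" "\<eta> ^ 6 = \<theta>" using \<theta> by (simp_all add: \<eta>_def)
  \<comment> \<open>The first summand comes from the zigzag, available for i \<ge> 3; the second
    covers i \<le> 2, where the one-index test is used and \<eta>^i \<ge> \<eta>^3.\<close>
  define c where "c = C / (1 - \<eta>) + 1 / \<eta> ^ 3"
  have c: "0 < c" using C \<eta> by (simp add: c_def add_pos_pos)
  define \<phi> :: "'k fls m4 \<Rightarrow> real" where "\<phi> = (\<lambda>\<gamma>. c * \<eta> ^ m4_deg \<gamma>)"
  have \<phi>: "\<phi> \<gamma> > 0" for \<gamma> using c \<eta> by (simp add: \<phi>_def)
  have C0: "finite {\<gamma> \<in> \<Gamma>4. \<epsilon> \<le> \<bar>\<phi> \<gamma>\<bar>}" if \<epsilon>: "\<epsilon> > 0" for \<epsilon>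
  proof -
    obtain d where d: "\<eta> ^ d < \<epsilon> / c" using real_arch_pow_inv[of "\<epsilon> / c" \<eta>] \<epsilon> c \<eta> by auto
    have "{\<gamma> \<in> \<Gamma>4. \<epsilon> \<le> \<bar>\<phi> \<gamma>\<bar>} \<subseteq> {\<gamma> \<in> \<Gamma>4. entries_le (int d) \<gamma>}"
    proof clarify
      fix \<gamma> :: "'k fls m4" assume \<gamma>: "\<gamma> \<in> \<Gamma>4" "\<epsilon> \<le> \<bar>\<phi> \<gamma>\<bar>"
      have "m4_deg \<gamma> \<le> d"
      proof (rule ccontr)
        assume "\<not> m4_deg \<gamma> \<le> d"
        hence "\<eta> ^ m4_deg \<gamma> \<le> \<eta> ^ d" using \<eta> by (intro power_decreasing) auto
        hence "c * \<eta> ^ m4_deg \<gamma> < \<epsilon>" using d c by (simp add: field_simps) (metis mult.commute mult_le_cancel_left_pos order_le_less_trans)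
        thus False using \<gamma>(2) \<phi>[of \<gamma>] by (simp add: \<phi>_def)
      qed
      thus "entries_le (int d) \<gamma>"
        using entries_le_m4_deg[OF \<Gamma>4_imp_UNIV[OF \<gamma>(1)]] unfolding entries_le_def
        by (meson deg_le_mono of_nat_mono)
    qed
    thus ?thesis using finite_Gamma_entries_le finite_subset by blast
  qed
  have main: "ereal (cmod (f \<gamma>)) \<le> ereal (\<phi> \<gamma>) * schur_mult_norm p \<Gamma>4 (\<lambda>x y. f (m4_mult (m4_inv x) y))"
    if fin: "finite {\<gamma> \<in> \<Gamma>4. f \<gamma> \<noteq> 0}"
      and inv: "\<And>\<gamma> \<gamma>'. \<gamma> \<in> \<Gamma>4 \<Longrightarrow> \<gamma>' \<in> \<Gamma>4 \<Longrightarrow> keq \<gamma> \<gamma>' \<Longrightarrow> f \<gamma> = f \<gamma>'"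
      and \<gamma>: "\<gamma> \<in> \<Gamma>4" for f :: "'k fls m4 \<Rightarrow> complex" and \<gamma>
  proof -
    define M where "M = (\<lambda>x y. f (m4_mult (m4_inv x) y))"
    have one: "m4_one \<in> (\<Gamma>4 :: 'k fls m4 set)" by simp
    have "m4_inv m4_one = (m4_one :: 'k fls m4)" by (rule m4_inv_eqI) auto
    hence M1: "M m4_one \<delta> = f \<delta>" if "\<delta> \<in> \<Gamma>4" for \<delta>
      using Sp4_is_m4[OF that] by (simp add: M_def)
    have triv: "cmod (f \<delta>) \<le> N" if "schur_mult_norm p \<Gamma>4 M \<le> ereal N" "\<delta> \<in> \<Gamma>4" for N \<delta>
      using schur_mult_norm_coefficient[OF one that(2) p2 that(1)] M1[OF that(2)] by simp
    have fin_case: "cmod (f \<gamma>) \<le> \<phi> \<gamma> * N" if N: "schur_mult_norm p \<Gamma>4 M \<le> ereal N" for N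
    proof -
      have N0: "0 \<le> N" using triv[OF N one] norm_ge_zero order_trans by blast
      define F where "F = (\<lambda>i j. f (cartan_rep i j))"
      have rep: "cartan_rep i j \<in> (\<Gamma>4 :: 'k fls m4 set)" for i j
        by (auto intro!: U4_Sp4)
      have cancel: "x \<le> C * N * \<theta> ^ n" if "q ^ n * x \<le> C * \<theta> ^ n * q ^ n * N" for x n
      proof -
        have "q ^ n * x \<le> q ^ n * (C * N * \<theta> ^ n)" using that by (simp add: mult_ac)
        thus ?thesis using q1 by simp
      qed
      have A: "cmod (F i (Suc j) - F i j) \<le> C * N * (\<eta> ^ 6) ^ (i - j)" if "j < i" for i j
        unfolding \<eta>(3) F_def
        by (intro cancel move_second_invariant[OF two that p2 inv N[unfolded M_def] q_def, unfolded bound])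
      have B: "cmod (F (Suc i) (j - 1) - F i j) \<le> C * N * (\<eta> ^ 6) ^ j" if "2 \<le> j" "j \<le> i" for i j
        unfolding \<eta>(3) F_def
        by (intro cancel move_along_sum[OF that p2 inv N[unfolded M_def] q_def, unfolded bound])
      \<comment> \<open>Distinct pairs give distinct elements of \<Gamma>, so finite support of
        \<open>f\<close> leaves finitely many nonzero \<open>F i j\<close> and provides the end
        \<open>L\<close> of the zigzag; the final bound does not involve \<open>L\<close>.\<close>
      have "inj (\<lambda>x. cartan_rep (fst x) (snd x) :: 'k fls m4)"
      proof (rule injI)
        fix x y assume "(cartan_rep (fst x) (snd x) :: 'k fls m4) = cartan_rep (fst y) (snd y)"
        hence "t_pow (fst x) = (t_pow (fst y) :: 'k fls)" "t_pow (snd x) = (t_pow (snd y) :: 'k fls)"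
          by (simp_all add: U4_inject)
        hence "t_pow (fst x) $$ (- int (fst x)) = (t_pow (fst y) $$ (- int (fst x)) :: 'k)"
          "t_pow (snd x) $$ (- int (snd x)) = (t_pow (snd y) $$ (- int (snd x)) :: 'k)" by simp_all
        thus "x = y" by (simp add: prod_eq_iff split: if_splits)
      qed
      hence "finite {x. f (cartan_rep (fst x) (snd x)) \<noteq> 0}"
        using finite_vimageI[OF fin, of "\<lambda>x. cartan_rep (fst x) (snd x)"] rep by (simp add: vimage_def)
      hence "finite ((\<lambda>x. 2 * fst x + snd x) ` {x. F (fst x) (snd x) \<noteq> 0})" by (simp add: F_def)
      then obtain L where "\<forall>k\<in>(\<lambda>x. 2 * fst x + snd x) ` {x. F (fst x) (snd x) \<noteq> 0}. k < L"
        using finite_nat_set_iff_bounded by blast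
      hence L: "F i j = 0" if "L \<le> 2 * i + j" for i j using that by fastforce
      obtain i j where ij: "j \<le> i" "keq \<gamma> (cartan_rep i j)"
        by (rule cartan_decomposition[OF \<Gamma>4_imp_UNIV[OF \<gamma>]], rule that)
      have f\<gamma>: "f \<gamma> = F i j" unfolding F_def by (rule inv[OF \<gamma> rep ij(2)])
      have "m4_deg \<gamma> \<le> i"
        unfolding m4_deg_def
        by (rule Least_le) (rule entries_le_keq[OF ij(2) entries_le_cartan_rep[OF ij(1)]])
      hence deg: "\<eta> ^ i \<le> \<eta> ^ m4_deg \<gamma>" using \<eta> by (intro power_decreasing) auto
      have "cmod (F i j) \<le> c * \<eta> ^ i * N"
      proof (cases "3 \<le> i")
        case True
        have "cmod (F i j) \<le> C * N / (1 - \<eta>) * \<eta> ^ (2 * i + j)"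
          by (rule zigzag_decay[OF \<eta>(1,2) _ A B L True ij(1)]) (use C N0 in auto)
        \<comment> \<open>The extra decay in i + j is given up, because \<open>\<phi>\<close> is a
          function of the degree alone.\<close>
        also have "\<dots> \<le> C * N / (1 - \<eta>) * \<eta> ^ i"
          using C N0 \<eta> by (intro mult_left_mono power_decreasing) auto
        also have "\<dots> \<le> c * \<eta> ^ i * N"
          using N0 \<eta> by (simp add: c_def algebra_simps)
        finally show ?thesis .
      next
        case False
        have "cmod (F i j) \<le> N" unfolding F_def by (rule triv[OF N rep])
        also have "N \<le> 1 / \<eta> ^ 3 * \<eta> ^ i * N"
        proof -
          have "\<eta> ^ 3 \<le> \<eta> ^ i" using False \<eta> by (intro power_decreasing) auto
          hence "1 \<le> 1 / \<eta> ^ 3 * \<eta> ^ i" using \<eta> by simp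
          thus ?thesis using N0 mult_right_mono[of 1 "1 / \<eta> ^ 3 * \<eta> ^ i" N] by simp
        qed
        also have "\<dots> \<le> c * \<eta> ^ i * N"
          using N0 \<eta> C by (intro mult_right_mono) (auto simp: c_def)
        finally show ?thesis .
      qed
      also have "\<dots> \<le> \<phi> \<gamma> * N"
        unfolding \<phi>_def using deg c N0 by (intro mult_right_mono mult_left_mono) auto
      finally show ?thesis unfolding f\<gamma> .
    qed
    show ?thesis
    proof (cases "schur_mult_norm p \<Gamma>4 M")
      case (real N)
      thus ?thesis using fin_case[of N] \<phi>[of \<gamma>] unfolding M_def[symmetric] by simp
    next
      case PInf
      thus ?thesis using \<phi>[of \<gamma>] unfolding M_def[symmetric] by simp
    next
      \<comment> \<open>Impossible: the one-index test at the identity would bound a modulus by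
        -1.\<close>
      case MInf
      hence "schur_mult_norm p \<Gamma>4 M \<le> ereal (- 1)" by simp
      from triv[OF this one] have "cmod (f m4_one) \<le> - 1" .
      thus ?thesis using norm_ge_zero[of "f m4_one"] by linarith
    qed
  qed
  show ?thesis
  proof (intro exI[of _ \<phi>] conjI allI impI ballI)
    show "finite {\<gamma> \<in> Sp4 inv_poly_ring. \<epsilon> \<le> \<bar>\<phi> \<gamma>\<bar>}" if "\<epsilon> > 0" for \<epsilon> using C0[OF that] .
    fix f :: "'k fls m4 \<Rightarrow> complex" and \<gamma> :: "'k fls m4"
    assume f: "finite {\<gamma> \<in> Sp4 inv_poly_ring. f \<gamma> \<noteq> 0} \<and>
        (\<forall>\<gamma>\<in>Sp4 inv_poly_ring. \<forall>\<gamma>'\<in>Sp4 inv_poly_ring.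
            \<gamma> \<in> double_coset (Sp4 power_series_ring) \<gamma>' \<longrightarrow> f \<gamma> = f \<gamma>')"
      and \<gamma>: "\<gamma> \<in> Sp4 inv_poly_ring"
    show "ereal (cmod (f \<gamma>)) \<le> ereal (\<phi> \<gamma>) *
                schur_mult_norm p (Sp4 inv_poly_ring) (\<lambda>x y. f (m4_mult (m4_inv x) y))"
      by (rule main[OF _ _ \<gamma>]) (use f in \<open>auto simp: keq_def\<close>)
  qed
qed

end
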